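(* There is an algorithm that, given a bicolored tree $T$ on $n$ vertices, solves the Balanced Connected Subgraph problem (BCS) on $T$ in $O(n^2)$ time.
   Context: All graphs are finite, simple and undirected. A graph is bicolored if every vertex is colored blue or red (adjacent vertices may have the same color); $B$ and $R$ denote the sets of blue and red vertices. The Balanced Connected Subgraph problem (BCS): the input is a bicolored graph $G=(B\cup R,E)$; the output is a connected induced subgraph $H$ of $G$ with $|V(H)\cap B|=|V(H)\cap R|$ having the maximum number of vertices. The empty subgraph (of size $0$) counts as feasible, so an optimum always exists. Running times are in the standard unit-cost RAM model. *)

theory Defs
  imports Main "HOL-Library.Landau_Symbols"
begin

section \<open>Finite simple graphs and trees\<close>

text \<open>
  A graph is given by its vertex set \<open>V\<close> and its set \<open>E\<close> of edges, an edge being the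
  two-element set of its endpoints. (The notion \<open>tree\<close> for digraphs in the AFP entry
  Graph\_Theory only excludes directed cycles: a symmetric digraph with an edge always contains
  the directed cycle \<open>u \<rightarrow> v \<rightarrow> u\<close>, so it does not describe undirected trees.)
\<close>

definition simple_graph :: "'a set \<Rightarrow> 'a set set \<Rightarrow> bool" where
  "simple_graph V E \<longleftrightarrow>
     finite V \<and> (\<forall>e\<in>E. \<exists>u\<in>V. \<exists>v\<in>V. u \<noteq> v \<and> e = {u, v})"

definition connected_graph :: "'a set \<Rightarrow> 'a set set \<Rightarrow> bool" where
  "connected_graph V E \<longleftrightarrow>
     V \<noteq> {} \<and> (\<forall>u\<in>V. \<forall>v\<in>V. (u, v) \<in> {(x, y). {x, y} \<in> E}\<^sup>*)"

definition cycle :: "'a set set \<Rightarrow> 'a list \<Rightarrow> bool" where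
  "cycle E vs \<longleftrightarrow>
     length vs \<ge> 3 \<and> distinct vs \<and>
     (\<forall>i. Suc i < length vs \<longrightarrow> {vs ! i, vs ! Suc i} \<in> E) \<and> {last vs, hd vs} \<in> E"

definition is_tree :: "'a set \<Rightarrow> 'a set set \<Rightarrow> bool" where
  "is_tree V E \<longleftrightarrow> simple_graph V E \<and> connected_graph V E \<and> (\<nexists>vs. cycle E vs)"

definition induced_edges :: "'a set set \<Rightarrow> 'a set \<Rightarrow> 'a set set" where
  "induced_edges E W = {e \<in> E. e \<subseteq> W}"


section \<open>Balanced connected subgraphs\<close>

datatype colour = Blue | Red

text \<open>
  An induced subgraph is identified with its vertex set \<open>W\<close>; the empty one is feasible.
\<close>

definition balanced_connected_subgraph ::
  "'a set \<Rightarrow> 'a set set \<Rightarrow> ('a \<Rightarrow> colour) \<Rightarrow> 'a set \<Rightarrow> bool" where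
  "balanced_connected_subgraph V E col W \<longleftrightarrow>
     W \<subseteq> V \<and>
     (W = {} \<or> connected_graph W (induced_edges E W)) \<and>
     card {v \<in> W. col v = Blue} = card {v \<in> W. col v = Red}"

definition bcs_solution ::
  "'a set \<Rightarrow> 'a set set \<Rightarrow> ('a \<Rightarrow> colour) \<Rightarrow> 'a set \<Rightarrow> bool" where
  "bcs_solution V E col W \<longleftrightarrow>
     balanced_connected_subgraph V E col W \<and>
     (\<forall>W'. balanced_connected_subgraph V E col W' \<longrightarrow> card W' \<le> card W)"


section \<open>The unit-cost random access machine\<close>

text \<open>
  This is the machine of Cook and Reckhow over the natural numbers: infinitely many registers,
  initially \<open>0\<close>, each holding a natural number; a read-only input tape and a write-only output
  tape; addition, truncated subtraction and indirect addressing, but no multiplication (with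
  multiplication at unit cost one could compute with exponentially long numbers).
  Below \<open>X\<^sub>i\<close> is the content of register \<open>i\<close>.
\<close>

datatype instr =
    Const nat nat       \<comment> \<open>\<open>Const i c\<close>: \<open>X\<^sub>i := c\<close>\<close>
  | Add nat nat nat     \<comment> \<open>\<open>Add i j k\<close>: \<open>X\<^sub>i := X\<^sub>j + X\<^sub>k\<close>\<close>
  | Sub nat nat nat     \<comment> \<open>\<open>Sub i j k\<close>: \<open>X\<^sub>i := X\<^sub>j - X\<^sub>k\<close>\<close>
  | Load nat nat        \<comment> \<open>\<open>Load i j\<close>: assign to \<open>X\<^sub>i\<close> the content of the register with address \<open>X\<^sub>j\<close>\<close>
  | Store nat nat       \<comment> \<open>\<open>Store i j\<close>: assign \<open>X\<^sub>j\<close> to the register with address \<open>X\<^sub>i\<close>\<close>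
  | JumpPos nat nat     \<comment> \<open>\<open>JumpPos i l\<close>: continue at instruction \<open>l\<close> if \<open>X\<^sub>i > 0\<close>\<close>
  | Read nat            \<comment> \<open>\<open>Read i\<close>: move the next input number to \<open>X\<^sub>i\<close>\<close>
  | Print nat           \<comment> \<open>\<open>Print i\<close>: append \<open>X\<^sub>i\<close> to the output\<close>

record config =
  pc :: nat
  mem :: "nat \<Rightarrow> nat"
  inp :: "nat list"
  out :: "nat list"

text \<open>Reading beyond the end of the input has no result: the machine gets stuck.\<close>

fun exec :: "instr \<Rightarrow> config \<Rightarrow> config option" where
  "exec (Const i c) s = Some (s\<lparr>pc := Suc (pc s), mem := (mem s)(i := c)\<rparr>)"
| "exec (Add i j k) s = Some (s\<lparr>pc := Suc (pc s), mem := (mem s)(i := mem s j + mem s k)\<rparr>)"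
| "exec (Sub i j k) s = Some (s\<lparr>pc := Suc (pc s), mem := (mem s)(i := mem s j - mem s k)\<rparr>)"
| "exec (Load i j) s = Some (s\<lparr>pc := Suc (pc s), mem := (mem s)(i := mem s (mem s j))\<rparr>)"
| "exec (Store i j) s = Some (s\<lparr>pc := Suc (pc s), mem := (mem s)(mem s i := mem s j)\<rparr>)"
| "exec (JumpPos i l) s = Some (s\<lparr>pc := (if mem s i > 0 then l else Suc (pc s))\<rparr>)"
| "exec (Read i) s =
     (case inp s of
        [] \<Rightarrow> None
      | x # xs \<Rightarrow> Some (s\<lparr>pc := Suc (pc s), mem := (mem s)(i := x), inp := xs\<rparr>))"
| "exec (Print i) s = Some (s\<lparr>pc := Suc (pc s), out := out s @ [mem s i]\<rparr>)"

definition ram_step :: "instr list \<Rightarrow> config \<Rightarrow> config \<Rightarrow> bool" where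
  "ram_step P s s' \<longleftrightarrow> pc s < length P \<and> exec (P ! pc s) s = Some s'"

definition initial_config :: "nat list \<Rightarrow> config" where
  "initial_config xs = \<lparr>pc = 0, mem = (\<lambda>_. 0), inp = xs, out = []\<rparr>"

text \<open>
  The program \<open>P\<close>, started on input \<open>xs\<close>, executes exactly \<open>k\<close> instructions, then halts by leaving
  the program, and has printed \<open>ys\<close>.
\<close>

definition ram_computes :: "instr list \<Rightarrow> nat list \<Rightarrow> nat \<Rightarrow> nat list \<Rightarrow> bool" where
  "ram_computes P xs k ys \<longleftrightarrow>
     (\<exists>s. (ram_step P ^^ k) (initial_config xs) s \<and> length P \<le> pc s \<and> out s = ys)"


section \<open>Bicolored graphs as machine input\<close>

fun colour_code :: "colour \<Rightarrow> nat" where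
  "colour_code Blue = 0"
| "colour_code Red = 1"

text \<open>
  \<open>encodes_graph xs n E col\<close>: the input \<open>xs\<close> describes the bicolored graph with vertices
  \<open>0, \<dots>, n - 1\<close>, edges \<open>E\<close> and colouring \<open>col\<close>. It consists of the number of vertices, the number
  of edges, the colours of the vertices, and a list of all edges, each occurring once. The order
  of the edges and the orientation in which each of them is listed are arbitrary.
\<close>

definition encodes_graph ::
  "nat list \<Rightarrow> nat \<Rightarrow> nat set set \<Rightarrow> (nat \<Rightarrow> colour) \<Rightarrow> bool" where
  "encodes_graph xs n E col \<longleftrightarrow>
     (\<exists>es. distinct (map (\<lambda>(u, v). {u, v}) es) \<and> set (map (\<lambda>(u, v). {u, v}) es) = E \<and>
        xs = [n, length es] @ map (\<lambda>v. colour_code (col v)) [0..<n] @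
             concat (map (\<lambda>(u, v). [u, v]) es))"

end

(*
  Number the vertices such that the parent of every vertex but the first precedes it; repeatedly
  scanning the edge list for an edge leaving the numbered part takes O(n^2) steps. Then remove the
  vertices in reverse order, merging the row of the removed vertex into that of its parent: the row
  of v stores, for every balance (blue minus red), the largest connected subgraph with topmost
  vertex v built so far. Merging components of sizes a and b costs O(a*b), which is the increase of
  the sum of the squared component sizes; this sum never exceeds n^2. Every entry of a row points to
  the two entries it was composed of, so an optimal subgraph is recovered by following pointers
  downwards, in one pass over the O(n^2) entries. All numbers stored are O(n^2).
*)

theory Submission
  imports Defs
begin

section \<open>A structured language compiled to the machine\<close>

text \<open>A claim about RAM time needs one fixed instruction list. The algorithm is therefore
  written in a small structured language that counts ticks; compiled code of length L executes at
  most L instructions per tick, and L does not depend on the input. The machine cannot multiply, so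
  arrays are interleaved in memory with the constant stride 16.

  A set of positions is connected iff it is closed under parents except at its least element. While
  the positions are handled downwards, the rows at stage k describe the subtrees that use only
  parent edges of positions j >= k (\<open>rooted\<close> with parameter k). Admitting the edge
  above k changes only the row of its parent: a subtree there either avoids k or splits into
  disjoint parts below the parent and below k, whose sizes and balances add. Rows of removed
  positions stay valid, so the optimum over all tops can be read off at the end.

  Merged rows are written to fresh memory, because their pointers lead into the old rows.\<close>

datatype array =
  Scal | Colr | EndA | EndB | Pos | Ord | Par | Base | Size | Best | Lft | Rgt | Mark | Sel

text \<open>All codes are nonzero modulo 16: residue 0 is reserved for temporary registers, so
  arrays and temporaries never collide.\<close>

fun code :: "array \<Rightarrow> nat" where
  "code Scal = 1" | "code Colr = 2" | "code EndA = 3" | "code EndB = 4" | "code Pos = 5"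
| "code Ord = 6" | "code Par = 7" | "code Base = 8" | "code Size = 9" | "code Best = 10"
| "code Lft = 11" | "code Rgt = 12" | "code Mark = 13" | "code Sel = 14"

type_synonym store = "array \<times> nat \<Rightarrow> nat"

datatype exp = Num nat | Fetch array exp | Plus exp exp | Minus exp exp

datatype com =
    Skip
  | Assign array exp exp
  | Seq com com (infixr ";;" 60)
  | Cond exp com com
  | For nat exp com
  | Get array exp
  | Put exp

primrec eval :: "exp \<Rightarrow> store \<Rightarrow> nat" where
  "eval (Num c) m = c"
| "eval (Fetch a e) m = m (a, eval e m)"
| "eval (Plus e f) m = eval e m + eval f m"
| "eval (Minus e f) m = eval e m - eval f m"

record state =
  store :: store
  tape_in :: "nat list"
  tape_out :: "nat list"
  ticks :: nat
  ok :: bool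

text \<open>A write costs one tick however large the evaluated expressions are: their evaluation
  time depends only on the program text and is absorbed by the code length in
  \<open>simulates\<close>.\<close>

definition set_loc :: "array \<Rightarrow> nat \<Rightarrow> nat \<Rightarrow> state \<Rightarrow> state" where
  "set_loc a i x s = s\<lparr>store := (store s)((a, i) := x), ticks := Suc (ticks s)\<rparr>"

text \<open>
  The bound of a \<open>For\<close> loop is evaluated once, and its counter is kept in a hidden register, so the
  semantics is a total function. Reading from an empty input clears the flag \<open>ok\<close>.
\<close>

primrec sem :: "com \<Rightarrow> state \<Rightarrow> state" where
  "sem Skip s = s"
| "sem (Assign a e f) s = set_loc a (eval e (store s)) (eval f (store s)) s"
| "sem (Seq c d) s = sem d (sem c s)"
| "sem (Cond e c d) s =
     (if eval e (store s) > 0 then sem c (s\<lparr>ticks := Suc (ticks s)\<rparr>)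
      else sem d (s\<lparr>ticks := Suc (ticks s)\<rparr>))"
| "sem (For v e c) s =
     fold (\<lambda>i s. sem c (set_loc Scal v i s)) [0..<eval e (store s)] (s\<lparr>ticks := Suc (ticks s)\<rparr>)"
| "sem (Get a e) s =
     (set_loc a (eval e (store s)) (hd (tape_in s)) s)
       \<lparr>tape_in := tl (tape_in s), ok := (ok s \<and> tape_in s \<noteq> [])\<rparr>"
| "sem (Put e) s = s\<lparr>tape_out := tape_out s @ [eval e (store s)], ticks := Suc (ticks s)\<rparr>"

text \<open>Four doublings replace the multiplication by the stride; the offset is loaded into the
  next temporary, which holds nothing that must survive.\<close>

definition scale :: "array \<Rightarrow> nat \<Rightarrow> instr list" where
  "scale a r =
     [Add (16*r) (16*r) (16*r), Add (16*r) (16*r) (16*r), Add (16*r) (16*r) (16*r),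
      Add (16*r) (16*r) (16*r), Const (16*Suc r) (code a), Add (16*r) (16*r) (16*Suc r)]"

text \<open>
  Entry \<open>i\<close> of array \<open>a\<close> is register \<open>16 * i + code a\<close>; the registers \<open>16 * r\<close> hold temporary
  values.
\<close>

primrec compile_exp :: "exp \<Rightarrow> nat \<Rightarrow> instr list" where
  "compile_exp (Num c) r = [Const (16*r) c]"
| "compile_exp (Fetch a e) r = compile_exp e r @ scale a r @ [Load (16*r) (16*r)]"
| "compile_exp (Plus e f) r =
     compile_exp e r @ compile_exp f (Suc r) @ [Add (16*r) (16*r) (16*Suc r)]"
| "compile_exp (Minus e f) r =
     compile_exp e r @ compile_exp f (Suc r) @ [Sub (16*r) (16*r) (16*Suc r)]"

text \<open>\<open>r\<close> is the first free temporary and \<open>i\<close> the address at which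
  the code will stand, since jumps are absolute. An unconditional jump is a jump on the constant 1.
  In a loop, temporaries \<open>r\<close> and \<open>r+1\<close> hold the bound and the hidden
  counter, so the body is compiled with \<open>r+2\<close>; register \<open>16*v+1\<close> is entry
  \<open>v\<close> of \<open>Scal\<close>.\<close>

primrec compile :: "com \<Rightarrow> nat \<Rightarrow> nat \<Rightarrow> instr list" where
  "compile Skip r i = []"
| "compile (Assign a e f) r i =
     compile_exp e r @ scale a r @ compile_exp f (Suc r) @ [Store (16*r) (16*Suc r)]"
| "compile (Seq c d) r i = (let C = compile c r i in C @ compile d r (i + length C))"
| "compile (Cond e c d) r i =
     (let T = compile_exp e r;
          D = compile d r (i + length T + 1);
          j = i + length T + length D + 3;
          C = compile c r j
      in T @ [JumpPos (16*r) j] @ D @ [Const (16*r) 1, JumpPos (16*r) (j + length C)] @ C)"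
| "compile (For v e c) r i =
     (let T = compile_exp e r;
          h = i + length T + 1;
          C = compile c (r + 2) (h + 6)
      in T @ [Const (16*(r+1)) 0,
              Sub (16*(r+2)) (16*r) (16*(r+1)), JumpPos (16*(r+2)) (h + 4),
              Const (16*(r+2)) 1, JumpPos (16*(r+2)) (h + 9 + length C),
              Const (16*v+1) 0, Add (16*v+1) (16*v+1) (16*(r+1))] @ C @
             [Const (16*(r+2)) 1, Add (16*(r+1)) (16*(r+1)) (16*(r+2)), JumpPos (16*(r+2)) h])"
| "compile (Get a e) r i =
     compile_exp e r @ scale a r @ [Read (16*Suc r), Store (16*r) (16*Suc r)]"
| "compile (Put e) r i = compile_exp e r @ [Print (16*r)]"

section \<open>Code segments and runs of the machine\<close>

definition code_at :: "instr list \<Rightarrow> nat \<Rightarrow> instr list \<Rightarrow> bool" where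
  "code_at P i C \<longleftrightarrow> (\<exists>A B. P = A @ C @ B \<and> length A = i)"

definition reach :: "instr list \<Rightarrow> nat \<Rightarrow> config \<Rightarrow> config \<Rightarrow> bool" where
  "reach P k s s' \<longleftrightarrow> (ram_step P ^^ k) s s'"

lemma code_at_append:
  "code_at P i (C @ D) \<longleftrightarrow> code_at P i C \<and> code_at P (i + length C) D"
proof
  assume "code_at P i (C @ D)"
  then obtain A B where "P = A @ (C @ D) @ B" "length A = i" by (auto simp: code_at_def)
  then have "P = A @ C @ (D @ B)" "P = (A @ C) @ D @ B" "length (A @ C) = i + length C" by auto
  with \<open>length A = i\<close> show "code_at P i C \<and> code_at P (i + length C) D"
    unfolding code_at_def by blast
next
  assume "code_at P i C \<and> code_at P (i + length C) D"
  then obtain A B A' B' where *: "P = A @ C @ B" "length A = i"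
    "P = A' @ D @ B'" "length A' = i + length C"
    unfolding code_at_def by blast
  then have "(A @ C) @ B = A' @ D @ B'" by simp
  then have "B = D @ B'" using * by (subst (asm) append_eq_append_conv) auto
  with * show "code_at P i (C @ D)" by (auto simp: code_at_def)
qed

lemma code_at_Cons: "code_at P i (c # D) \<longleftrightarrow> code_at P i [c] \<and> code_at P (Suc i) D"
  using code_at_append[of P i "[c]" D] by simp

lemma code_at_single: "code_at P i [c] \<longleftrightarrow> i < length P \<and> P ! i = c"
proof
  assume "i < length P \<and> P ! i = c"
  then have "P = take i P @ [c] @ drop (Suc i) P" "length (take i P) = i"
    by (auto simp: id_take_nth_drop)
  then show "code_at P i [c]" unfolding code_at_def by blast
qed (auto simp: code_at_def)

lemma reach_0: "reach P 0 s s"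
  by (simp add: reach_def)

lemma reach_trans: "reach P k s s' \<Longrightarrow> reach P l s' s'' \<Longrightarrow> reach P (k + l) s s''"
  by (auto simp: reach_def relpowp_add)

lemma reach_step:
  "code_at P (pc s) [c] \<Longrightarrow> exec c s = Some s' \<Longrightarrow> reach P 1 s s'"
  unfolding reach_def code_at_single by (simp add: ram_step_def eq_OO)

fun straight :: "instr \<Rightarrow> bool" where
  "straight (JumpPos _ _) = False"
| "straight _ = True"

fun exec_list :: "instr list \<Rightarrow> config \<Rightarrow> config option" where
  "exec_list [] s = Some s"
| "exec_list (c # C) s = (case exec c s of None \<Rightarrow> None | Some s' \<Rightarrow> exec_list C s')"

lemma straight_pc: "straight c \<Longrightarrow> exec c s = Some s' \<Longrightarrow> pc s' = Suc (pc s)"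
  by (cases c) (auto split: list.splits)

lemma reach_straight:
  "code_at P (pc s) C \<Longrightarrow> list_all straight C \<Longrightarrow> exec_list C s = Some s' \<Longrightarrow>
   reach P (length C) s s'"
proof (induction C arbitrary: s)
  case Nil
  then show ?case by (simp add: reach_0)
next
  case (Cons c C)
  from Cons.prems obtain t where t: "exec c s = Some t" "exec_list C t = Some s'"
    by (auto split: option.splits)
  have c: "code_at P (pc s) [c]" "code_at P (Suc (pc s)) C"
    using Cons.prems(1) code_at_Cons by blast+
  have "reach P 1 s t" using reach_step[OF c(1) t(1)] .
  moreover have "reach P (length C) t s'"
    using Cons c t straight_pc[of c s t] by simp
  ultimately have "reach P (1 + length C) s s'" by (rule reach_trans)
  then show ?case by simp
qed

section \<open>Arrays laid out in the registers\<close>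

text \<open>The array contents that a memory represents. Multiples of 16 are never looked at, so
  writes to temporaries are invisible (\<open>view_temp\<close>).\<close>

definition view :: "(nat \<Rightarrow> nat) \<Rightarrow> store" where
  "view f = (\<lambda>(a, i). f (16*i + code a))"

lemma code_pos: "0 < code a" and code_less: "code a < 16"
  by (cases a; simp)+

lemma code_inj: "code a = code b \<longleftrightarrow> a = b"
  by (cases a; cases b; simp)

lemma loc_mod: "(16*i + code a) mod 16 = code a"
  using code_less[of a] by simp

lemma loc_eq: "16*i + code a = 16*j + code b \<longleftrightarrow> a = b \<and> i = j"
proof
  assume *: "16*i + code a = 16*j + code b"
  then have "a = b" using loc_mod[of i a] loc_mod[of j b] code_inj by metis
  with * show "a = b \<and> i = j" by simp
qed simp

lemma loc_neq_temp: "16*i + code a \<noteq> 16*r" 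
  using loc_mod[of i a] code_pos[of a] by (metis mod_mult_self1_is_0 neq0_conv)

lemma view_temp [simp]: "view (f(16*r := x)) = view f"
  using loc_neq_temp by (auto simp: view_def fun_eq_iff)

lemma view_loc: "view (f(16*i + code a := x)) = (view f)((a, i) := x)"
  by (auto simp: view_def fun_eq_iff loc_eq)

lemma view_apply: "f (16*i + code a) = view f (a, i)"
  by (simp add: view_def)

text \<open>This is what keeps the value of a left operand in temporary \<open>r\<close> intact
  while the right operand is computed with \<open>Suc r\<close>.\<close>

definition same :: "nat \<Rightarrow> (nat \<Rightarrow> nat) \<Rightarrow> (nat \<Rightarrow> nat) \<Rightarrow> bool" where
  "same r f g \<longleftrightarrow> view f = view g \<and> (\<forall>q<r. f (16*q) = g (16*q))"

lemma same_trans: "same r f g \<Longrightarrow> same r g h \<Longrightarrow> same r f h" by (simp add: same_def)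

lemma same_mono: "same r f g \<Longrightarrow> q \<le> r \<Longrightarrow> same q f g" by (simp add: same_def)

lemma same_temp: "r \<le> q \<Longrightarrow> same r f (f(16*q := x))"
  by (auto simp: same_def)

lemma length_scale [simp]: "length (scale a r) = 6"
  by (simp add: scale_def)

lemma scale_correct:
  assumes "code_at P (pc s) (scale a r)"
  shows "\<exists>f. reach P 6 s (s\<lparr>pc := pc s + 6, mem := f\<rparr>) \<and>
    f (16*r) = 16 * mem s (16*r) + code a \<and> same r (mem s) f"
proof -
  let ?f = "(mem s)(16*r := 16 * mem s (16*r) + code a, 16*Suc r := code a)"
  have "exec_list (scale a r) s = Some (s\<lparr>pc := pc s + 6, mem := ?f\<rparr>)"
    by (auto simp: scale_def intro!: config.equality ext)
  moreover have "list_all straight (scale a r)" by (simp add: scale_def)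
  ultimately have "reach P 6 s (s\<lparr>pc := pc s + 6, mem := ?f\<rparr>)"
    using reach_straight[OF assms] by simp
  moreover have "same r (mem s) ?f" by (auto simp: same_def simp del: mult_Suc_right)
  ultimately show ?thesis by (intro exI[of _ ?f]) auto
qed


lemma compile_exp_correct:
  "code_at P (pc s) (compile_exp e r) \<Longrightarrow>
   \<exists>f. reach P (length (compile_exp e r)) s
         (s\<lparr>pc := pc s + length (compile_exp e r), mem := f\<rparr>) \<and>
       f (16*r) = eval e (view (mem s)) \<and> same r (mem s) f"
proof (induction e arbitrary: s r)
  case (Num c)
  let ?f = "(mem s)(16*r := c)"
  from Num have "reach P 1 s (s\<lparr>pc := Suc (pc s), mem := ?f\<rparr>)"
    by (intro reach_step[of _ _ "Const (16*r) c"]) simp_all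
  moreover have "same r (mem s) ?f" "?f (16*r) = c" by (simp_all add: same_temp)
  ultimately show ?case by (intro exI[of _ ?f]) (simp del: fun_upd_apply)
next
  case (Fetch a e)
  let ?C = "compile_exp e r"
  from Fetch.prems have C: "code_at P (pc s) ?C" "code_at P (pc s + length ?C) (scale a r)"
    "code_at P (pc s + length ?C + 6) [Load (16*r) (16*r)]"
    by (simp_all add: code_at_append add.assoc)
  from Fetch.IH[OF C(1)] obtain f where f:
    "reach P (length ?C) s (s\<lparr>pc := pc s + length ?C, mem := f\<rparr>)"
    "f (16*r) = eval e (view (mem s))" "same r (mem s) f" by blast
  from scale_correct[of P "s\<lparr>pc := pc s + length ?C, mem := f\<rparr>"] C(2) obtain g where g:
    "reach P 6 (s\<lparr>pc := pc s + length ?C, mem := f\<rparr>) (s\<lparr>pc := pc s + length ?C + 6, mem := g\<rparr>)"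
    "g (16*r) = 16 * f (16*r) + code a" "same r f g" by auto
  let ?h = "g(16*r := g (16 * f (16*r) + code a))"
  have "reach P 1 (s\<lparr>pc := pc s + length ?C + 6, mem := g\<rparr>)
      (s\<lparr>pc := Suc (pc s + length ?C + 6), mem := ?h\<rparr>)"
    by (rule reach_step[of _ _ "Load (16*r) (16*r)"]) (use C(3) g(2) in auto)
  from reach_trans[OF f(1) reach_trans[OF g(1) this]]
  have "reach P (length ?C + (6 + 1)) s (s\<lparr>pc := Suc (pc s + length ?C + 6), mem := ?h\<rparr>)" .
  moreover have "same r (mem s) ?h"
    using f(3) g(3) same_temp[of r r g] by (meson order_refl same_trans)
  moreover have "?h (16*r) = eval (Fetch a e) (view (mem s))"
    using f g by (simp add: view_apply same_def)
  ultimately show ?case by (intro exI[of _ ?h]) (simp add: ac_simps del: fun_upd_apply)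
next
  case (Plus e1 e2)
  let ?C = "compile_exp e1 r" and ?D = "compile_exp e2 (Suc r)"
  from Plus.prems have C: "code_at P (pc s) ?C" "code_at P (pc s + length ?C) ?D"
    "code_at P (pc s + length ?C + length ?D) [Add (16*r) (16*r) (16*Suc r)]"
    by (simp_all add: code_at_append add.assoc)
  from Plus.IH(1)[OF C(1)] obtain f where f:
    "reach P (length ?C) s (s\<lparr>pc := pc s + length ?C, mem := f\<rparr>)"
    "f (16*r) = eval e1 (view (mem s))" "same r (mem s) f" by blast
  from Plus.IH(2)[of "s\<lparr>pc := pc s + length ?C, mem := f\<rparr>" "Suc r"] C(2) obtain g where g:
    "reach P (length ?D) (s\<lparr>pc := pc s + length ?C, mem := f\<rparr>)
       (s\<lparr>pc := pc s + length ?C + length ?D, mem := g\<rparr>)"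
    "g (16*Suc r) = eval e2 (view f)" "same (Suc r) f g" by auto
  let ?h = "g(16*r := g (16*r) + g (16*Suc r))"
  have "reach P 1 (s\<lparr>pc := pc s + length ?C + length ?D, mem := g\<rparr>)
      (s\<lparr>pc := Suc (pc s + length ?C + length ?D), mem := ?h\<rparr>)"
    by (rule reach_step[of _ _ "Add (16*r) (16*r) (16*Suc r)"]) (use C(3) in auto)
  from reach_trans[OF f(1) reach_trans[OF g(1) this]]
  have "reach P (length ?C + (length ?D + 1)) s
      (s\<lparr>pc := Suc (pc s + length ?C + length ?D), mem := ?h\<rparr>)" .
  moreover have "same r (mem s) ?h"
    using f(3) g(3) same_temp[of r r g] same_mono[of "Suc r" f g r]
    by (meson order_refl same_trans Suc_leD)
  moreover have "?h (16*r) = eval (Plus e1 e2) (view (mem s))"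
    using f g by (simp add: same_def)
  ultimately show ?case by (intro exI[of _ ?h]) (simp add: ac_simps del: fun_upd_apply)
next
  case (Minus e1 e2)
  let ?C = "compile_exp e1 r" and ?D = "compile_exp e2 (Suc r)"
  from Minus.prems have C: "code_at P (pc s) ?C" "code_at P (pc s + length ?C) ?D"
    "code_at P (pc s + length ?C + length ?D) [Sub (16*r) (16*r) (16*Suc r)]"
    by (simp_all add: code_at_append add.assoc)
  from Minus.IH(1)[OF C(1)] obtain f where f:
    "reach P (length ?C) s (s\<lparr>pc := pc s + length ?C, mem := f\<rparr>)"
    "f (16*r) = eval e1 (view (mem s))" "same r (mem s) f" by blast
  from Minus.IH(2)[of "s\<lparr>pc := pc s + length ?C, mem := f\<rparr>" "Suc r"] C(2) obtain g where g:
    "reach P (length ?D) (s\<lparr>pc := pc s + length ?C, mem := f\<rparr>)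
       (s\<lparr>pc := pc s + length ?C + length ?D, mem := g\<rparr>)"
    "g (16*Suc r) = eval e2 (view f)" "same (Suc r) f g" by auto
  let ?h = "g(16*r := g (16*r) - g (16*Suc r))"
  have "reach P 1 (s\<lparr>pc := pc s + length ?C + length ?D, mem := g\<rparr>)
      (s\<lparr>pc := Suc (pc s + length ?C + length ?D), mem := ?h\<rparr>)"
    by (rule reach_step[of _ _ "Sub (16*r) (16*r) (16*Suc r)"]) (use C(3) in auto)
  from reach_trans[OF f(1) reach_trans[OF g(1) this]]
  have "reach P (length ?C + (length ?D + 1)) s
      (s\<lparr>pc := Suc (pc s + length ?C + length ?D), mem := ?h\<rparr>)" .
  moreover have "same r (mem s) ?h"
    using f(3) g(3) same_temp[of r r g] same_mono[of "Suc r" f g r]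
    by (meson order_refl same_trans Suc_leD)
  moreover have "?h (16*r) = eval (Minus e1 e2) (view (mem s))"
    using f g by (simp add: same_def)
  ultimately show ?case by (intro exI[of _ ?h]) (simp add: ac_simps del: fun_upd_apply)
qed

section \<open>Simulation of commands with a constant slowdown\<close>

lemma ok_fold:
  assumes "\<And>i s. ok (g i s) \<Longrightarrow> ok s" "ok (fold g xs s)"
  shows "ok s"
  using assms(2)
proof (induction xs arbitrary: s)
  case (Cons x xs)
  then have "ok (g x s)" by simp
  then show ?case by (rule assms(1))
qed simp

lemma ok_set_loc [simp]: "ok (set_loc a i x s) = ok s"
  by (simp add: set_loc_def)

text \<open>A failed read is never forgotten. Hence success of a whole run yields success of every
  initial part of it, as the simulation of sequences and loops requires.\<close>

lemma ok_mono: "ok (sem c s) \<Longrightarrow> ok s"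
proof (induction c arbitrary: s)
  case (For v e c)
  have "ok (s\<lparr>ticks := Suc (ticks s)\<rparr>)"
  proof (rule ok_fold)
    show "ok (fold (\<lambda>i s. sem c (set_loc Scal v i s)) [0..<eval e (store s)]
        (s\<lparr>ticks := Suc (ticks s)\<rparr>))"
      using For.prems by simp
    show "ok t" if "ok (sem c (set_loc Scal v i t))" for i t
      using For.IH[OF that] by simp
  qed
  then show ?case by simp
next
  case (Seq c d)
  show ?case using Seq.IH(1)[of s] Seq.IH(2)[of "sem c s"] Seq.prems by simp
next
  case (Cond e c d)
  show ?case
    using Cond.IH[of "s\<lparr>ticks := Suc (ticks s)\<rparr>"] Cond.prems
    by (cases "eval e (store s) > 0") auto
qed auto

definition agree :: "config \<Rightarrow> state \<Rightarrow> bool" where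
  "agree s \<sigma> \<longleftrightarrow> view (mem s) = store \<sigma> \<and> inp s = tape_in \<sigma> \<and> out s = tape_out \<sigma>"

lemma agree_update:
  "agree (s\<lparr>pc := p, mem := f\<rparr>) \<sigma> \<longleftrightarrow>
   view f = store \<sigma> \<and> inp s = tape_in \<sigma> \<and> out s = tape_out \<sigma>"
  by (simp add: agree_def)

text \<open>The bound \<open>k \<le> l * d\<close> charges at most \<open>l\<close> instructions,
  the length of the code, to each tick. It composes because
  \<open>l1*d1 + l2*d2 \<le> (l1+l2)*(d1+d2)\<close>.\<close>

definition simulates :: "instr list \<Rightarrow> nat \<Rightarrow> nat \<Rightarrow> config \<Rightarrow> state \<Rightarrow> state \<Rightarrow> bool" where
  "simulates P r l s \<sigma> \<sigma>' \<longleftrightarrow>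
     (\<exists>k s' d. reach P k s s' \<and> pc s' = pc s + l \<and> agree s' \<sigma>' \<and>
        (\<forall>q<r. mem s' (16*q) = mem s (16*q)) \<and> ticks \<sigma>' = ticks \<sigma> + d \<and> k \<le> l * d)"

lemma compile_exp_agree:
  assumes "code_at P (pc s) (compile_exp e r)" "agree s \<sigma>"
  obtains s' where "reach P (length (compile_exp e r)) s s'"
    "pc s' = pc s + length (compile_exp e r)" "mem s' (16*r) = eval e (store \<sigma>)"
    "agree s' \<sigma>" "same r (mem s) (mem s')"
proof -
  from compile_exp_correct[OF assms(1)] obtain f where
    "reach P (length (compile_exp e r)) s
         (s\<lparr>pc := pc s + length (compile_exp e r), mem := f\<rparr>)"
    "f (16*r) = eval e (view (mem s))" "same r (mem s) f" by blast
  with assms(2) show thesis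
    by (intro that[of "s\<lparr>pc := pc s + length (compile_exp e r), mem := f\<rparr>"])
       (auto simp: agree_def same_def)
qed

lemma scale_agree:
  assumes "code_at P (pc s) (scale a r)" "agree s \<sigma>"
  obtains s' where "reach P 6 s s'" "pc s' = pc s + 6"
    "mem s' (16*r) = 16 * mem s (16*r) + code a" "agree s' \<sigma>" "same r (mem s) (mem s')"
proof -
  from scale_correct[OF assms(1)] obtain f where
    "reach P 6 s (s\<lparr>pc := pc s + 6, mem := f\<rparr>)"
    "f (16*r) = 16 * mem s (16*r) + code a" "same r (mem s) f" by blast
  with assms(2) show thesis
    by (intro that[of "s\<lparr>pc := pc s + 6, mem := f\<rparr>"])
       (auto simp: agree_def same_def)
qed

text \<open>Induction on the number of remaining iterations; \<open>body\<close> is the induction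
  hypothesis of the compiler proof. An iteration executes 4 instructions before the body and 3 after
  it, all charged to the tick of storing the counter. The final failing test accounts for the extra
  4.\<close>

lemma compile_For_loop:
  fixes c v r
  defines "F \<equiv> \<lambda>i \<sigma>. sem c (set_loc Scal v i \<sigma>)"
  assumes body: "\<And>s \<sigma>. code_at P (pc s) (compile c (r + 2) (pc s)) \<Longrightarrow> agree s \<sigma> \<Longrightarrow> ok (sem c \<sigma>) \<Longrightarrow>
      simulates P (r + 2) (length (compile c (r + 2) (pc s))) s \<sigma> (sem c \<sigma>)"
    and C: "C = compile c (r + 2) (h + 6)"
    and code: "code_at P h ([Sub (16*(r+2)) (16*r) (16*(r+1)), JumpPos (16*(r+2)) (h + 4),
              Const (16*(r+2)) 1, JumpPos (16*(r+2)) (h + 9 + length C),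
              Const (16*v+1) 0, Add (16*v+1) (16*v+1) (16*(r+1))] @ C @
             [Const (16*(r+2)) 1, Add (16*(r+1)) (16*(r+1)) (16*(r+2)), JumpPos (16*(r+2)) h])"
  shows "pc s = h \<Longrightarrow> mem s (16*r) = N \<Longrightarrow> mem s (16*(r+1)) = j \<Longrightarrow> j \<le> N \<Longrightarrow>
    agree s \<sigma> \<Longrightarrow> ok (fold F [j..<N] \<sigma>) \<Longrightarrow>
    \<exists>k s' d. reach P k s s' \<and> pc s' = h + 9 + length C \<and> agree s' (fold F [j..<N] \<sigma>) \<and>
        (\<forall>q<r. mem s' (16*q) = mem s (16*q)) \<and> ticks (fold F [j..<N] \<sigma>) = ticks \<sigma> + d \<and>
        k \<le> (length C + 7) * d + 4"
proof (induction "N - j" arbitrary: j s \<sigma>)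
  case 0
  let ?t = "s\<lparr>pc := h + 9 + length C, mem := (mem s)(16*(r+2) := 1)\<rparr>"
  have code': "code_at P h [Sub (16*(r+2)) (16*r) (16*(r+1))]"
    "code_at P (h+1) [JumpPos (16*(r+2)) (h + 4)]"
    "code_at P (h+2) [Const (16*(r+2)) 1]"
    "code_at P (h+3) [JumpPos (16*(r+2)) (h + 9 + length C)]"
    using code by (simp_all add: code_at_Cons[of P _ _ "_ # _"] code_at_Cons[of P _ _ "_ @ _"]
        numeral_eq_Suc)
  have 1: "reach P 1 s (s\<lparr>pc := h + 1, mem := (mem s)(16*(r+2) := 0)\<rparr>)"
    by (rule reach_step) (use code'(1) 0 in auto)
  have 2: "reach P 1 (s\<lparr>pc := h + 1, mem := (mem s)(16*(r+2) := 0)\<rparr>)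
     (s\<lparr>pc := h + 2, mem := (mem s)(16*(r+2) := 0)\<rparr>)"
    by (rule reach_step) (use code'(2) 0 in auto)
  have 3: "reach P 1 (s\<lparr>pc := h + 2, mem := (mem s)(16*(r+2) := 0)\<rparr>)
     (s\<lparr>pc := h + 3, mem := (mem s)(16*(r+2) := 1)\<rparr>)"
    by (rule reach_step) (use code'(3) 0 in auto)
  have 4: "reach P 1 (s\<lparr>pc := h + 3, mem := (mem s)(16*(r+2) := 1)\<rparr>) ?t"
    by (rule reach_step) (use code'(4) 0 in auto)
  have "reach P 4 s ?t"
    using reach_trans[OF 1 reach_trans[OF 2 reach_trans[OF 3 4]]] by (simp del: One_nat_def)
  moreover have "agree ?t \<sigma>" using 0
    by (simp only: agree_update view_temp) (simp add: agree_def)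
  ultimately show ?case using 0 by (intro exI[of _ 4] exI[of _ ?t] exI[of _ 0]) auto
next
  case (Suc x)
  then have "j < N" by simp
  have "h + 6 + length C = h + (6 + length C)" by simp
  then have code': "code_at P h [Sub (16*(r+2)) (16*r) (16*(r+1))]"
    "code_at P (h+1) [JumpPos (16*(r+2)) (h + 4)]"
    "code_at P (h+4) [Const (16*v+1) 0]"
    "code_at P (h+5) [Add (16*v+1) (16*v+1) (16*(r+1))]"
    "code_at P (h+6) C"
    "code_at P (h+6+length C) [Const (16*(r+2)) 1]"
    "code_at P (h+6+length C+1) [Add (16*(r+1)) (16*(r+1)) (16*(r+2))]"
    "code_at P (h+6+length C+2) [JumpPos (16*(r+2)) h]"
    using code by (simp_all add: code_at_Cons[of P _ _ "_ # _"] code_at_Cons[of P _ _ "_ @ _"]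
        code_at_append numeral_eq_Suc)
  let ?m1 = "(mem s)(16*(r+2) := N - j)"
  let ?m2 = "?m1(16*v + code Scal := j)"
  have T1: "16*(r+1) \<noteq> 16*v + code Scal" using loc_neq_temp by metis
  have T2: "16*q \<noteq> 16*v + code Scal" for q using loc_neq_temp by metis
  have 1: "reach P 1 s (s\<lparr>pc := h + 1, mem := ?m1\<rparr>)"
    by (rule reach_step) (use code'(1) Suc.prems in auto)
  have 2: "reach P 1 (s\<lparr>pc := h + 1, mem := ?m1\<rparr>) (s\<lparr>pc := h + 4, mem := ?m1\<rparr>)"
    by (rule reach_step) (use code'(2) \<open>j < N\<close> in auto)
  have 3: "reach P 1 (s\<lparr>pc := h + 4, mem := ?m1\<rparr>)
      (s\<lparr>pc := h + 5, mem := ?m1(16*v + code Scal := 0)\<rparr>)"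
    by (rule reach_step) (use code'(3) in auto)
  have 4: "reach P 1 (s\<lparr>pc := h + 5, mem := ?m1(16*v + code Scal := 0)\<rparr>)
      (s\<lparr>pc := h + 6, mem := ?m2\<rparr>)"
    by (rule reach_step) (use code'(4) Suc.prems T1 in auto)
  let ?s2 = "s\<lparr>pc := h + 6, mem := ?m2\<rparr>"
  have to_body: "reach P 4 s ?s2"
    using reach_trans[OF 1 reach_trans[OF 2 reach_trans[OF 3 4]]] by (simp del: One_nat_def)
  have ag: "agree ?s2 (set_loc Scal v j \<sigma>)"
    using Suc.prems
    by (simp only: agree_update view_temp view_loc) (simp add: agree_def set_loc_def)
  have upt: "[j..<N] = j # [Suc j..<N]" using \<open>j < N\<close> by (simp add: upt_conv_Cons)
  let ?\<tau> = "F j \<sigma>"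
  have ok': "ok (fold F [Suc j..<N] ?\<tau>)" using Suc.prems upt by simp
  have "ok (fold F xs \<tau>) \<Longrightarrow> ok \<tau>" for xs \<tau>
  proof (induction xs arbitrary: \<tau>)
    case (Cons x xs)
    then have "ok (F x \<tau>)" by simp
    from ok_mono[OF this[unfolded F_def]] show ?case by (simp add: set_loc_def)
  qed simp
  with ok' have "ok ?\<tau>" by blast
  then have "simulates P (r + 2) (length C) ?s2 (set_loc Scal v j \<sigma>) ?\<tau>"
    using body[of ?s2, OF _ ag] code'(5) C by (simp add: F_def)
  then obtain k t d where t: "reach P k ?s2 t" "pc t = h + 6 + length C" "agree t ?\<tau>"
    "\<forall>q<r+2. mem t (16*q) = ?m2 (16*q)" "ticks ?\<tau> = Suc (ticks \<sigma>) + d" "k \<le> length C * d"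
    by (auto simp: simulates_def set_loc_def simp del: mult_Suc_right add_2_eq_Suc' code.simps)
  have tr: "mem t (16*r) = N" "mem t (16*(r+1)) = j" "\<forall>q<r. mem t (16*q) = mem s (16*q)"
    using t(4) Suc.prems T2 by (auto simp del: mult_Suc_right code.simps)
  let ?m3 = "(mem t)(16*(r+2) := 1)"
  let ?m4 = "?m3(16*(r+1) := j + 1)"
  have 5: "reach P 1 t (t\<lparr>pc := h + 6 + length C + 1, mem := ?m3\<rparr>)"
    by (rule reach_step) (use code'(6) t(2) in auto)
  have 6: "reach P 1 (t\<lparr>pc := h + 6 + length C + 1, mem := ?m3\<rparr>)
     (t\<lparr>pc := h + 6 + length C + 2, mem := ?m4\<rparr>)"
    by (rule reach_step) (use code'(7) tr in auto)
  have 7: "reach P 1 (t\<lparr>pc := h + 6 + length C + 2, mem := ?m4\<rparr>) (t\<lparr>pc := h, mem := ?m4\<rparr>)"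
    by (rule reach_step) (use code'(8) in auto)
  let ?u = "t\<lparr>pc := h, mem := ?m4\<rparr>"
  have return: "reach P 3 t ?u"
    using reach_trans[OF 5 reach_trans[OF 6 7]] by (simp del: One_nat_def)
  have "agree ?u ?\<tau>" using t(3)
    by (simp only: agree_update view_temp) (simp add: agree_def)
  then have "\<exists>k s' d. reach P k ?u s' \<and> pc s' = h + 9 + length C \<and>
      agree s' (fold F [Suc j..<N] ?\<tau>) \<and>
        (\<forall>q<r. mem s' (16*q) = mem ?u (16*q)) \<and>
        ticks (fold F [Suc j..<N] ?\<tau>) = ticks ?\<tau> + d \<and>
        k \<le> (length C + 7) * d + 4"
    using Suc.hyps(2) \<open>j < N\<close> tr ok' by (intro Suc.hyps(1)) auto
  then obtain k' s' d' where s': "reach P k' ?u s'" "pc s' = h + 9 + length C"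
      "agree s' (fold F [Suc j..<N] ?\<tau>)" "\<forall>q<r. mem s' (16*q) = mem ?u (16*q)"
      "ticks (fold F [Suc j..<N] ?\<tau>) = ticks ?\<tau> + d'" "k' \<le> (length C + 7) * d' + 4"
    by blast
  have "reach P (4 + (k + (3 + k'))) s s'"
    using reach_trans[OF to_body reach_trans[OF t(1) reach_trans[OF return s'(1)]]] .
  moreover have "4 + (k + (3 + k')) \<le> (length C + 7) * (Suc d + d') + 4"
    using t(6) s'(6) by (simp add: algebra_simps)
  ultimately show ?case
    using s' t(5) tr(3) upt by (intro exI[of _ "4 + (k + (3 + k'))"] exI[of _ s'] exI[of _ "Suc d + d'"]) auto
qed


lemma compile_correct:
  "code_at P (pc s) (compile c r (pc s)) \<Longrightarrow> agree s \<sigma> \<Longrightarrow> ok (sem c \<sigma>) \<Longrightarrow>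
   simulates P r (length (compile c r (pc s))) s \<sigma> (sem c \<sigma>)"
proof (induction c arbitrary: r s \<sigma>)
  case Skip
  then show ?case
    unfolding simulates_def by (intro exI[of _ 0] exI[of _ s]) (simp add: reach_0)
next
  case (Assign a e f)
  let ?E = "compile_exp e r" and ?F = "compile_exp f (Suc r)"
  from Assign.prems have C: "code_at P (pc s) ?E" "code_at P (pc s + length ?E) (scale a r)"
    "code_at P (pc s + length ?E + 6) ?F"
    "code_at P (pc s + length ?E + 6 + length ?F) [Store (16*r) (16*Suc r)]"
    by (simp_all add: code_at_append add.assoc)
  from compile_exp_agree[OF C(1) Assign.prems(2)] obtain s1 where s1:
    "reach P (length ?E) s s1" "pc s1 = pc s + length ?E" "mem s1 (16*r) = eval e (store \<sigma>)"
    "agree s1 \<sigma>" "same r (mem s) (mem s1)" .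
  from scale_agree[of P s1 a r \<sigma>] C(2) s1 obtain s2 where s2:
    "reach P 6 s1 s2" "pc s2 = pc s + length ?E + 6"
    "mem s2 (16*r) = 16 * eval e (store \<sigma>) + code a" "agree s2 \<sigma>" "same r (mem s1) (mem s2)"
    by auto
  from compile_exp_agree[of P s2 f "Suc r" \<sigma>] C(3) s2 obtain s3 where s3:
    "reach P (length ?F) s2 s3" "pc s3 = pc s + length ?E + 6 + length ?F"
    "mem s3 (16*Suc r) = eval f (store \<sigma>)" "agree s3 \<sigma>" "same (Suc r) (mem s2) (mem s3)"
    by (metis (no_types))
  \<comment> \<open>Computing \<open>f\<close> touches only temporaries from \<open>Suc r\<close>
    on, so the target address in \<open>r\<close> survives.\<close>
  have m: "mem s3 (16*r) = 16 * eval e (store \<sigma>) + code a"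
    using s3(5) s2(3) by (simp add: same_def)
  let ?t = "s3\<lparr>pc := Suc (pc s3),
    mem := (mem s3)(16 * eval e (store \<sigma>) + code a := eval f (store \<sigma>))\<rparr>"
  have "reach P 1 s3 ?t"
    by (rule reach_step[of _ _ "Store (16*r) (16*Suc r)"])
       (use C(4) s3 m in \<open>auto simp del: mult_Suc_right\<close>)
  from reach_trans[OF s1(1) reach_trans[OF s2(1) reach_trans[OF s3(1) this]]]
  have "reach P (length (compile (Assign a e f) r (pc s))) s ?t" by simp
  moreover have "agree ?t (sem (Assign a e f) \<sigma>)"
    using s3(4) by (simp add: agree_def view_loc set_loc_def)
  moreover have "mem ?t (16*q) = mem s (16*q)" if "q < r" for q
    using that s1(5) s2(5) s3(5) loc_neq_temp[THEN not_sym] by (simp add: same_def)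
  ultimately show ?case using s3(2) unfolding simulates_def
    by (intro exI[of _ "length (compile (Assign a e f) r (pc s))"] exI[of _ ?t] exI[of _ 1])
       (simp add: set_loc_def)
next
  case (Seq c d)
  let ?C = "compile c r (pc s)"
  let ?D = "compile d r (pc s + length ?C)"
  from Seq.prems have C: "code_at P (pc s) ?C" "code_at P (pc s + length ?C) ?D"
    by (simp_all add: code_at_append Let_def)
  from Seq.prems have ok: "ok (sem d (sem c \<sigma>))" by simp
  from Seq.IH(1)[OF C(1) Seq.prems(2) ok_mono[OF ok]] obtain k t i where t:
    "reach P k s t" "pc t = pc s + length ?C" "agree t (sem c \<sigma>)"
    "\<forall>q<r. mem t (16*q) = mem s (16*q)" "ticks (sem c \<sigma>) = ticks \<sigma> + i" "k \<le> length ?C * i"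
    unfolding simulates_def by blast
  from Seq.IH(2)[of t r "sem c \<sigma>"] C(2) t(2,3) ok obtain l u j where u:
    "reach P l t u" "pc u = pc t + length ?D" "agree u (sem d (sem c \<sigma>))"
    "\<forall>q<r. mem u (16*q) = mem t (16*q)" "ticks (sem d (sem c \<sigma>)) = ticks (sem c \<sigma>) + j"
    "l \<le> length ?D * j"
    unfolding simulates_def by auto
  have "k + l \<le> (length ?C + length ?D) * (i + j)"
    using t(6) u(6) by (simp add: algebra_simps)
  with reach_trans[OF t(1) u(1)] t u show ?case unfolding simulates_def
    by (intro exI[of _ "k + l"] exI[of _ u] exI[of _ "i + j"]) (simp add: Let_def)
next
  case (Cond e c d)
  let ?E = "compile_exp e r"
  let ?D = "compile d r (pc s + length ?E + 1)"
  let ?j = "pc s + length ?E + length ?D + 3"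
  let ?C = "compile c r ?j"
  let ?\<tau> = "\<sigma>\<lparr>ticks := Suc (ticks \<sigma>)\<rparr>"
  let ?L = "length (compile (Cond e c d) r (pc s))"
  have L: "?L = length ?E + length ?D + length ?C + 3" by (simp add: Let_def)
  from Cond.prems(1) have "code_at P (pc s)
      (?E @ [JumpPos (16*r) ?j] @ ?D @ [Const (16*r) 1] @ [JumpPos (16*r) (?j + length ?C)] @ ?C)"
    by (simp add: Let_def)
  then have C: "code_at P (pc s) ?E"
    "code_at P (pc s + length ?E) [JumpPos (16*r) ?j]"
    "code_at P (pc s + length ?E + 1) ?D"
    "code_at P (pc s + length ?E + 1 + length ?D) [Const (16*r) 1]"
    "code_at P (pc s + length ?E + 1 + length ?D + 1) [JumpPos (16*r) (?j + length ?C)]"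
    "code_at P ?j ?C"
    unfolding code_at_append by (simp_all add: numeral_3_eq_3)
  from compile_exp_agree[OF C(1) Cond.prems(2)] obtain s1 where s1:
    "reach P (length ?E) s s1" "pc s1 = pc s + length ?E" "mem s1 (16*r) = eval e (store \<sigma>)"
    "agree s1 \<sigma>" "same r (mem s) (mem s1)" .
  show ?case
  proof (cases "eval e (store \<sigma>) > 0")
    case True
    let ?s2 = "s1\<lparr>pc := ?j\<rparr>"
    have 2: "reach P 1 s1 ?s2"
      by (rule reach_step) (use C(2) s1 True in auto)
    have "agree ?s2 ?\<tau>" using s1(4) by (simp add: agree_def)
    moreover have "ok (sem c ?\<tau>)" using Cond.prems(3) True by simp
    ultimately have "simulates P r (length ?C) ?s2 ?\<tau> (sem c ?\<tau>)"
      using Cond.IH(1)[of ?s2 r ?\<tau>] C(6) by simp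
    then obtain k t i where t:
      "reach P k ?s2 t" "pc t = ?j + length ?C" "agree t (sem c ?\<tau>)"
      "\<forall>q<r. mem t (16*q) = mem s1 (16*q)" "ticks (sem c ?\<tau>) = Suc (ticks \<sigma>) + i"
      "k \<le> length ?C * i"
      unfolding simulates_def by auto
    have "length ?E + (1 + k) \<le> ?L * Suc i"
      using t(6) unfolding L by (simp add: algebra_simps)
    moreover from reach_trans[OF s1(1) reach_trans[OF 2 t(1)]]
    have "reach P (length ?E + (1 + k)) s t" .
    ultimately show ?thesis using t s1(5) True unfolding simulates_def L
      by (intro exI[of _ "length ?E + (1 + k)"] exI[of _ t] exI[of _ "Suc i"])
         (simp add: same_def)
  next
    case False
    let ?s2 = "s1\<lparr>pc := pc s + length ?E + 1\<rparr>"
    have 2: "reach P 1 s1 ?s2"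
      by (rule reach_step) (use C(2) s1 False in auto)
    have "agree ?s2 ?\<tau>" using s1(4) by (simp add: agree_def)
    moreover have "ok (sem d ?\<tau>)" using Cond.prems(3) False by simp
    ultimately have "simulates P r (length ?D) ?s2 ?\<tau> (sem d ?\<tau>)"
      using Cond.IH(2)[of ?s2 r ?\<tau>] C(3) by simp
    then obtain k t i where t:
      "reach P k ?s2 t" "pc t = pc s + length ?E + 1 + length ?D" "agree t (sem d ?\<tau>)"
      "\<forall>q<r. mem t (16*q) = mem s1 (16*q)" "ticks (sem d ?\<tau>) = Suc (ticks \<sigma>) + i"
      "k \<le> length ?D * i"
      unfolding simulates_def by auto
    let ?u = "t\<lparr>pc := pc t + 1, mem := (mem t)(16*r := 1)\<rparr>"
    let ?v = "?u\<lparr>pc := ?j + length ?C\<rparr>"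
    have 3: "reach P 1 t ?u" by (rule reach_step) (use C(4) t(2) in auto)
    have 4: "reach P 1 ?u ?v" by (rule reach_step) (use C(5) t(2) in auto)
    have "length ?E + (1 + (k + (1 + 1))) \<le> ?L * Suc i"
      using t(6) unfolding L by (simp add: algebra_simps)
    moreover from reach_trans[OF s1(1) reach_trans[OF 2 reach_trans[OF t(1) reach_trans[OF 3 4]]]]
    have "reach P (length ?E + (1 + (k + (1 + 1)))) s ?v" .
    moreover have "agree ?v (sem d ?\<tau>)" using t(3) by (simp add: agree_def)
    ultimately show ?thesis using t s1(5) False unfolding simulates_def L
      by (intro exI[of _ "length ?E + (1 + (k + (1 + 1)))"] exI[of _ ?v] exI[of _ "Suc i"])
         (simp add: same_def)
  qed
next
  case (For v e c)
  let ?E = "compile_exp e r"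
  let ?h = "pc s + length ?E + 1"
  let ?C = "compile c (r + 2) (?h + 6)"
  let ?\<tau> = "\<sigma>\<lparr>ticks := Suc (ticks \<sigma>)\<rparr>"
  let ?N = "eval e (store \<sigma>)"
  let ?L = "length (compile (For v e c) r (pc s))"
  let ?loop = "[Sub (16*(r+2)) (16*r) (16*(r+1)), JumpPos (16*(r+2)) (?h + 4),
              Const (16*(r+2)) 1, JumpPos (16*(r+2)) (?h + 9 + length ?C),
              Const (16*v+1) 0, Add (16*v+1) (16*v+1) (16*(r+1))] @ ?C @
             [Const (16*(r+2)) 1, Add (16*(r+1)) (16*(r+1)) (16*(r+2)), JumpPos (16*(r+2)) ?h]"
  have *: "compile (For v e c) r (pc s) = ?E @ [Const (16*(r+1)) 0] @ ?loop"
    by (simp add: Let_def)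
  have C: "code_at P (pc s) ?E" "code_at P (pc s + length ?E) [Const (16*(r+1)) 0]"
    "code_at P ?h ?loop"
    using For.prems(1) unfolding * code_at_append by (simp_all add: code_at_append add.assoc)
  have L: "?L = length ?E + length ?C + 10" by (simp add: Let_def)
  from compile_exp_agree[OF C(1) For.prems(2)] obtain s1 where s1:
    "reach P (length ?E) s s1" "pc s1 = pc s + length ?E" "mem s1 (16*r) = ?N"
    "agree s1 \<sigma>" "same r (mem s) (mem s1)" .
  let ?s2 = "s1\<lparr>pc := ?h, mem := (mem s1)(16*(r+1) := 0)\<rparr>"
  have 2: "reach P 1 s1 ?s2" by (rule reach_step) (use C(2) s1 in auto)
  have "agree ?s2 ?\<tau>" using s1(4)
    by (simp only: agree_update view_temp) (simp add: agree_def)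
  moreover have "ok (fold (\<lambda>i s. sem c (set_loc Scal v i s)) [0..<?N] ?\<tau>)"
    using For.prems(3) by simp
  ultimately have "\<exists>k s' d. reach P k ?s2 s' \<and> pc s' = ?h + 9 + length ?C \<and>
      agree s' (fold (\<lambda>i s. sem c (set_loc Scal v i s)) [0..<?N] ?\<tau>) \<and>
      (\<forall>q<r. mem s' (16*q) = mem ?s2 (16*q)) \<and>
      ticks (fold (\<lambda>i s. sem c (set_loc Scal v i s)) [0..<?N] ?\<tau>) = ticks ?\<tau> + d \<and>
      k \<le> (length ?C + 7) * d + 4"
    by (intro compile_For_loop[OF For.IH refl C(3)]) (simp_all add: s1(3))
  then obtain k t i where t: "reach P k ?s2 t" "pc t = ?h + 9 + length ?C"
    "agree t (sem (For v e c) \<sigma>)" "\<forall>q<r. mem t (16*q) = mem ?s2 (16*q)"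
    "ticks (sem (For v e c) \<sigma>) = Suc (ticks \<sigma>) + i" "k \<le> (length ?C + 7) * i + 4"
    by auto
  \<comment> \<open>The tick of entering the loop pays for evaluating the bound, clearing the
    counter and the final exit test.\<close>
  have "length ?E + (1 + k) \<le> ?L * Suc i"
    using t(6) unfolding L by (simp add: algebra_simps)
  moreover from reach_trans[OF s1(1) reach_trans[OF 2 t(1)]]
  have "reach P (length ?E + (1 + k)) s t" .
  ultimately show ?case using t s1(5) unfolding simulates_def L
    by (intro exI[of _ "length ?E + (1 + k)"] exI[of _ t] exI[of _ "Suc i"])
       (simp add: same_def)
next
  case (Get a e)
  let ?E = "compile_exp e r"
  from Get.prems(3) obtain x xs where x: "tape_in \<sigma> = x # xs" by (cases "tape_in \<sigma>") auto
  from Get.prems have C: "code_at P (pc s) ?E" "code_at P (pc s + length ?E) (scale a r)"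
    "code_at P (pc s + length ?E + 6) [Read (16*Suc r)]"
    "code_at P (pc s + length ?E + 7) [Store (16*r) (16*Suc r)]"
    by (simp_all add: code_at_append code_at_Cons[of P _ _ "_ # _"] ac_simps)
  from compile_exp_agree[OF C(1) Get.prems(2)] obtain s1 where s1:
    "reach P (length ?E) s s1" "pc s1 = pc s + length ?E" "mem s1 (16*r) = eval e (store \<sigma>)"
    "agree s1 \<sigma>" "same r (mem s) (mem s1)" .
  from scale_agree[of P s1 a r \<sigma>] C(2) s1 obtain s2 where s2:
    "reach P 6 s1 s2" "pc s2 = pc s + length ?E + 6"
    "mem s2 (16*r) = 16 * eval e (store \<sigma>) + code a" "agree s2 \<sigma>" "same r (mem s1) (mem s2)"
    by auto
  let ?s3 = "s2\<lparr>pc := pc s + length ?E + 7, mem := (mem s2)(16*Suc r := x), inp := xs\<rparr>"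
  have 3: "reach P 1 s2 ?s3"
    by (rule reach_step) (use C(3) s2(2,4) x in \<open>auto simp: agree_def\<close>)
  let ?t = "?s3\<lparr>pc := pc s + length ?E + 8,
    mem := (mem ?s3)(16 * eval e (store \<sigma>) + code a := x)\<rparr>"
  have "reach P 1 ?s3 ?t"
    by (rule reach_step[of _ _ "Store (16*r) (16*Suc r)"]) (use C(4) s2(3) in auto)
  from reach_trans[OF s1(1) reach_trans[OF s2(1) reach_trans[OF 3 this]]]
  have "reach P (length (compile (Get a e) r (pc s))) s ?t" by simp
  moreover have "agree ?t (sem (Get a e) \<sigma>)"
    using s2(4) x by (simp add: agree_def view_loc set_loc_def del: mult_Suc_right)
  moreover have "mem ?t (16*q) = mem s (16*q)" if "q < r" for q
    using that s1(5) s2(5) loc_neq_temp[THEN not_sym] by (simp add: same_def)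
  ultimately show ?case unfolding simulates_def
    by (intro exI[of _ "length (compile (Get a e) r (pc s))"] exI[of _ ?t] exI[of _ 1])
       (simp add: set_loc_def)
next
  case (Put e)
  let ?E = "compile_exp e r"
  from Put.prems have C: "code_at P (pc s) ?E" "code_at P (pc s + length ?E) [Print (16*r)]"
    by (simp_all add: code_at_append)
  from compile_exp_agree[OF C(1) Put.prems(2)] obtain s1 where s1:
    "reach P (length ?E) s s1" "pc s1 = pc s + length ?E" "mem s1 (16*r) = eval e (store \<sigma>)"
    "agree s1 \<sigma>" "same r (mem s) (mem s1)" .
  let ?t = "s1\<lparr>pc := Suc (pc s1), out := out s1 @ [eval e (store \<sigma>)]\<rparr>"
  have "reach P 1 s1 ?t" by (rule reach_step) (use C(2) s1 in auto)
  from reach_trans[OF s1(1) this] have "reach P (length ?E + 1) s ?t" .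
  then show ?case using s1 unfolding simulates_def
    by (intro exI[of _ "length ?E + 1"] exI[of _ ?t] exI[of _ 1]) (simp add: same_def agree_def)
qed

text \<open>The slowdown is the length of the compiled code, a constant once the command is
  fixed.\<close>

lemma compiled_program:
  fixes xs :: "nat list"
  defines "\<sigma> \<equiv> \<lparr>store = \<lambda>_. 0, tape_in = xs, tape_out = [], ticks = 0, ok = True\<rparr>"
  assumes "ok (sem c \<sigma>)"
  shows "\<exists>k. ram_computes (compile c 0 0) xs k (tape_out (sem c \<sigma>)) \<and>
    k \<le> length (compile c 0 0) * ticks (sem c \<sigma>)"
proof -
  let ?P = "compile c 0 0" and ?s = "initial_config xs"
  have "code_at ?P (pc ?s) (compile c 0 (pc ?s))"
    by (auto simp: code_at_def initial_config_def)
  moreover have "agree ?s \<sigma>"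
    by (auto simp: agree_def initial_config_def \<sigma>_def view_def)
  ultimately have "simulates ?P 0 (length ?P) ?s \<sigma> (sem c \<sigma>)"
    using compile_correct[of ?P ?s c 0 \<sigma>] assms(2) by (simp add: initial_config_def)
  then obtain k t where "reach ?P k ?s t" "pc t = length ?P" "agree t (sem c \<sigma>)"
    "k \<le> length ?P * ticks (sem c \<sigma>)"
    by (auto simp: simulates_def \<sigma>_def initial_config_def)
  then show ?thesis
    unfolding ram_computes_def reach_def agree_def by (intro exI[of _ k]) auto
qed

section \<open>Trees as parent arrays\<close>

text \<open>\<open>ord\<close> maps positions to vertices, \<open>par\<close> maps positions to
  positions. Only the presence of the parent edges is demanded; that a tree has no other edges is
  derived in \<open>tree_order_edges\<close>.\<close>

definition tree_order :: "nat \<Rightarrow> nat set set \<Rightarrow> (nat \<Rightarrow> nat) \<Rightarrow> (nat \<Rightarrow> nat) \<Rightarrow> bool" where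
  "tree_order n E ord par \<longleftrightarrow> bij_betw ord {..<n} {..<n} \<and>
     (\<forall>i. 0 < i \<longrightarrow> i < n \<longrightarrow> par i < i \<and> {ord i, ord (par i)} \<in> E)"

text \<open>
  For \<open>k = 1\<close> these are the vertex sets of the subtrees with topmost vertex \<open>v\<close>; for larger \<open>k\<close>
  only the edges from \<open>j \<ge> k\<close> to the parent of \<open>j\<close> may be used.
\<close>

definition rooted :: "nat \<Rightarrow> (nat \<Rightarrow> nat) \<Rightarrow> nat \<Rightarrow> nat \<Rightarrow> nat set \<Rightarrow> bool" where
  "rooted n par k v S \<longleftrightarrow> S \<subseteq> {..<n} \<and> v \<in> S \<and> (\<forall>j\<in>S. j \<noteq> v \<longrightarrow> k \<le> j \<and> par j \<in> S)"

lemma rooted_finite: "rooted n par k v S \<Longrightarrow> finite S"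
  by (auto simp: rooted_def intro: finite_subset)

lemma rooted_top: "v < n \<Longrightarrow> rooted n par n v S \<longleftrightarrow> S = {v}"
  by (auto simp: rooted_def) (meson lessThan_iff leD subsetD)

text \<open>If \<open>k\<close> belonged to such a set without being its top, then so would its
  parent; being smaller than \<open>k\<close>, the parent would have to be the top.\<close>

lemma rooted_other:
  assumes "par k < k" "v \<noteq> par k"
  shows "rooted n par k v S \<longleftrightarrow> rooted n par (Suc k) v S"
proof
  assume S: "rooted n par k v S"
  have "j \<noteq> k" if "j \<in> S" "j \<noteq> v" for j
  proof
    assume "j = k"
    then have "par k \<in> S" using S that by (auto simp: rooted_def)
    then have "k \<le> par k" using S assms(2) by (auto simp: rooted_def)
    with assms(1) show False by simp
  qed
  with S show "rooted n par (Suc k) v S"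
    unfolding rooted_def by (metis Suc_leI le_neq_implies_less)
qed (auto simp: rooted_def)

text \<open>Descent: a common element lies in the set below \<open>k\<close>, so it is at least
  \<open>k\<close> and differs from the top of the other set. Hence it exceeds \<open>k\<close>, is
  the top of neither set, and its smaller parent is common as well.\<close>

lemma rooted_disjoint:
  assumes par: "\<And>i. 0 < i \<Longrightarrow> i < n \<Longrightarrow> par i < i" and k: "0 < k" "k < n"
    and S: "rooted n par (Suc k) (par k) S" "rooted n par (Suc k) k T"
  shows "S \<inter> T = {}"
proof -
  have "par k < k" using par k by simp
  have "j \<notin> S \<or> j \<notin> T" for j
  proof (induction j rule: less_induct)
    case (less j)
    show ?case
    proof (rule ccontr)
      assume "\<not> ?thesis"
      then have j: "j \<in> S" "j \<in> T" by auto
      have "k \<le> j" using S(2) j(2) by (cases "j = k") (auto simp: rooted_def)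
      then have "j \<noteq> par k" using \<open>par k < k\<close> by simp
      then have "Suc k \<le> j" "par j \<in> S" using S(1) j(1) by (auto simp: rooted_def)
      moreover have "par j \<in> T" using S(2) j(2) \<open>Suc k \<le> j\<close> by (auto simp: rooted_def)
      moreover have "par j < j" using par[of j] \<open>Suc k \<le> j\<close> j(1) S(1) by (auto simp: rooted_def)
      ultimately show False using less.IH by blast
    qed
  qed
  then show ?thesis by blast
qed

text \<open>The recursion of the dynamic program. Cut the edge from \<open>k\<close> to its parent:
  the descendants of \<open>k\<close> within \<open>U\<close> form \<open>T\<close>, the rest forms
  \<open>S\<close>. The parent of a proper descendant is again a descendant, and the parent of a
  position outside \<open>T\<close> is outside \<open>T\<close>, so both parts remain
  closed.\<close>

lemma rooted_parent:
  assumes par: "\<And>i. 0 < i \<Longrightarrow> i < n \<Longrightarrow> par i < i" and k: "0 < k" "k < n"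
  shows "rooted n par k (par k) U \<longleftrightarrow> rooted n par (Suc k) (par k) U \<or>
    (\<exists>S T. rooted n par (Suc k) (par k) S \<and> rooted n par (Suc k) k T \<and> U = S \<union> T)"
    (is "?l \<longleftrightarrow> ?r")
proof
  assume U: ?l
  show ?r
  proof (cases "k \<in> U")
    case False
    then have "rooted n par (Suc k) (par k) U"
      using U unfolding rooted_def by (metis Suc_leI le_neq_implies_less)
    then show ?thesis by blast
  next
    case True
    let ?R = "{(i, par i) | i. 0 < i \<and> i < n}\<^sup>*"
    let ?T = "{j \<in> U. (j, k) \<in> ?R}"
    have desc: "y \<le> x" if "(x, y) \<in> ?R" for x y
      using that by induction (auto dest!: par)
    have "k \<in> ?T" using True by simp
    have step: "par j \<in> ?T" if "j \<in> ?T" "j \<noteq> k" for j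
    proof -
      have "(par j, k) \<in> ?R"
        using that by (auto elim!: converse_rtranclE)
      then have "k \<le> par j" by (rule desc)
      moreover have "j \<noteq> par k" using that desc[of j k] par[OF k] by auto
      ultimately show ?thesis using that U \<open>(par j, k) \<in> ?R\<close> by (auto simp: rooted_def)
    qed
    have T: "rooted n par (Suc k) k ?T"
      unfolding rooted_def
    proof (intro conjI ballI impI)
      fix j assume "j \<in> ?T" "j \<noteq> k"
      then show "par j \<in> ?T" by (rule step)
      from \<open>j \<in> ?T\<close> have "k \<le> j" using desc by auto
      with \<open>j \<noteq> k\<close> show "Suc k \<le> j" by simp
    qed (use U True in \<open>auto simp: rooted_def\<close>)
    have "(par k, k) \<notin> ?R" using desc par[OF k] by fastforce
    have S: "rooted n par (Suc k) (par k) (U - ?T)"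
      unfolding rooted_def
    proof (intro conjI ballI impI)
      show "U - ?T \<subseteq> {..<n}" using U by (auto simp: rooted_def)
      show "par k \<in> U - ?T" using U \<open>(par k, k) \<notin> ?R\<close> by (auto simp: rooted_def)
      fix j assume j: "j \<in> U - ?T" "j \<noteq> par k"
      have "j \<noteq> k" using j \<open>k \<in> ?T\<close> by blast
      moreover have kj: "k \<le> j" "par j \<in> U" using j U by (auto simp: rooted_def)
      ultimately show "Suc k \<le> j" by simp
      have "j < n" using j(1) U by (auto simp: rooted_def)
      have "(par j, k) \<notin> ?R"
      proof
        assume "(par j, k) \<in> ?R"
        moreover have "(j, par j) \<in> {(i, par i) | i. 0 < i \<and> i < n}"
          using \<open>j < n\<close> kj(1) k by auto
        ultimately have "(j, k) \<in> ?R" by (rule converse_rtrancl_into_rtrancl[rotated])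
        with j show False by blast
      qed
      with kj show "par j \<in> U - ?T" by blast
    qed
    have "U = (U - ?T) \<union> ?T" by blast
    with S T show ?thesis by blast
  qed
next
  assume ?r
  then show ?l
  proof (elim disjE exE conjE)
    assume "rooted n par (Suc k) (par k) U"
    then show ?thesis by (auto simp: rooted_def)
  next
    fix S T assume "rooted n par (Suc k) (par k) S" "rooted n par (Suc k) k T" "U = S \<union> T"
    then show ?thesis unfolding rooted_def using k by (auto dest: Suc_leD)
  qed
qed

section \<open>Edges and connected sets of a tree in terms of parents\<close>

text \<open>Always step from the larger endpoint to its parent. The path found for the smaller pair
  stays strictly below the removed endpoint, thanks to the bound by \<open>max a b\<close>; so that
  endpoint is new and the path remains simple.\<close>

lemma parent_path:
  fixes par :: "nat \<Rightarrow> nat"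
  assumes par: "\<And>i. 0 < i \<Longrightarrow> i < n \<Longrightarrow> par i < i" and "a < n" "b < n"
  defines "adj \<equiv> \<lambda>x y. (0 < x \<and> x < n \<and> par x = y) \<or> (0 < y \<and> y < n \<and> par y = x)"
  shows "\<exists>vs. vs \<noteq> [] \<and> distinct vs \<and> hd vs = a \<and> last vs = b \<and> set vs \<subseteq> {..max a b} \<and>
    successively adj vs"
  using \<open>a < n\<close> \<open>b < n\<close>
proof (induction "a + b" arbitrary: a b rule: less_induct)
  case less
  consider "a = b" | "a < b" | "b < a" by linarith
  then show ?case
  proof cases
    case 1
    then show ?thesis by (intro exI[of _ "[a]"]) auto
  next
    case 2
    then have "par b < b" using par less.prems by auto
    with less.hyps[of a "par b"] less.prems obtain vs where vs:
      "vs \<noteq> []" "distinct vs" "hd vs = a" "last vs = par b" "set vs \<subseteq> {..max a (par b)}"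
      "successively adj vs" by auto
    have "b \<notin> set vs" using vs(5) 2 \<open>par b < b\<close> by auto
    then show ?thesis using vs 2 less.prems \<open>par b < b\<close>
      by (intro exI[of _ "vs @ [b]"]) (auto simp: successively_append_iff adj_def)
  next
    case 3
    then have "par a < a" using par less.prems by auto
    with less.hyps[of "par a" b] less.prems obtain vs where vs:
      "vs \<noteq> []" "distinct vs" "hd vs = par a" "last vs = b" "set vs \<subseteq> {..max (par a) b}"
      "successively adj vs" by auto
    have "a \<notin> set vs" using vs(5) 3 \<open>par a < a\<close> by auto
    then show ?thesis using vs 3 less.prems \<open>par a < a\<close>
      by (intro exI[of _ "a # vs"]) (auto simp: successively_Cons adj_def)
  qed
qed

text \<open>An edge not joining a vertex to its parent closes a cycle with the path of parent edges.\<close>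

lemma tree_order_edges:
  assumes tree: "is_tree {..<n} E" and ord: "tree_order n E ord par"
  shows "E = (\<lambda>i. {ord i, ord (par i)}) ` {0<..<n}"
proof
  show "(\<lambda>i. {ord i, ord (par i)}) ` {0<..<n} \<subseteq> E"
    using ord by (auto simp: tree_order_def)
  have par: "par i < i" if "0 < i" "i < n" for i using ord that by (auto simp: tree_order_def)
  have bij: "bij_betw ord {..<n} {..<n}" using ord by (simp add: tree_order_def)
  show "E \<subseteq> (\<lambda>i. {ord i, ord (par i)}) ` {0<..<n}"
  proof
    fix e assume "e \<in> E"
    then obtain u v where uv: "u < n" "v < n" "u \<noteq> v" "e = {u, v}"
      using tree by (auto simp: is_tree_def simple_graph_def)
    then have "u \<in> ord ` {..<n}" "v \<in> ord ` {..<n}" using bij by (simp_all add: bij_betw_def)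
    then obtain a b where ab: "a < n" "b < n" "u = ord a" "v = ord b" by blast
    let ?adj = "\<lambda>x y. (0 < x \<and> x < n \<and> par x = y) \<or> (0 < y \<and> y < n \<and> par y = x)"
    obtain vs where vs: "vs \<noteq> []" "distinct vs" "hd vs = a" "last vs = b" "set vs \<subseteq> {..max a b}"
      "successively ?adj vs"
      using parent_path[OF par ab(1,2)] by blast
    have edge: "{ord x, ord y} \<in> E" if "?adj x y" for x y
      using that ord unfolding tree_order_def by (metis insert_commute)
    show "e \<in> (\<lambda>i. {ord i, ord (par i)}) ` {0<..<n}"
    proof (rule ccontr)
      assume no: "e \<notin> (\<lambda>i. {ord i, ord (par i)}) ` {0<..<n}"
      have "\<not> ?adj a b" using no ab uv by (auto simp: insert_commute)
      have "a \<noteq> b" using ab uv by auto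
      \<comment> \<open>One vertex is impossible because \<open>a \<noteq> b\<close>, two because
        \<open>a\<close> and \<open>b\<close> are not joined by a parent edge.\<close>
      have "length vs \<ge> 3"
      proof (cases vs)
        case (Cons x xs)
        note C = this
        show ?thesis
        proof (cases xs)
          case Nil then show ?thesis using C vs \<open>a \<noteq> b\<close> by auto
        next
          case (Cons y ys)
          then show ?thesis using C vs \<open>\<not> ?adj a b\<close> by (cases ys) auto
        qed
      qed (use vs in simp)
      moreover have "set vs \<subseteq> {..<n}" using vs(5) ab by auto
      then have "distinct (map ord vs)"
        using vs(2) bij by (auto simp: distinct_map bij_betw_def intro: inj_on_subset)
      moreover have "{map ord vs ! i, map ord vs ! Suc i} \<in> E" if "Suc i < length (map ord vs)" for i
        using that vs(6) edge by (simp add: successively_conv_nth)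
      moreover have "{last (map ord vs), hd (map ord vs)} \<in> E"
        using vs uv ab \<open>e \<in> E\<close> by (simp add: last_map hd_map insert_commute)
      ultimately have "cycle E (map ord vs)" by (simp add: cycle_def)
      with tree show False by (auto simp: is_tree_def)
    qed
  qed
qed

text \<open>The top is the least position. If another \<open>j\<close> in \<open>S\<close> had its
  parent outside \<open>S\<close>, the descendants of \<open>j\<close> in \<open>S\<close> would be
  closed under adjacency, and the top, being smaller than \<open>j\<close>, could not be reached.
  Conversely, every position climbs to the top along parent edges.\<close>

lemma connected_iff_rooted:
  assumes E: "E = (\<lambda>i. {ord i, ord (par i)}) ` {0<..<n}"
    and par: "\<And>i. 0 < i \<Longrightarrow> i < n \<Longrightarrow> par i < i"
    and inj: "inj_on ord {..<n}" and S: "S \<subseteq> {..<n}"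
  shows "connected_graph (ord ` S) (induced_edges E (ord ` S)) \<longleftrightarrow> (\<exists>v. rooted n par 1 v S)"
proof -
  let ?R = "{(x, y). {x, y} \<in> induced_edges E (ord ` S)}"
  have R: "(ord x, ord y) \<in> ?R \<longleftrightarrow> (0 < x \<and> par x = y) \<or> (0 < y \<and> par y = x)"
    if "x \<in> S" "y \<in> S" for x y
  proof -
    have xy: "x < n" "y < n" using that S by auto
    have *: "ord i = ord j \<longleftrightarrow> i = j" if "i < n" "j < n" for i j
      using inj that by (auto simp: inj_on_eq_iff)
    have "(ord x, ord y) \<in> ?R \<longleftrightarrow> (\<exists>i. 0 < i \<and> i < n \<and> {ord x, ord y} = {ord i, ord (par i)})"
      using that by (auto simp: induced_edges_def E)
    also have "\<dots> \<longleftrightarrow> (\<exists>i. 0 < i \<and> i < n \<and> (x = i \<and> y = par i \<or> x = par i \<and> y = i))"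
    proof -
      have "{ord x, ord y} = {ord i, ord (par i)} \<longleftrightarrow> (x = i \<and> y = par i \<or> x = par i \<and> y = i)"
        if "0 < i" "i < n" for i
        using * xy that par[of i] by (auto simp: doubleton_eq_iff)
      then show ?thesis by blast
    qed
    also have "\<dots> \<longleftrightarrow> (0 < x \<and> par x = y) \<or> (0 < y \<and> par y = x)" using xy by auto
    finally show ?thesis .
  qed
  have RS: "x \<in> ord ` S \<and> y \<in> ord ` S" if "(x, y) \<in> ?R" for x y
    using that by (auto simp: induced_edges_def)
  show ?thesis
  proof
    assume conn: "connected_graph (ord ` S) (induced_edges E (ord ` S))"
    then have "S \<noteq> {}" by (auto simp: connected_graph_def)
    have fin: "finite S" using S finite_subset by blast
    define v where "v = Min S"
    have "v \<in> S" using \<open>S \<noteq> {}\<close> fin by (simp add: v_def)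
    have "par j \<in> S" if j: "j \<in> S" "j \<noteq> v" for j
    proof (rule ccontr)
      assume "par j \<notin> S"
      have "v < j" using j fin by (simp add: v_def le_neq_implies_less)
      let ?P = "{(i, par i) | i. 0 < i \<and> i < n}\<^sup>*"
      have desc: "y \<le> x" if "(x, y) \<in> ?P" for x y
        using that by induction (auto dest!: par)
      let ?D = "{x \<in> S. (x, j) \<in> ?P}"
      have closed_step: "y \<in> ord ` ?D" if "(x, y) \<in> ?R" "x \<in> ord ` ?D" for x y
      proof -
        from that RS obtain a b where ab: "x = ord a" "y = ord b" "a \<in> ?D" "b \<in> S" by blast
        with R[of a b] that(1) consider "0 < a" "par a = b" | "0 < b" "par b = a" by auto
        then have "(b, j) \<in> ?P"
        proof cases
          case 1
          then have "a \<noteq> j" using ab \<open>par j \<notin> S\<close> by auto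
          with 1 ab(3) show ?thesis by (auto elim!: converse_rtranclE)
        next
          case 2
          then have "(b, a) \<in> {(i, par i) | i. 0 < i \<and> i < n}" using ab S by auto
          then show ?thesis using ab(3) by (auto intro: converse_rtrancl_into_rtrancl)
        qed
        with ab show ?thesis by auto
      qed
      have closed: "y \<in> ord ` ?D" if "(x, y) \<in> ?R\<^sup>*" "x \<in> ord ` ?D" for x y
        using that(1)
      proof (induction rule: rtrancl_induct)
        case (step y z)
        from closed_step[OF step(2,3)] show ?case .
      qed (rule that(2))
      have "(ord j, ord v) \<in> ?R\<^sup>*"
        using conn j \<open>v \<in> S\<close> by (auto simp: connected_graph_def)
      then have "ord v \<in> ord ` ?D" using closed j by blast
      then have "v \<in> ?D" using inj \<open>v \<in> S\<close> S by (auto simp: inj_on_def) 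
      with desc \<open>v < j\<close> show False by fastforce
    qed
    moreover have "1 \<le> j" if "j \<in> S" "j \<noteq> v" for j
      using that fin Min_le[of S j] by (cases j) (auto simp: v_def)
    ultimately have "rooted n par 1 v S" using S \<open>v \<in> S\<close> by (auto simp: rooted_def)
    then show "\<exists>v. rooted n par 1 v S" ..
  next
    assume "\<exists>v. rooted n par 1 v S"
    then obtain v where v: "rooted n par 1 v S" ..
    have up: "(ord j, ord v) \<in> ?R\<^sup>*" if "j \<in> S" for j
      using that
    proof (induction j rule: less_induct)
      case (less j)
      show ?case
      proof (cases "j = v")
        case False
        then have j: "0 < j" "par j \<in> S" "j < n" using v less.prems by (auto simp: rooted_def)
        then have "(ord j, ord (par j)) \<in> ?R" using R less.prems by blast
        moreover have "(ord (par j), ord v) \<in> ?R\<^sup>*" using less.IH par j by blast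
        ultimately show ?thesis by (rule converse_rtrancl_into_rtrancl)
      qed simp
    qed
    have "sym (?R\<^sup>*)" by (rule sym_rtrancl) (auto simp: sym_def insert_commute)
    then have "(ord a, ord b) \<in> ?R\<^sup>*" if "a \<in> S" "b \<in> S" for a b
      using up that by (meson rtrancl_trans symD)
    then show "connected_graph (ord ` S) (induced_edges E (ord ` S))"
      using v by (auto simp: connected_graph_def rooted_def)
  qed
qed


section \<open>Colour balance, and solutions as sets of positions\<close>

definition weight :: "colour \<Rightarrow> int" where
  "weight c = (case c of Blue \<Rightarrow> 1 | Red \<Rightarrow> -1)"

definition balance :: "(nat \<Rightarrow> colour) \<Rightarrow> nat set \<Rightarrow> int" where
  "balance c S = (\<Sum>i\<in>S. weight (c i))"

lemma abs_balance_le: "\<bar>balance c S\<bar> \<le> int (card S)"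
proof -
  have "\<bar>balance c S\<bar> \<le> (\<Sum>i\<in>S. \<bar>weight (c i)\<bar>)" unfolding balance_def by (rule sum_abs)
  also have "\<dots> \<le> (\<Sum>i\<in>S. 1)" by (rule sum_mono) (simp add: weight_def split: colour.split)
  finally show ?thesis by simp
qed

lemma balance_eq:
  assumes "finite S" "inj_on ord S"
  shows "balance (\<lambda>i. col (ord i)) S =
    int (card {v \<in> ord ` S. col v = Blue}) - int (card {v \<in> ord ` S. col v = Red})"
proof -
  have "weight c = of_bool (c = Blue) - of_bool (c = Red)" for c
    by (cases c) (auto simp: weight_def)
  then have "balance (\<lambda>i. col (ord i)) S =
      (\<Sum>v\<in>ord ` S. of_bool (col v = Blue) - of_bool (col v = Red))"
    using assms by (simp add: balance_def sum.reindex)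
  also have "\<dots> = int (card {v \<in> ord ` S. col v = Blue}) - int (card {v \<in> ord ` S. col v = Red})"
    using assms by (simp add: sum_subtractf sum_of_bool_eq Int_def)
  finally show ?thesis .
qed

lemma optimal_rooted_solution:
  assumes tree: "is_tree {..<n} E" and ord: "tree_order n E ord par"
    and S: "S = {} \<or> (\<exists>v. rooted n par 1 v S)" "balance (\<lambda>i. col (ord i)) S = 0"
    and opt: "\<And>v U. rooted n par 1 v U \<Longrightarrow> balance (\<lambda>i. col (ord i)) U = 0 \<Longrightarrow> card U \<le> card S"
  shows "bcs_solution {..<n} E col (ord ` S)"
proof -
  have par: "par i < i" if "0 < i" "i < n" for i using ord that by (auto simp: tree_order_def)
  have bij: "bij_betw ord {..<n} {..<n}" using ord by (simp add: tree_order_def)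
  then have inj: "inj_on ord {..<n}" by (simp add: bij_betw_def)
  have bcs: "balanced_connected_subgraph {..<n} E col (ord ` U) \<longleftrightarrow>
      (U = {} \<or> (\<exists>v. rooted n par 1 v U)) \<and> balance (\<lambda>i. col (ord i)) U = 0"
    if "U \<subseteq> {..<n}" for U
  proof -
    have "finite U" "inj_on ord U" using that inj by (auto intro: finite_subset inj_on_subset)
    moreover have "ord ` U \<subseteq> {..<n}" using bij that by (auto simp: bij_betw_def)
    ultimately show ?thesis
      using connected_iff_rooted[OF tree_order_edges[OF tree ord] par inj that]
      by (auto simp: balanced_connected_subgraph_def balance_eq)
  qed
  have sub: "S \<subseteq> {..<n}" using S by (auto simp: rooted_def)
  have "card W \<le> card (ord ` S)" if W: "balanced_connected_subgraph {..<n} E col W" for W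
  proof -
    have "W \<subseteq> ord ` {..<n}" using W bij by (simp add: balanced_connected_subgraph_def bij_betw_def)
    then obtain U where U: "U \<subseteq> {..<n}" "W = ord ` U" by (auto simp: subset_image_iff)
    have "card U \<le> card S" using W U bcs[of U] opt by auto
    moreover have "card W = card U" "card (ord ` S) = card S"
      using U sub inj by (auto intro: card_image inj_on_subset)
    ultimately show ?thesis by simp
  qed
  then show ?thesis using bcs[OF sub] S by (simp add: bcs_solution_def)
qed

section \<open>Rows of the dynamic program\<close>

text \<open>
  The entry at \<open>x\<close> of the row for \<open>v\<close> belongs to balance \<open>x - s\<close>, where \<open>s\<close> bounds the size of
  the subtrees. Thus the indices of two merged rows add up, and no index is negative.
  The value \<open>0\<close> stands for infeasibility.
\<close>

definition row_ok :: "nat \<Rightarrow> (nat \<Rightarrow> nat) \<Rightarrow> (nat \<Rightarrow> colour) \<Rightarrow> nat \<Rightarrow> nat \<Rightarrow> nat \<Rightarrow>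
    (nat \<Rightarrow> nat) \<Rightarrow> (nat \<Rightarrow> nat set) \<Rightarrow> bool" where
  "row_ok n par c k v s H cs \<longleftrightarrow>
     (\<forall>S. rooted n par k v S \<longrightarrow> card S \<le> s \<and> card S \<le> H (nat (balance c S + int s))) \<and>
     (\<forall>x\<le>2*s. 0 < H x \<longrightarrow>
        rooted n par k v (cs x) \<and> card (cs x) = H x \<and> balance c (cs x) + int s = int x)"

text \<open>In the first family nothing is taken from below \<open>k\<close>. This contributes
  balance 0, which has index \<open>t\<close> in a row with bound \<open>t\<close>; hence the shift
  to \<open>x + t\<close>.\<close>

definition candidates :: "nat \<Rightarrow> nat \<Rightarrow> (nat \<Rightarrow> nat) \<Rightarrow> (nat \<Rightarrow> nat) \<Rightarrow> (nat \<Rightarrow> nat set) \<Rightarrow>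
    (nat \<Rightarrow> nat set) \<Rightarrow> (nat \<times> nat \<times> nat set) set" where
  "candidates s t H J cs ds =
     {(x + t, H x, cs x) | x. x \<le> 2*s \<and> 0 < H x} \<union>
     {(x + y, H x + J y, cs x \<union> ds y) | x y. x \<le> 2*s \<and> y \<le> 2*t \<and> 0 < H x \<and> 0 < J y}"

lemma row_ok_index:
  assumes "row_ok n par c k v s H cs" "rooted n par k v S"
  obtains x where "x \<le> 2*s" "balance c S + int s = int x" "card S \<le> H x" "0 < H x"
proof -
  have "card S \<le> s" "card S \<le> H (nat (balance c S + int s))"
    using assms by (auto simp: row_ok_def)
  moreover have "0 < card S"
    using assms(2) rooted_finite[OF assms(2)] by (auto simp: rooted_def card_gt_0_iff)
  ultimately show thesis
    using abs_balance_le[of c S] by (intro that[of "nat (balance c S + int s)"]) auto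
qed

lemma balance_Un:
  "finite S \<Longrightarrow> finite T \<Longrightarrow> S \<inter> T = {} \<Longrightarrow> balance c (S \<union> T) = balance c S + balance c T"
  by (simp add: balance_def sum.union_disjoint)

text \<open>\<open>ub\<close> and \<open>att\<close> say that \<open>M z\<close> is the greatest
  candidate value at index \<open>z\<close>, or 0 if there is none. The candidates cover all
  subtrees by \<open>rooted_parent\<close>, and sizes and balances add by
  \<open>rooted_disjoint\<close>.\<close>

lemma row_ok_merge:
  assumes par: "\<And>i. 0 < i \<Longrightarrow> i < n \<Longrightarrow> par i < i" and k: "0 < k" "k < n"
    and p: "row_ok n par c (Suc k) (par k) s H cs" and q: "row_ok n par c (Suc k) k t J ds"
    and ub: "\<And>z u S. (z, u, S) \<in> candidates s t H J cs ds \<Longrightarrow> u \<le> M z"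
    and att: "\<And>z. 0 < M z \<Longrightarrow> (z, M z, es z) \<in> candidates s t H J cs ds"
  shows "row_ok n par c k (par k) (s + t) M es"
  unfolding row_ok_def
proof (intro conjI allI impI)
  fix U assume U: "rooted n par k (par k) U"
  from U rooted_parent[of n par k U] par k
  have "rooted n par (Suc k) (par k) U \<or>
    (\<exists>S T. rooted n par (Suc k) (par k) S \<and> rooted n par (Suc k) k T \<and> U = S \<union> T)" by blast
  then have "card U \<le> s + t \<and> card U \<le> M (nat (balance c U + int (s + t)))"
  proof (elim disjE exE conjE)
    assume U: "rooted n par (Suc k) (par k) U"
    from row_ok_index[OF p U] obtain x where x: "x \<le> 2*s" "balance c U + int s = int x"
      "card U \<le> H x" "0 < H x" .
    then have "(x + t, H x, cs x) \<in> candidates s t H J cs ds" by (auto simp: candidates_def)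
    from ub[OF this] have "card U \<le> M (x + t)" using x by simp
    moreover have "nat (balance c U + int (s + t)) = x + t" using x(2) by simp
    moreover have "card U \<le> s" using p U by (auto simp: row_ok_def)
    ultimately show ?thesis by simp
  next
    fix S T assume S: "rooted n par (Suc k) (par k) S" and T: "rooted n par (Suc k) k T"
      and UST: "U = S \<union> T"
    have "S \<inter> T = {}" using rooted_disjoint[of n par k, OF par k S T] .
    then have *: "card U = card S + card T" "balance c U = balance c S + balance c T"
      using rooted_finite[OF S] rooted_finite[OF T] UST by (auto simp: card_Un_disjoint balance_Un)
    from row_ok_index[OF p S] obtain x where x: "x \<le> 2*s" "balance c S + int s = int x"
      "card S \<le> H x" "0 < H x" .
    from row_ok_index[OF q T] obtain y where y: "y \<le> 2*t" "balance c T + int t = int y"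
      "card T \<le> J y" "0 < J y" .
    have "(x + y, H x + J y, cs x \<union> ds y) \<in> candidates s t H J cs ds"
      using x y by (auto simp: candidates_def)
    from ub[OF this] have "card U \<le> M (x + y)" using x y * by simp
    moreover have "nat (balance c U + int (s + t)) = x + y" using x(2) y(2) * by simp
    moreover have "card S \<le> s" "card T \<le> t" using p q S T by (auto simp: row_ok_def)
    ultimately show ?thesis using * by simp
  qed
  then show "card U \<le> s + t" "card U \<le> M (nat (balance c U + int (s + t)))" by simp_all
next
  fix z assume "0 < M z"
  have "rooted n par k (par k) (es z) \<and> card (es z) = M z \<and> balance c (es z) + int (s + t) = int z"
    using att[OF \<open>0 < M z\<close>] unfolding candidates_def
  proof (elim UnE CollectE exE conjE)
    fix x assume x: "(z, M z, es z) = (x + t, H x, cs x)" "x \<le> 2*s" "0 < H x"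
    then have S: "rooted n par (Suc k) (par k) (cs x)" "card (cs x) = H x"
      "balance c (cs x) + int s = int x"
      using p by (auto simp: row_ok_def)
    with x show ?thesis using rooted_parent[of n par k, OF par k] by auto
  next
    fix x y assume xy: "(z, M z, es z) = (x + y, H x + J y, cs x \<union> ds y)" "x \<le> 2*s" "y \<le> 2*t"
      "0 < H x" "0 < J y"
    have S: "rooted n par (Suc k) (par k) (cs x)" "card (cs x) = H x"
      "balance c (cs x) + int s = int x"
      using p xy by (auto simp: row_ok_def)
    have T: "rooted n par (Suc k) k (ds y)" "card (ds y) = J y"
      "balance c (ds y) + int t = int y"
      using q xy by (auto simp: row_ok_def)
    have "cs x \<inter> ds y = {}" using rooted_disjoint[of n par k, OF par k S(1) T(1)] .
    then have "card (es z) = M z" "balance c (es z) = balance c (cs x) + balance c (ds y)"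
      using rooted_finite[OF S(1)] rooted_finite[OF T(1)] xy(1) S T
      by (auto simp: card_Un_disjoint balance_Un)
    moreover have "rooted n par k (par k) (es z)"
      using rooted_parent[of n par k, OF par k] S(1) T(1) xy(1) by auto
    ultimately show ?thesis using xy(1) S T by simp
  qed
  then show "rooted n par k (par k) (es z)" "card (es z) = M z"
    "balance c (es z) + int (s + t) = int z" by simp_all
qed

lemma row_ok_other:
  assumes "par k < k" "v \<noteq> par k" "row_ok n par c (Suc k) v s H cs"
  shows "row_ok n par c k v s H cs"
  using assms(3) by (simp add: row_ok_def rooted_other assms(1,2))

text \<open>With size bound 1 a row has three entries; a blue vertex occupies index 2, a red one
  index 0.\<close>

lemma row_ok_leaf:
  assumes "v < n" "H (nat (weight (c v) + 1)) = 1" "cs (nat (weight (c v) + 1)) = {v}"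
    "\<And>x. x \<noteq> nat (weight (c v) + 1) \<Longrightarrow> x \<le> 2 \<Longrightarrow> H x = 0"
  shows "row_ok n par c n v 1 H cs"
  unfolding row_ok_def rooted_top[OF assms(1)]
proof (intro conjI allI impI)
  fix x assume "x \<le> 2*1" "0 < H x"
  then have "x = nat (weight (c v) + 1)" using assms(4)[of x] by fastforce
  moreover have "weight (c v) + 1 \<ge> 0" by (simp add: weight_def split: colour.split)
  ultimately show "cs x = {v}" "card (cs x) = H x" "balance c (cs x) + int 1 = int x"
    using assms(2,3) by (simp_all add: balance_def)
qed (use assms(2) in \<open>auto simp: balance_def\<close>)

section \<open>Sets described by pointers\<close>

text \<open>A positive right pointer marks a union of two entries; otherwise the left component is
  not an address but the single position itself. The comparisons with \<open>a\<close> secure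
  termination; \<open>rows_ok\<close> guarantees them for positive right pointers.\<close>

function cell_set :: "(nat \<Rightarrow> nat) \<Rightarrow> (nat \<Rightarrow> nat) \<Rightarrow> nat \<Rightarrow> nat set" where
  "cell_set l r a =
     (if 0 < r a \<and> l a < a \<and> r a < a then cell_set l r (l a) \<union> cell_set l r (r a) else {l a})"
  by auto
termination by (relation "measure (\<lambda>(l, r, a). a)") auto

declare cell_set.simps [simp del]

text \<open>An entry depends on no address above its own, so rows appended later do not alter the
  sets described by earlier ones.\<close>

lemma cell_set_cong:
  "(\<And>b. b \<le> a \<Longrightarrow> l b = l' b \<and> r b = r' b) \<Longrightarrow> cell_set l r a = cell_set l' r' a"
proof (induction a rule: less_induct)
  case (less a)
  have "cell_set l r b = cell_set l' r' b" if "b < a" for b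
    using less.IH[OF that] less.prems that by simp
  then show ?case
    using less.prems[of a] by (subst (1 2) cell_set.simps) auto
qed

section \<open>Reasoning about structured programs\<close>

lemma store_set_loc [simp]: "store (set_loc a i x s) = (store s)((a, i) := x)"
  and ticks_set_loc [simp]: "ticks (set_loc a i x s) = Suc (ticks s)"
  and tape_in_set_loc [simp]: "tape_in (set_loc a i x s) = tape_in s"
  and tape_out_set_loc [simp]: "tape_out (set_loc a i x s) = tape_out s"
  by (simp_all add: set_loc_def)

text \<open>A syntactic sufficient condition. Within one array, indices are distinguished only when
  the written index is a constant, which covers the scalar variables.\<close>

primrec keeps :: "array \<Rightarrow> nat \<Rightarrow> com \<Rightarrow> bool" where
  "keeps a i Skip = True"
| "keeps a i (Assign b e f) = (a \<noteq> b \<or> (\<exists>j. e = Num j \<and> i \<noteq> j))"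
| "keeps a i (Seq c d) = (keeps a i c \<and> keeps a i d)"
| "keeps a i (Cond e c d) = (keeps a i c \<and> keeps a i d)"
| "keeps a i (For v e c) = ((a \<noteq> Scal \<or> i \<noteq> v) \<and> keeps a i c)"
| "keeps a i (Get b e) = (a \<noteq> b \<or> (\<exists>j. e = Num j \<and> i \<noteq> j))"
| "keeps a i (Put e) = True"

primrec reads :: "com \<Rightarrow> bool" where
  "reads Skip = False"
| "reads (Assign b e f) = False"
| "reads (Seq c d) = (reads c \<or> reads d)"
| "reads (Cond e c d) = (reads c \<or> reads d)"
| "reads (For v e c) = reads c"
| "reads (Get b e) = True"
| "reads (Put e) = False"

primrec prints :: "com \<Rightarrow> bool" where
  "prints Skip = False"
| "prints (Assign b e f) = False"
| "prints (Seq c d) = (prints c \<or> prints d)"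
| "prints (Cond e c d) = (prints c \<or> prints d)"
| "prints (For v e c) = prints c"
| "prints (Get b e) = False"
| "prints (Put e) = True"

lemma fold_invariant_upt:
  assumes "I 0 s" "\<And>i s. i < n \<Longrightarrow> I i s \<Longrightarrow> I (Suc i) (f i s)"
  shows "I n (fold f [0..<n] s)"
  using assms
proof (induction n)
  case (Suc n)
  then have "I n (fold f [0..<n] s)" by simp
  then show ?case using Suc.prems(2)[of n] by simp
qed simp

lemma keeps_store: "keeps a i c \<Longrightarrow> store (sem c s) (a, i) = store s (a, i)"
proof (induction c arbitrary: s)
  case (For v e c)
  have "store (fold (\<lambda>i s. sem c (set_loc Scal v i s)) [0..<eval e (store s)]
      (s\<lparr>ticks := Suc (ticks s)\<rparr>)) (a, i) = store s (a, i)"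
  proof (rule fold_invariant_upt[where I = "\<lambda>_ t. store t (a, i) = store s (a, i)"])
    fix j and t :: state assume "store t (a, i) = store s (a, i)"
    then show "store (sem c (set_loc Scal v j t)) (a, i) = store s (a, i)"
      using For by auto
  qed simp
  then show ?case by simp
qed auto

lemma reads_sem: "\<not> reads c \<Longrightarrow> ok (sem c s) = ok s"
proof (induction c arbitrary: s)
  case (For v e c)
  have "ok (fold (\<lambda>i s. sem c (set_loc Scal v i s)) [0..<eval e (store s)]
      (s\<lparr>ticks := Suc (ticks s)\<rparr>)) = ok s"
  proof (rule fold_invariant_upt[where I = "\<lambda>_ t. ok t = ok s"])
    fix j and t :: state assume "ok t = ok s"
    then show "ok (sem c (set_loc Scal v j t)) = ok s" using For by simp
  qed simp
  then show ?case by simp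
qed auto

lemma prints_sem: "\<not> prints c \<Longrightarrow> tape_out (sem c s) = tape_out s"
proof (induction c arbitrary: s)
  case (For v e c)
  have "tape_out (fold (\<lambda>i s. sem c (set_loc Scal v i s)) [0..<eval e (store s)]
      (s\<lparr>ticks := Suc (ticks s)\<rparr>)) = tape_out s"
  proof (rule fold_invariant_upt[where I = "\<lambda>_ t. tape_out t = tape_out s"])
    fix j and t :: state assume "tape_out t = tape_out s"
    then show "tape_out (sem c (set_loc Scal v j t)) = tape_out s" using For by simp
  qed simp
  then show ?case by simp
qed auto

text \<open>The step may also use that everything the loop cannot write still has its value from
  before the loop. Invariants thus need to mention only what changes.\<close>

lemma For_rule:
  assumes "eval e (store s) = n"
    and "I 0 (s\<lparr>ticks := Suc (ticks s)\<rparr>)"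
    and "\<And>i t. i < n \<Longrightarrow> I i t \<Longrightarrow>
      (\<And>a j. keeps a j (For v e c) \<Longrightarrow> store t (a, j) = store s (a, j)) \<Longrightarrow>
      I (Suc i) (sem c (set_loc Scal v i t))"
  shows "I n (sem (For v e c) s)"
proof -
  let ?J = "\<lambda>i (t :: state). I i t \<and> (\<forall>a j. keeps a j (For v e c) \<longrightarrow> store t (a, j) = store s (a, j))"
  have "?J n (fold (\<lambda>i s. sem c (set_loc Scal v i s)) [0..<n] (s\<lparr>ticks := Suc (ticks s)\<rparr>))"
  proof (rule fold_invariant_upt)
    fix i t assume "i < n" and *: "?J i t"
    then have "I (Suc i) (sem c (set_loc Scal v i t))" using assms(3) by blast
    moreover have "store (sem c (set_loc Scal v i t)) (a, j) = store s (a, j)"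
      if "keeps a j (For v e c)" for a j
      using that * keeps_store[of a j c] by auto
    ultimately show "?J (Suc i) (sem c (set_loc Scal v i t))" by blast
  qed (use assms(2) in auto)
  then show ?thesis using assms(1) by simp
qed

section \<open>The program\<close>

abbreviation Var :: "nat \<Rightarrow> exp" where "Var x \<equiv> Fetch Scal (Num x)"

abbreviation set_var :: "nat \<Rightarrow> exp \<Rightarrow> com" (infix "::=" 65) where
  "x ::= e \<equiv> Assign Scal (Num x) e"

abbreviation (input) "vn \<equiv> 2 :: nat"
abbreviation (input) "vm \<equiv> 3 :: nat"
abbreviation (input) "vi \<equiv> 4 :: nat"
abbreviation (input) "vj \<equiv> 5 :: nat"
abbreviation (input) "vk \<equiv> 6 :: nat"
abbreviation (input) "vp \<equiv> 7 :: nat"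
abbreviation (input) "vx \<equiv> 8 :: nat"
abbreviation (input) "vy \<equiv> 9 :: nat"
abbreviation (input) "vu \<equiv> 10 :: nat"
abbreviation (input) "vw \<equiv> 11 :: nat"
abbreviation (input) "vtop \<equiv> 12 :: nat"
abbreviation (input) "vcell \<equiv> 13 :: nat"
abbreviation (input) "vval \<equiv> 14 :: nat"
abbreviation (input) "vleft \<equiv> 15 :: nat"
abbreviation (input) "vright \<equiv> 16 :: nat"
abbreviation (input) "vbest \<equiv> 17 :: nat"
abbreviation (input) "vroot \<equiv> 18 :: nat"

definition read_input :: com where
  "read_input =
     Get Scal (Num vn) ;; Get Scal (Num vm) ;;
     For vi (Var vn) (Get Colr (Var vi)) ;;
     For vj (Var vm) (Get EndA (Var vj) ;; Get EndB (Var vj))"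

text \<open>\<open>Pos\<close> of a vertex is its position plus one, or \<open>0\<close> as long as the vertex has none.\<close>

definition find_crossing :: com where
  "find_crossing =
     For vj (Var vm)
       (vu ::= Fetch EndA (Var vj) ;; vw ::= Fetch EndB (Var vj) ;;
        Cond (Fetch Pos (Var vu))
          (Cond (Fetch Pos (Var vw)) Skip (vx ::= Var vw ;; vy ::= Var vu))
          (Cond (Fetch Pos (Var vw)) (vx ::= Var vu ;; vy ::= Var vw) Skip))"

text \<open>Vertex 0 takes position 0 without a write to \<open>Ord\<close>, because memory is
  initially 0.\<close>

definition compute_order :: com where
  "compute_order =
     Assign Pos (Num 0) (Num 1) ;;
     For vi (Minus (Var vn) (Num 1))
       (find_crossing ;;
        Assign Ord (Plus (Var vi) (Num 1)) (Var vx) ;;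
        Assign Par (Plus (Var vi) (Num 1)) (Minus (Fetch Pos (Var vy)) (Num 1)) ;;
        Assign Pos (Var vx) (Plus (Var vi) (Num 2)))"

text \<open>Addresses start at 1, so that a right pointer 0, never written here, can mark single
  positions. Subtracting twice the colour code from offset 2 gives offset 2 for blue and 0 for
  red.\<close>

definition init_rows :: com where
  "init_rows =
     vtop ::= Num 1 ;;
     For vi (Var vn)
       (Assign Base (Var vi) (Var vtop) ;; Assign Size (Var vi) (Num 1) ;;
        vcell ::= Minus (Plus (Var vtop) (Num 2))
          (Plus (Fetch Colr (Fetch Ord (Var vi))) (Fetch Colr (Fetch Ord (Var vi)))) ;;
        Assign Best (Var vcell) (Num 1) ;; Assign Lft (Var vcell) (Var vi) ;;
        vtop ::= Plus (Var vtop) (Num 3))"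

text \<open>Truncated subtraction makes the test succeed exactly on a strict improvement.\<close>

definition relax :: com where
  "relax =
     Cond (Minus (Var vval) (Fetch Best (Var vcell)))
       (Assign Best (Var vcell) (Var vval) ;; Assign Lft (Var vcell) (Var vleft) ;;
        Assign Rgt (Var vcell) (Var vright))
       Skip"

definition merge_inner :: com where
  "merge_inner =
     For vy (Plus (Plus (Fetch Size (Var vk)) (Fetch Size (Var vk))) (Num 1))
       (vright ::= Plus (Fetch Base (Var vk)) (Var vy) ;;
        Cond (Fetch Best (Var vright))
          (vcell ::= Plus (Plus (Var vtop) (Var vx)) (Var vy) ;;
           vval ::= Plus (Fetch Best (Var vleft)) (Fetch Best (Var vright)) ;; relax)
          Skip)"

text \<open>To keep an entry of the parent unchanged, both pointers are set to it: the union of a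
  set with itself. Thus every entry of a merged row that is in use has a positive
  \<open>Rgt\<close>.\<close>

definition merge_rows :: com where
  "merge_rows =
     For vx (Plus (Plus (Fetch Size (Var vp)) (Fetch Size (Var vp))) (Num 1))
       (vleft ::= Plus (Fetch Base (Var vp)) (Var vx) ;;
        Cond (Fetch Best (Var vleft))
          (vright ::= Var vleft ;;
           vcell ::= Plus (Plus (Var vtop) (Var vx)) (Fetch Size (Var vk)) ;;
           vval ::= Fetch Best (Var vleft) ;; relax ;; merge_inner)
          Skip)"

text \<open>Round \<open>i\<close> removes position \<open>n - 1 - i\<close>; position 0 remains.
  The size is updated after the merge, which needs the old one, and before \<open>vtop\<close> moves
  past the longer new row.\<close>

definition compute_rows :: com where
  "compute_rows =
     For vi (Minus (Var vn) (Num 1))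
       (vk ::= Minus (Minus (Var vn) (Num 1)) (Var vi) ;; vp ::= Fetch Par (Var vk) ;;
        merge_rows ;;
        Assign Base (Var vp) (Var vtop) ;;
        Assign Size (Var vp) (Plus (Fetch Size (Var vp)) (Fetch Size (Var vk))) ;;
        vtop ::= Plus (Var vtop) (Plus (Plus (Fetch Size (Var vp)) (Fetch Size (Var vp))) (Num 1)))"

text \<open>Index \<open>Size\<close> of a row belongs to balance 0.\<close>

definition select_best :: com where
  "select_best =
     For vi (Var vn)
       (vcell ::= Plus (Fetch Base (Var vi)) (Fetch Size (Var vi)) ;;
        Cond (Minus (Fetch Best (Var vcell)) (Var vbest))
          (vbest ::= Fetch Best (Var vcell) ;; vroot ::= Var vcell)
          Skip)"

text \<open>Addresses are visited in decreasing order and pointers lead to smaller ones, so an entry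
  has received all its marks before it is visited.\<close>

definition mark_cells :: com where
  "mark_cells =
     Cond (Var vbest) (Assign Mark (Var vroot) (Num 1)) Skip ;;
     For vi (Var vtop)
       (vcell ::= Minus (Minus (Var vtop) (Num 1)) (Var vi) ;;
        Cond (Fetch Mark (Var vcell))
          (Cond (Fetch Rgt (Var vcell))
             (Assign Mark (Fetch Lft (Var vcell)) (Num 1) ;;
              Assign Mark (Fetch Rgt (Var vcell)) (Num 1))
             (Assign Sel (Fetch Lft (Var vcell)) (Num 1)))
          Skip)"

definition print_selected :: com where
  "print_selected = For vi (Var vn) (Cond (Fetch Sel (Var vi)) (Put (Fetch Ord (Var vi))) Skip)"

definition bcs_program :: com where
  "bcs_program = read_input ;; compute_order ;; init_rows ;; compute_rows ;; select_best ;;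
     mark_cells ;; print_selected"

section \<open>Reading the graph and ordering its vertices\<close>

lemma read_input_correct:
  assumes s: "tape_in s = [n, length es] @ map (\<lambda>v. colour_code (col v)) [0..<n] @
             concat (map (\<lambda>(u, v). [u, v]) es)" "ok s"
  defines "m \<equiv> store (sem read_input s)"
  shows "m (Scal, vn) = n" "m (Scal, vm) = length es"
    "\<And>v. v < n \<Longrightarrow> m (Colr, v) = colour_code (col v)"
    "\<And>j. j < length es \<Longrightarrow> (m (EndA, j), m (EndB, j)) = es ! j"
    "ok (sem read_input s)" "ticks (sem read_input s) \<le> ticks s + 4 + 2 * n + 3 * length es"
proof -
  let ?c = "\<lambda>v. colour_code (col v)" and ?e = "\<lambda>(u, v). [u, v :: nat]"
  let ?L = "For vi (Var vn) (Get Colr (Var vi))"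
  let ?M = "For vj (Var vm) (Get EndA (Var vj) ;; Get EndB (Var vj))"
  define s1 where "s1 = sem (Get Scal (Num vn) ;; Get Scal (Num vm)) s"
  define s2 where "s2 = sem ?L s1"
  define s3 where "s3 = sem ?M s2"
  have s3: "sem read_input s = s3"
    by (simp add: read_input_def s3_def s2_def s1_def)
  have s1: "tape_in s1 = map ?c [0..<n] @ concat (map ?e es)" "ok s1"
    "store s1 (Scal, vn) = n" "store s1 (Scal, vm) = length es" "ticks s1 = ticks s + 2"
    using s by (simp_all add: s1_def)
  let ?I = "\<lambda>i (t :: state). tape_in t = map ?c [i..<n] @ concat (map ?e es) \<and> ok t \<and>
    (\<forall>v<i. store t (Colr, v) = ?c v) \<and> ticks t = ticks s1 + 1 + 2 * i"
  have I: "?I n s2"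
    unfolding s2_def
  proof (rule For_rule[where I = ?I])
    fix i t assume "i < n" "?I i t"
    then show "?I (Suc i) (sem (Get Colr (Var vi)) (set_loc Scal vi i t))"
      by (auto simp: upt_conv_Cons less_Suc_eq)
  qed (use s1 in simp_all)
  have keep2: "store s2 (Scal, vn) = n" "store s2 (Scal, vm) = length es"
    using s1 by (simp_all add: s2_def keeps_store del: sem.simps)
  let ?J = "\<lambda>j (t :: state). tape_in t = concat (map ?e (drop j es)) \<and> ok t \<and>
    (\<forall>i<j. (store t (EndA, i), store t (EndB, i)) = es ! i) \<and> ticks t = ticks s2 + 1 + 3 * j"
  have J: "?J (length es) s3"
    unfolding s3_def
  proof (rule For_rule[where I = ?J])
    fix i t assume i: "i < length es" "?J i t"
    obtain u v where "es ! i = (u, v)" by force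
    with i(1) have "drop i es = (u, v) # drop (Suc i) es" by (metis Cons_nth_drop_Suc)
    with i \<open>es ! i = (u, v)\<close>
    show "?J (Suc i) (sem (Get EndA (Var vj) ;; Get EndB (Var vj)) (set_loc Scal vj i t))"
      by (auto simp: less_Suc_eq)
  qed (use I keep2 in simp_all)
  have keep3: "store s3 (Scal, vn) = n" "store s3 (Scal, vm) = length es"
    "store s3 (Colr, v) = store s2 (Colr, v)" for v
    using keep2 by (simp_all add: s3_def keeps_store del: sem.simps)
  show "m (Scal, vn) = n" "m (Scal, vm) = length es"
    "\<And>v. v < n \<Longrightarrow> m (Colr, v) = colour_code (col v)"
    "\<And>j. j < length es \<Longrightarrow> (m (EndA, j), m (EndB, j)) = es ! j"
    "ok (sem read_input s)" "ticks (sem read_input s) \<le> ticks s + 4 + 2 * n + 3 * length es"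
    using I J keep3 s1(5) by (simp_all add: m_def s3)
qed

lemma crossing_edge:
  assumes "connected_graph V E" "A \<subseteq> V" "a \<in> A" "b \<in> V - A"
  obtains x y where "{x, y} \<in> E" "x \<in> A" "y \<notin> A"
proof -
  have "(a, b) \<in> {(x, y). {x, y} \<in> E}\<^sup>*" using assms by (auto simp: connected_graph_def)
  then have "b \<in> A \<or> (\<exists>x y. {x, y} \<in> E \<and> x \<in> A \<and> y \<notin> A)"
    using assms(3) by induction blast+
  with assms(4) that show thesis by blast
qed

text \<open>A scan step overwrites the pair only with another crossing edge, so once one has been
  seen the pair stays crossing, with \<open>vx\<close> on the unnumbered side. Seven ticks suffice
  per edge: the counter, two assignments, two tests and two more assignments.\<close>

lemma find_crossing_correct:
  fixes s
  defines "m \<equiv> store s" and "t \<equiv> sem find_crossing s"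
  assumes "m (Scal, vm) = k"
    and "\<exists>j<k. (0 < m (Pos, m (EndA, j))) \<noteq> (0 < m (Pos, m (EndB, j)))"
  shows "m (Pos, store t (Scal, vx)) = 0" "0 < m (Pos, store t (Scal, vy))"
    "\<exists>j<k. {store t (Scal, vx), store t (Scal, vy)} = {m (EndA, j), m (EndB, j)}"
    "ticks t \<le> ticks s + 1 + 7 * k"
proof -
  let ?cr = "\<lambda>j. (0 < m (Pos, m (EndA, j))) \<noteq> (0 < m (Pos, m (EndB, j)))"
  let ?I = "\<lambda>i (t :: state). ticks t \<le> ticks s + 1 + 7 * i \<and>
    ((\<exists>j<i. ?cr j) \<longrightarrow> m (Pos, store t (Scal, vx)) = 0 \<and> 0 < m (Pos, store t (Scal, vy)) \<and>
       (\<exists>j<k. {store t (Scal, vx), store t (Scal, vy)} = {m (EndA, j), m (EndB, j)}))"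
  have "?I k t"
    unfolding t_def find_crossing_def
  proof (rule For_rule[where I = ?I])
    fix i t
    let ?c = "vu ::= Fetch EndA (Var vj) ;; vw ::= Fetch EndB (Var vj) ;;
        Cond (Fetch Pos (Var vu))
          (Cond (Fetch Pos (Var vw)) Skip (vx ::= Var vw ;; vy ::= Var vu))
          (Cond (Fetch Pos (Var vw)) (vx ::= Var vu ;; vy ::= Var vw) Skip)"
    assume i: "i < k" "?I i t"
      and fr: "\<And>a j. keeps a j (For vj (Var vm) ?c) \<Longrightarrow> store t (a, j) = store s (a, j)"
    have [simp]: "store t (Pos, v) = m (Pos, v)" "store t (EndA, v) = m (EndA, v)"
      "store t (EndB, v) = m (EndB, v)" for v
      using fr[of _ v] by (simp_all add: m_def)
    show "?I (Suc i) (sem ?c (set_loc Scal vj i t))"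
      using i by (auto simp: less_Suc_eq doubleton_eq_iff)
  qed (use assms(3) m_def in auto)
  with assms(4) show "m (Pos, store t (Scal, vx)) = 0" "0 < m (Pos, store t (Scal, vy))"
    "\<exists>j<k. {store t (Scal, vx), store t (Scal, vy)} = {m (EndA, j), m (EndB, j)}"
    "ticks t \<le> ticks s + 1 + 7 * k" by blast+
qed


text \<open>After \<open>i\<close> rounds the positions up to \<open>i\<close> are filled and
  \<open>Pos\<close> is positive exactly on their vertices. By connectedness some edge leaves this
  set as long as it is not everything, so each of the \<open>n - 1\<close> scans succeeds.\<close>

lemma compute_order_correct:
  fixes s
  defines "m \<equiv> store s" and "t \<equiv> sem compute_order s"
  assumes tree: "is_tree {..<n} E"
    and m: "m (Scal, vn) = n" "m (Scal, vm) = length es"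
      "\<And>j. j < length es \<Longrightarrow> (m (EndA, j), m (EndB, j)) = es ! j" "\<And>v. m (Pos, v) = 0" "m (Ord, 0) = 0"
    and E: "set (map (\<lambda>(u, v). {u, v}) es) = E"
  shows "tree_order n E (\<lambda>i. store t (Ord, i)) (\<lambda>i. store t (Par, i))"
    "ticks t \<le> ticks s + 2 + n * (5 + 7 * length es)"
proof -
  have conn: "connected_graph {..<n} E" and simp: "simple_graph {..<n} E"
    using tree by (auto simp: is_tree_def)
  have "0 < n" using conn by (auto simp: connected_graph_def)
  have edgeE: "{m (EndA, j), m (EndB, j)} \<in> E" if "j < length es" for j
  proof -
    have "(\<lambda>(u, v). {u, v}) (es ! j) \<in> E" using that E by force
    with m(3)[OF that, symmetric] show ?thesis by simp
  qed
  have Eedge: "\<exists>j<length es. {u, v} = {m (EndA, j), m (EndB, j)}" if "{u, v} \<in> E" for u v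
  proof -
    from that E have "{u, v} \<in> set (map (\<lambda>(u, v). {u, v}) es)" by simp
    then obtain j where "j < length es" "{u, v} = (\<lambda>(u, v). {u, v}) (es ! j)"
      by (auto simp: in_set_conv_nth)
    with m(3)[of j, symmetric] show ?thesis by auto
  qed
  let ?body = "find_crossing ;;
        Assign Ord (Plus (Var vi) (Num 1)) (Var vx) ;;
        Assign Par (Plus (Var vi) (Num 1)) (Minus (Fetch Pos (Var vy)) (Num 1)) ;;
        Assign Pos (Var vx) (Plus (Var vi) (Num 2))"
  define s0 where "s0 = set_loc Pos 0 1 s"
  let ?ord = "\<lambda>(t :: state) i. store t (Ord, i)" and ?par = "\<lambda>(t :: state) i. store t (Par, i)"
  let ?I = "\<lambda>i (t :: state). ticks t \<le> ticks s + 2 + i * (5 + 7 * length es) \<and>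
    inj_on (?ord t) {..i} \<and> ?ord t ` {..i} \<subseteq> {..<n} \<and>
    (\<forall>a. 0 < a \<longrightarrow> a \<le> i \<longrightarrow> ?par t a < a \<and> {?ord t a, ?ord t (?par t a)} \<in> E) \<and>
    (\<forall>a\<le>i. store t (Pos, ?ord t a) = Suc a) \<and>
    (\<forall>v. v \<notin> ?ord t ` {..i} \<longrightarrow> store t (Pos, v) = 0)"
  have "?I (n - 1) (sem (For vi (Minus (Var vn) (Num 1)) ?body) s0)"
  proof (rule For_rule[where I = ?I])
    fix i t
    assume i: "i < n - 1" and I: "?I i t"
      and fr: "\<And>a j. keeps a j (For vi (Minus (Var vn) (Num 1)) ?body) \<Longrightarrow>
        store t (a, j) = store s0 (a, j)"
    have [simp]: "store t (EndA, v) = m (EndA, v)" "store t (EndB, v) = m (EndB, v)"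
      "store t (Scal, vm) = length es" for v
      using fr[of _ v] fr[of Scal vm] m(2) by (simp_all add: m_def s0_def find_crossing_def)
    let ?t = "set_loc Scal vi i t"
    define u where "u = sem find_crossing ?t"
    have keep [simp]: "store u (Scal, vi) = i" "store u (Ord, v) = store t (Ord, v)"
      "store u (Par, v) = store t (Par, v)" "store u (Pos, v) = store t (Pos, v)" for v
      by (simp_all add: u_def keeps_store find_crossing_def del: sem.simps)
    let ?A = "?ord t ` {..i}"
    have card: "card ?A = Suc i" using I by (simp add: card_image)
    have pos: "0 < store t (Pos, v) \<longleftrightarrow> v \<in> ?A" for v using I by auto
    have "?A \<subseteq> {..<n}" using I by simp
    moreover have "?A \<noteq> {..<n}" using card i by auto
    ultimately obtain b where "b \<in> {..<n} - ?A" by blast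
    moreover have "?ord t 0 \<in> ?A" by simp
    ultimately obtain x y where xy: "{x, y} \<in> E" "x \<in> ?A" "y \<notin> ?A"
      using crossing_edge[OF conn \<open>?A \<subseteq> {..<n}\<close>] by metis
    from Eedge[OF xy(1)] obtain j where j: "j < length es" "{x, y} = {m (EndA, j), m (EndB, j)}"
      by blast
    moreover have "0 < store t (Pos, x)" "\<not> 0 < store t (Pos, y)"
      unfolding pos using xy by blast+
    ultimately have
      "(0 < store ?t (Pos, store ?t (EndA, j))) \<noteq> (0 < store ?t (Pos, store ?t (EndB, j)))"
      by (auto simp: doubleton_eq_iff)
    with j(1) have "\<exists>j<length es.
        (0 < store ?t (Pos, store ?t (EndA, j))) \<noteq> (0 < store ?t (Pos, store ?t (EndB, j)))" by blast
    note f = find_crossing_correct[of ?t "length es", OF _ this, folded u_def, simplified]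
    let ?x = "store u (Scal, vx)" and ?y = "store u (Scal, vy)"
    have x: "?x \<notin> ?A" using f(1) pos[of ?x] by simp
    have "?y \<in> ?A" using f(2) pos[of ?y] by simp
    then obtain a where a: "a \<le> i" "?y = ?ord t a" by auto
    have "{?x, ?y} \<in> E" using f(3) edgeE by auto
    then have "?x < n" using simp by (auto simp: simple_graph_def doubleton_eq_iff)
    define t' where "t' = sem ?body ?t"
    have t': "store t' = (store u)((Ord, Suc i) := ?x, (Par, Suc i) := a, (Pos, ?x) := Suc (Suc i))"
      "ticks t' = ticks u + 3"
      using a I by (simp_all add: t'_def u_def[symmetric])
    have ord: "?ord t' b = (if b = Suc i then ?x else ?ord t b)" for b by (simp add: t')
    have A: "?ord t' ` {..Suc i} = insert ?x ?A"
      by (auto simp: ord atMost_Suc image_iff)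
    have old: "?ord t b \<noteq> ?x" if "b \<le> i" for b
    proof -
      have "?ord t b \<in> ?A" using that by (intro imageI) simp
      with x show ?thesis by metis
    qed
    have "?I (Suc i) t'"
    proof (intro conjI)
      \<comment> \<open>One tick for the counter, \<open>1 + 7 * length es\<close> for the scan,
        three for the assignments.\<close>
      show "ticks t' \<le> ticks s + 2 + Suc i * (5 + 7 * length es)"
        using I f(4) t' by simp
      show "inj_on (?ord t') {..Suc i}"
      proof -
        have "inj_on (?ord t') {..i} \<longleftrightarrow> inj_on (?ord t) {..i}"
          by (rule inj_on_cong) (simp add: ord)
        moreover have "?ord t' ` {..i} = ?A" by (rule image_cong) (simp_all add: ord)
        moreover have "?ord t' (Suc i) = ?x" by (simp add: ord)
        moreover have "{..i} - {Suc i} = {..i}" by auto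
        ultimately show ?thesis
          unfolding atMost_Suc inj_on_insert using I x by presburger
      qed
      show "?ord t' ` {..Suc i} \<subseteq> {..<n}" using A I \<open>?x < n\<close> by auto
      show "\<forall>b. 0 < b \<longrightarrow> b \<le> Suc i \<longrightarrow> ?par t' b < b \<and> {?ord t' b, ?ord t' (?par t' b)} \<in> E"
      proof (intro allI impI)
        fix b assume b: "0 < b" "b \<le> Suc i"
        show "?par t' b < b \<and> {?ord t' b, ?ord t' (?par t' b)} \<in> E"
        proof (cases "b = Suc i")
          case True
          then show ?thesis using a \<open>{?x, ?y} \<in> E\<close> by (simp add: t')
        next
          case False
          then have "b \<le> i" using b by simp
          then have "?par t b < b \<and> {?ord t b, ?ord t (?par t b)} \<in> E" using I b by blast
          then show ?thesis using \<open>b \<le> i\<close> by (simp add: t')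
        qed
      qed
      show "\<forall>b\<le>Suc i. store t' (Pos, ?ord t' b) = Suc b"
        using I old by (auto simp: t' le_Suc_eq)
      show "\<forall>v. v \<notin> ?ord t' ` {..Suc i} \<longrightarrow> store t' (Pos, v) = 0"
        unfolding A using I by (auto simp: t')
    qed
    then show "?I (Suc i) (sem ?body ?t)" unfolding t'_def .
  next
    show "eval (Minus (Var vn) (Num 1)) (store s0) = n - 1" using m(1) by (simp add: s0_def m_def)
    show "?I 0 (s0\<lparr>ticks := Suc (ticks s0)\<rparr>)"
      using m \<open>0 < n\<close> by (auto simp: s0_def m_def)
  qed
  moreover have "sem (For vi (Minus (Var vn) (Num 1)) ?body) s0 = t"
    by (simp add: t_def compute_order_def s0_def)
  ultimately have I: "?I (n - 1) t" by simp
  have n: "{..n - 1} = {..<n}" using \<open>0 < n\<close> by auto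
  have "inj_on (?ord t) {..<n}" "?ord t ` {..<n} \<subseteq> {..<n}" using I unfolding n by blast+
  then have "bij_betw (?ord t) {..<n} {..<n}"
    using endo_inj_surj[of "{..<n}" "?ord t"] by (simp add: bij_betw_def)
  then show "tree_order n E (?ord t) (?par t)"
    using I by (auto simp: tree_order_def)
  have "(n - 1) * (5 + 7 * length es) \<le> n * (5 + 7 * length es)" by simp
  then show "ticks t \<le> ticks s + 2 + n * (5 + 7 * length es)" using I by linarith
qed

section \<open>Correctness of the dynamic program\<close>

text \<open>Rows of positions \<open>v \<ge> k\<close>, although merged already, are kept because an
  optimal subgraph may have its top there. Entries from \<open>vtop\<close> on are 0, so a new row
  needs no initialisation. The sizes below \<open>k\<close> sum to \<open>n\<close> since these
  positions are the tops of the current components.\<close>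

definition rows_ok :: "nat \<Rightarrow> (nat \<Rightarrow> nat) \<Rightarrow> (nat \<Rightarrow> colour) \<Rightarrow> nat \<Rightarrow> store \<Rightarrow> bool" where
  "rows_ok n par c k m \<longleftrightarrow>
     (\<forall>v<n. 0 < m (Base, v) \<and> 0 < m (Size, v) \<and> m (Base, v) + 2 * m (Size, v) < m (Scal, vtop) \<and>
        row_ok n par c k v (m (Size, v)) (\<lambda>x. m (Best, m (Base, v) + x))
          (\<lambda>x. cell_set (\<lambda>a. m (Lft, a)) (\<lambda>a. m (Rgt, a)) (m (Base, v) + x))) \<and>
     (\<forall>a\<ge>m (Scal, vtop). m (Best, a) = 0) \<and>
     (\<forall>a. 0 < m (Rgt, a) \<longrightarrow> m (Lft, a) < a \<and> m (Rgt, a) < a) \<and>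
     (\<Sum>v<k. m (Size, v)) = n"

lemma init_rows_correct:
  fixes s
  defines "m \<equiv> store s" and "t \<equiv> sem init_rows s"
  assumes m: "m (Scal, vn) = n" "\<And>i. i < n \<Longrightarrow> m (Ord, i) < n"
    "\<And>v. v < n \<Longrightarrow> m (Colr, v) = colour_code (col v)"
    "\<And>a. m (Best, a) = 0" "\<And>a. m (Rgt, a) = 0"
  shows "rows_ok n par (\<lambda>i. col (m (Ord, i))) n (store t)" "store t (Scal, vtop) = 1 + 3 * n"
    "ticks t \<le> ticks s + 2 + 7 * n"
proof -
  let ?c = "\<lambda>i. col (m (Ord, i))"
  let ?off = "\<lambda>i. nat (weight (?c i) + 1)"
  have off: "?off i \<le> 2" "2 - 2 * colour_code (?c i) = ?off i" for i
    by (cases "?c i"; simp add: weight_def)+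
  let ?body = "Assign Base (Var vi) (Var vtop) ;; Assign Size (Var vi) (Num 1) ;;
        vcell ::= Minus (Plus (Var vtop) (Num 2))
          (Plus (Fetch Colr (Fetch Ord (Var vi))) (Fetch Colr (Fetch Ord (Var vi)))) ;;
        Assign Best (Var vcell) (Num 1) ;; Assign Lft (Var vcell) (Var vi) ;;
        vtop ::= Plus (Var vtop) (Num 3)"
  define s0 where "s0 = set_loc Scal vtop 1 s"
  let ?I = "\<lambda>i (t :: state). ticks t \<le> ticks s + 2 + 7 * i \<and> store t (Scal, vtop) = 1 + 3 * i \<and>
    (\<forall>v<i. store t (Base, v) = 1 + 3 * v \<and> store t (Size, v) = 1 \<and>
       store t (Lft, 1 + 3 * v + ?off v) = v) \<and>
    (\<forall>v<i. \<forall>x\<le>2. store t (Best, 1 + 3 * v + x) = of_bool (x = ?off v)) \<and>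
    (\<forall>a\<ge>1 + 3 * i. store t (Best, a) = 0)"
  have "?I n (sem (For vi (Var vn) ?body) s0)"
  proof (rule For_rule[where I = ?I])
    fix i t
    assume i: "i < n" and I: "?I i t"
      and fr: "\<And>a j. keeps a j (For vi (Var vn) ?body) \<Longrightarrow> store t (a, j) = store s0 (a, j)"
    have [simp]: "store t (Colr, v) = m (Colr, v)" "store t (Ord, v) = m (Ord, v)" for v
      using fr[of _ v] by (simp_all add: m_def s0_def)
    define t' where "t' = sem ?body (set_loc Scal vi i t)"
    \<comment> \<open>The truncated subtraction is exact here: at most 2 is subtracted.\<close>
    have "1 + 3 * i + 2 - (m (Colr, m (Ord, i)) + m (Colr, m (Ord, i))) = 1 + 3 * i + ?off i"
      using m(2,3) i off(1)[of i] off(2)[of i] by (cases "?c i") auto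
    then have t': "store t' = (store t)((Scal, vi) := i, (Base, i) := 1 + 3 * i, (Size, i) := 1,
        (Scal, vcell) := 1 + 3 * i + ?off i, (Best, 1 + 3 * i + ?off i) := 1,
        (Lft, 1 + 3 * i + ?off i) := i, (Scal, vtop) := 1 + 3 * i + 3)"
      "ticks t' = ticks t + 7"
      using I by (simp_all add: t'_def)
    have neq: "1 + 3 * v + x \<noteq> 1 + 3 * i + ?off i" if "v < i" "x \<le> 2" for v x
      using that by linarith
    have "?I (Suc i) t'"
    proof (intro conjI allI impI)
      fix v x assume v: "v < Suc i" "x \<le> (2::nat)"
      show "store t' (Best, 1 + 3 * v + x) = of_bool (x = ?off v)"
      proof (cases "v = i")
        case True
        then show ?thesis using I by (simp add: t')
      next
        case False
        then have "v < i" using v by simp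
        then have "store t (Best, 1 + 3 * v + x) = of_bool (x = ?off v)" using I v by blast
        then show ?thesis using neq[OF \<open>v < i\<close> v(2)] by (simp add: t')
      qed
    next
      fix v assume v: "v < Suc i"
      show "store t' (Lft, 1 + 3 * v + ?off v) = v"
      proof (cases "v = i")
        case False
        then have "v < i" using v by simp
        then show ?thesis using I neq[OF \<open>v < i\<close> off(1)[of v]] by (simp add: t')
      qed (simp add: t')
      show "store t' (Base, v) = 1 + 3 * v" "store t' (Size, v) = 1"
        using I v by (auto simp: t' less_Suc_eq)
    next
      fix a assume "1 + 3 * Suc i \<le> a"
      then show "store t' (Best, a) = 0" using I off(1)[of i] by (simp add: t')
    qed (use I t' in auto)
    then show "?I (Suc i) (sem ?body (set_loc Scal vi i t))" unfolding t'_def .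
  next
    show "eval (Var vn) (store s0) = n" using m(1) by (simp add: s0_def m_def)
    show "?I 0 (s0\<lparr>ticks := Suc (ticks s0)\<rparr>)" using m by (auto simp: s0_def m_def)
  qed
  moreover have "sem (For vi (Var vn) ?body) s0 = t"
    by (simp add: t_def init_rows_def s0_def)
  ultimately have I: "?I n t" by simp
  have R: "store t (Rgt, a) = 0" for a
    using m(5)[of a] by (simp add: t_def m_def keeps_store init_rows_def del: sem.simps)
  show "rows_ok n par ?c n (store t)"
    unfolding rows_ok_def
  proof (intro conjI allI impI)
    fix v assume v: "v < n"
    then have b: "store t (Base, v) = 1 + 3 * v" "store t (Size, v) = 1" using I by auto
    show "0 < store t (Base, v)" "0 < store t (Size, v)"
      "store t (Base, v) + 2 * store t (Size, v) < store t (Scal, vtop)"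
      using b I v by auto
    have B: "store t (Best, 1 + 3 * v + x) = of_bool (x = ?off v)" if "x \<le> 2" for x
      using I v that by blast
    have L: "store t (Lft, 1 + 3 * v + ?off v) = v" using I v by blast
    show "row_ok n par ?c n v (store t (Size, v)) (\<lambda>x. store t (Best, store t (Base, v) + x))
          (\<lambda>x. cell_set (\<lambda>a. store t (Lft, a)) (\<lambda>a. store t (Rgt, a)) (store t (Base, v) + x))"
      unfolding b
    proof (rule row_ok_leaf[OF v])
      show "store t (Best, 1 + 3 * v + ?off v) = 1" using B off(1) by simp
      show "cell_set (\<lambda>a. store t (Lft, a)) (\<lambda>a. store t (Rgt, a)) (1 + 3 * v + ?off v) = {v}"
        using L R by (subst cell_set.simps) simp
    qed (use B in simp)
  next
    show "(\<Sum>v<n. store t (Size, v)) = n" using I by simp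
  qed (use I R in auto)
  show "store t (Scal, vtop) = 1 + 3 * n" "ticks t \<le> ticks s + 2 + 7 * n" using I by auto
qed

section \<open>Merging two rows in memory\<close>

text \<open>
  The new row starts at address \<open>hp\<close>. \<open>K\<close> is the set of candidates \<open>(z, u, l, r)\<close> seen so far:
  index \<open>z\<close>, value \<open>u\<close>, and the addresses of the two entries from which the subtree is composed.
\<close>

definition relaxed :: "store \<Rightarrow> nat \<Rightarrow> (nat \<times> nat \<times> nat \<times> nat) set \<Rightarrow> store \<Rightarrow> bool" where
  "relaxed m0 hp K m \<longleftrightarrow>
     (\<forall>a<hp. m (Best, a) = m0 (Best, a) \<and> m (Lft, a) = m0 (Lft, a) \<and> m (Rgt, a) = m0 (Rgt, a)) \<and>
     (\<forall>(z, u, l, r)\<in>K. u \<le> m (Best, hp + z)) \<and>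
     (\<forall>z. 0 < m (Best, hp + z) \<longrightarrow>
        (z, m (Best, hp + z), m (Lft, hp + z), m (Rgt, hp + z)) \<in> K) \<and>
     (\<forall>a. 0 < m (Rgt, a) \<longrightarrow> m (Lft, a) < a \<and> m (Rgt, a) < a)"

lemma relaxed_Scal [simp]: "relaxed m0 hp K (m((Scal, i) := x)) = relaxed m0 hp K m"
  by (simp add: relaxed_def)

text \<open>The value at an index never decreases, so earlier upper bounds persist, and it changes
  only together with its pointers. The bounds on \<open>l\<close> and \<open>r\<close> keep the
  pointers decreasing.\<close>

lemma relax_correct:
  assumes R: "relaxed m0 hp K (store s)"
    and s: "store s (Scal, vcell) = hp + z" "store s (Scal, vval) = u"
      "store s (Scal, vleft) = l" "store s (Scal, vright) = r" "l < hp" "r < hp"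
  shows "relaxed m0 hp (insert (z, u, l, r) K) (store (sem relax s))"
    "ticks (sem relax s) \<le> ticks s + 4"
proof -
  show "ticks (sem relax s) \<le> ticks s + 4" by (simp add: relax_def)
  show "relaxed m0 hp (insert (z, u, l, r) K) (store (sem relax s))"
  proof (cases "u > store s (Best, hp + z)")
    case False
    then show ?thesis using R s by (auto simp: relax_def relaxed_def)
  next
    case True
    define m' where "m' = (store s)((Best, hp + z) := u, (Lft, hp + z) := l, (Rgt, hp + z) := r)"
    have m': "store (sem relax s) = m'"
      using True s by (simp add: relax_def m'_def)
    show ?thesis
      unfolding m' relaxed_def
    proof (intro conjI allI impI)
      show "\<forall>(z', u', l', r')\<in>insert (z, u, l, r) K. u' \<le> m' (Best, hp + z')"
      proof (clarify)
        fix z' u' l' r' assume "(z', u', l', r') \<in> insert (z, u, l, r) K"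
        then have "z' = z \<and> u' = u \<or> u' \<le> store s (Best, hp + z')"
          using R by (auto simp: relaxed_def)
        then show "u' \<le> m' (Best, hp + z')" using True by (auto simp: m'_def)
      qed
    next
      fix z' assume "0 < m' (Best, hp + z')"
      then show "(z', m' (Best, hp + z'), m' (Lft, hp + z'), m' (Rgt, hp + z'))
          \<in> insert (z, u, l, r) K"
        using R by (cases "z' = z") (auto simp: relaxed_def m'_def)
    next
      fix a assume "0 < m' (Rgt, a)"
      then show "m' (Lft, a) < a" "m' (Rgt, a) < a"
        using R s by (auto simp: relaxed_def m'_def split: if_splits)
    qed (use R in \<open>auto simp: relaxed_def m'_def\<close>)
  qed
qed

definition pairs :: "store \<Rightarrow> nat \<Rightarrow> nat \<Rightarrow> nat \<Rightarrow> nat \<Rightarrow> (nat \<times> nat \<times> nat \<times> nat) set" where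
  "pairs m p q x j =
     {(x + y, m (Best, p + x) + m (Best, q + y), p + x, q + y) | y. y < j \<and> 0 < m (Best, q + y)}"

text \<open>Row entries are written only from \<open>hp\<close> on, so the values read are still
  those of \<open>m0\<close>. A round costs at most 9 ticks: counter, \<open>vright\<close>, test,
  two assignments, and 4 in \<open>relax\<close>.\<close>

lemma merge_inner_correct:
  assumes R: "relaxed m0 hp K (store s)"
    and s: "store s (Scal, vtop) = hp" "store s (Scal, vleft) = p + x" "store s (Scal, vx) = x"
      "store s (Scal, vk) = k" "store s (Size, k) = t" "store s (Base, k) = q"
      "p + x < hp" "q + 2 * t < hp"
  shows "relaxed m0 hp (K \<union> pairs m0 p q x (2*t+1)) (store (sem merge_inner s))"
    "ticks (sem merge_inner s) \<le> ticks s + 1 + 9 * (2*t+1)"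
proof -
  let ?body = "vright ::= Plus (Fetch Base (Var vk)) (Var vy) ;;
        Cond (Fetch Best (Var vright))
          (vcell ::= Plus (Plus (Var vtop) (Var vx)) (Var vy) ;;
           vval ::= Plus (Fetch Best (Var vleft)) (Fetch Best (Var vright)) ;; relax)
          Skip"
  let ?I = "\<lambda>j (u :: state). relaxed m0 hp (K \<union> pairs m0 p q x j) (store u) \<and>
    ticks u \<le> ticks s + 1 + 9 * j"
  have "?I (2*t+1) (sem merge_inner s)"
    unfolding merge_inner_def
  proof (rule For_rule[where I = ?I])
    fix j u
    assume j: "j < 2*t+1" and I: "?I j u"
      and fr: "\<And>a j. keeps a j (For vy (Plus (Plus (Fetch Size (Var vk)) (Fetch Size (Var vk))) (Num 1)) ?body)
        \<Longrightarrow> store u (a, j) = store s (a, j)"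
    have u: "store u (Scal, vtop) = hp" "store u (Scal, vleft) = p + x" "store u (Scal, vx) = x"
      "store u (Scal, vk) = k" "store u (Size, k) = t" "store u (Base, k) = q"
      using s fr by (simp_all add: relax_def)
    have "q + j < hp" using j s by simp
    then have B: "store u (Best, q + j) = m0 (Best, q + j)" "store u (Best, p + x) = m0 (Best, p + x)"
      using I s(7) by (auto simp: relaxed_def)
    show "?I (Suc j) (sem ?body (set_loc Scal vy j u))"
    proof (cases "0 < m0 (Best, q + j)")
      case True
      define w where "w = set_loc Scal vval (m0 (Best, p + x) + m0 (Best, q + j))
        (set_loc Scal vcell (hp + (x + j)) ((set_loc Scal vright (q + j) (set_loc Scal vy j u))
          \<lparr>ticks := Suc (Suc (Suc (ticks u)))\<rparr>))"
      have "sem ?body (set_loc Scal vy j u) = sem relax w"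
        using True u B by (simp add: w_def add.assoc)
      moreover have "relaxed m0 hp (insert (x + j, m0 (Best, p + x) + m0 (Best, q + j), p + x, q + j)
          (K \<union> pairs m0 p q x j)) (store (sem relax w))" "ticks (sem relax w) \<le> ticks w + 4"
        by (rule relax_correct[of m0 hp "K \<union> pairs m0 p q x j" w "x + j"
              "m0 (Best, p + x) + m0 (Best, q + j)" "p + x" "q + j"];
            use I u \<open>q + j < hp\<close> s(7) in \<open>simp add: w_def\<close>)+
      moreover have "insert (x + j, m0 (Best, p + x) + m0 (Best, q + j), p + x, q + j)
          (K \<union> pairs m0 p q x j) = K \<union> pairs m0 p q x (Suc j)"
        using True by (auto simp: pairs_def less_Suc_eq)
      ultimately show ?thesis using I by (simp add: w_def)
    next
      case False
      then have "pairs m0 p q x (Suc j) = pairs m0 p q x j"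
        by (auto simp: pairs_def less_Suc_eq)
      then show ?thesis using False I u B by simp
    qed
  next
    show "?I 0 (s\<lparr>ticks := Suc (ticks s)\<rparr>)" using R by (simp add: pairs_def)
  qed (use s in simp)
  then show "relaxed m0 hp (K \<union> pairs m0 p q x (2*t+1)) (store (sem merge_inner s))"
    "ticks (sem merge_inner s) \<le> ticks s + 1 + 9 * (2*t+1)" by blast+
qed

text \<open>The counterpart of \<open>candidates\<close> with addresses in place of sets; a kept
  entry appears with both pointers equal.\<close>

definition cells :: "store \<Rightarrow> nat \<Rightarrow> nat \<Rightarrow> nat \<Rightarrow> nat \<Rightarrow> (nat \<times> nat \<times> nat \<times> nat) set" where
  "cells m p q t i =
     (\<Union>x\<in>{x. x < i \<and> 0 < m (Best, p + x)}.
        insert (x + t, m (Best, p + x), p + x, p + x) (pairs m p q x (2*t+1)))"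

text \<open>The bound \<open>20 + 18 * t\<close> for a round consists of 6 ticks before
  \<open>relax\<close>, 4 in it, and \<open>1 + 9 * (2*t+1)\<close> in the inner loop.\<close>

lemma merge_rows_correct:
  fixes s
  defines "m \<equiv> store s"
  assumes m: "m (Scal, vtop) = hp" "m (Scal, vp) = v" "m (Scal, vk) = k"
      "m (Size, v) = a" "m (Base, v) = p" "m (Size, k) = t" "m (Base, k) = q"
      "p + 2 * a < hp" "q + 2 * t < hp"
      "\<And>a. hp \<le> a \<Longrightarrow> m (Best, a) = 0"
      "\<And>a. 0 < m (Rgt, a) \<Longrightarrow> m (Lft, a) < a \<and> m (Rgt, a) < a"
  shows "relaxed m hp (cells m p q t (2*a+1)) (store (sem merge_rows s))"
    "ticks (sem merge_rows s) \<le> ticks s + 1 + (20 + 18 * t) * (2*a+1)"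
proof -
  let ?body = "vleft ::= Plus (Fetch Base (Var vp)) (Var vx) ;;
        Cond (Fetch Best (Var vleft))
          (vright ::= Var vleft ;;
           vcell ::= Plus (Plus (Var vtop) (Var vx)) (Fetch Size (Var vk)) ;;
           vval ::= Fetch Best (Var vleft) ;; relax ;; merge_inner)
          Skip"
  let ?I = "\<lambda>i (u :: state). relaxed m hp (cells m p q t i) (store u) \<and>
    ticks u \<le> ticks s + 1 + (20 + 18 * t) * i"
  have "?I (2*a+1) (sem merge_rows s)"
    unfolding merge_rows_def
  proof (rule For_rule[where I = ?I])
    fix i u
    assume i: "i < 2*a+1" and I: "?I i u"
      and fr: "\<And>a j. keeps a j (For vx (Plus (Plus (Fetch Size (Var vp)) (Fetch Size (Var vp))) (Num 1)) ?body)
        \<Longrightarrow> store u (a, j) = store s (a, j)"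
    have u: "store u (Scal, vtop) = hp" "store u (Scal, vp) = v" "store u (Scal, vk) = k"
      "store u (Size, v) = a" "store u (Base, v) = p" "store u (Size, k) = t" "store u (Base, k) = q"
      using m fr by (simp_all add: m_def relax_def merge_inner_def)
    have "p + i < hp" using i m by simp
    then have B: "store u (Best, p + i) = m (Best, p + i)" using I by (auto simp: relaxed_def)
    show "?I (Suc i) (sem ?body (set_loc Scal vx i u))"
    proof (cases "0 < m (Best, p + i)")
      case True
      define w where "w = set_loc Scal vval (m (Best, p + i)) (set_loc Scal vcell (hp + (i + t))
        (set_loc Scal vright (p + i) ((set_loc Scal vleft (p + i) (set_loc Scal vx i u))
          \<lparr>ticks := Suc (Suc (Suc (ticks u)))\<rparr>)))"
      let ?K = "insert (i + t, m (Best, p + i), p + i, p + i) (cells m p q t i)"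
      have "sem ?body (set_loc Scal vx i u) = sem merge_inner (sem relax w)"
        using True u B by (simp add: w_def add.assoc)
      moreover have 1: "relaxed m hp ?K (store (sem relax w))" "ticks (sem relax w) \<le> ticks w + 4"
        by (rule relax_correct[of m hp "cells m p q t i" w "i + t" "m (Best, p + i)" "p + i" "p + i"];
            use I u \<open>p + i < hp\<close> in \<open>simp add: w_def\<close>)+
      moreover have "relaxed m hp (?K \<union> pairs m p q i (2*t+1)) (store (sem merge_inner (sem relax w)))"
        "ticks (sem merge_inner (sem relax w)) \<le> ticks (sem relax w) + 1 + 9 * (2*t+1)"
        by (rule merge_inner_correct[of m hp ?K "sem relax w" p i k t q];
            use 1(1) u \<open>p + i < hp\<close> m(9) in \<open>simp add: w_def keeps_store relax_def del: sem.simps\<close>)+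
      moreover have "?K \<union> pairs m p q i (2*t+1) = cells m p q t (Suc i)"
        using True by (auto simp: cells_def less_Suc_eq)
      moreover have "ticks w = ticks u + 6" by (simp add: w_def)
      ultimately show ?thesis using I by simp
    next
      case False
      then have "cells m p q t (Suc i) = cells m p q t i"
        by (auto simp: cells_def less_Suc_eq)
      then show ?thesis using False I u B by simp
    qed
  next
    show "?I 0 (s\<lparr>ticks := Suc (ticks s)\<rparr>)"
      using m by (simp add: cells_def relaxed_def m_def)
  qed (use m in \<open>simp add: m_def\<close>)
  then show "relaxed m hp (cells m p q t (2*a+1)) (store (sem merge_rows s))"
    "ticks (sem merge_rows s) \<le> ticks s + 1 + (20 + 18 * t) * (2*a+1)" by blast+
qed

text \<open>The balance of a subtree is bounded by its size, so no subtree refers to an index beyond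
  \<open>2*s\<close>.\<close>

lemma row_ok_cong:
  assumes "row_ok n par c k v s H cs" "\<And>x. x \<le> 2*s \<Longrightarrow> H' x = H x \<and> cs' x = cs x"
  shows "row_ok n par c k v s H' cs'"
proof -
  have "card S \<le> s \<and> card S \<le> H' (nat (balance c S + int s))" if "rooted n par k v S" for S
  proof -
    have S: "card S \<le> s" "card S \<le> H (nat (balance c S + int s))"
      using assms(1) that by (auto simp: row_ok_def)
    then have "nat (balance c S + int s) \<le> 2*s" using abs_balance_le[of c S] by linarith
    then show ?thesis using S assms(2) by simp
  qed
  then show ?thesis using assms by (simp add: row_ok_def)
qed

text \<open>Addresses are turned into sets: pointers of the new row lead below \<open>hp\<close>,
  where no row entry changed, so they denote the same sets in \<open>u\<close> as in
  \<open>m\<close>, and \<open>cells\<close> becomes \<open>candidates\<close>.\<close>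

lemma merged_row_ok:
  assumes par: "\<And>i. 0 < i \<Longrightarrow> i < n \<Longrightarrow> par i < i" and k: "0 < k" "k < n"
    and R: "rows_ok n par c (Suc k) m" and v: "v = par k"
    and p: "p = m (Base, v)" "a = m (Size, v)" and q: "q = m (Base, k)" "t = m (Size, k)"
    and u: "relaxed m (m (Scal, vtop)) (cells m p q t (2*a+1)) u" and hp: "hp = m (Scal, vtop)"
  shows "row_ok n par c k v (a + t) (\<lambda>z. u (Best, hp + z))
     (\<lambda>z. cell_set (\<lambda>a. u (Lft, a)) (\<lambda>a. u (Rgt, a)) (hp + z))"
  unfolding v
proof (rule row_ok_merge[OF par k])
  let ?cs = "\<lambda>m b. cell_set (\<lambda>a. m (Lft, a)) (\<lambda>a. m (Rgt, a)) b :: nat set"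
  let ?C = "candidates a t (\<lambda>x. m (Best, p + x)) (\<lambda>x. m (Best, q + x)) (\<lambda>x. ?cs m (p + x)) (\<lambda>x. ?cs m (q + x))"
  have vn: "v < n" using par[OF k] k v by simp
  have P: "row_ok n par c (Suc k) v a (\<lambda>x. m (Best, p + x)) (\<lambda>x. ?cs m (p + x))" "0 < p" "p + 2*a < hp"
    using R vn unfolding rows_ok_def p hp by blast+
  have Q: "row_ok n par c (Suc k) k t (\<lambda>x. m (Best, q + x)) (\<lambda>x. ?cs m (q + x))" "0 < q" "q + 2*t < hp"
    using R k(2) unfolding rows_ok_def q hp by blast+
  show "row_ok n par c (Suc k) (par k) a (\<lambda>x. m (Best, p + x)) (\<lambda>x. ?cs m (p + x))"
    using P v by simp
  show "row_ok n par c (Suc k) k t (\<lambda>x. m (Best, q + x)) (\<lambda>x. ?cs m (q + x))" by (rule Q)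
  have low: "?cs u b = ?cs m b" if "b < hp" for b
    using u that unfolding relaxed_def hp by (intro cell_set_cong) auto
  let ?K = "cells m p q t (2*a+1)"
  have ub: "w \<le> u (Best, hp + z)" if "(z, w, l, r) \<in> ?K" for z w l r
    using u that by (auto simp: relaxed_def hp)
  have att: "(z, u (Best, hp + z), u (Lft, hp + z), u (Rgt, hp + z)) \<in> ?K"
    if "0 < u (Best, hp + z)" for z
    using u that by (auto simp: relaxed_def hp)
  have K: "(z, w, l, r) \<in> ?K \<longleftrightarrow>
     (\<exists>x\<le>2*a. 0 < m (Best, p + x) \<and> l = p + x \<and>
        (z = x + t \<and> w = m (Best, p + x) \<and> r = p + x \<or>
         (\<exists>y\<le>2*t. 0 < m (Best, q + y) \<and> z = x + y \<and> w = m (Best, p + x) + m (Best, q + y) \<and> r = q + y)))"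
    for z w l r
    unfolding cells_def pairs_def by (auto simp: less_Suc_eq_le) 
  show "w \<le> u (Best, hp + z)" if "(z, w, S) \<in> ?C" for z w S
    using that unfolding candidates_def
  proof (elim UnE CollectE exE conjE)
    fix x assume "(z, w, S) = (x + t, m (Best, p + x), ?cs m (p + x))" "x \<le> 2*a" "0 < m (Best, p + x)"
    then have "(z, w, p + x, p + x) \<in> ?K" unfolding K by blast
    then show ?thesis by (rule ub)
  next
    fix x y assume "(z, w, S) = (x + y, m (Best, p + x) + m (Best, q + y), ?cs m (p + x) \<union> ?cs m (q + y))"
      "x \<le> 2*a" "y \<le> 2*t" "0 < m (Best, p + x)" "0 < m (Best, q + y)"
    then have "(z, w, p + x, q + y) \<in> ?K" unfolding K by blast
    then show ?thesis by (rule ub)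
  qed
  show "(z, u (Best, hp + z), ?cs u (hp + z)) \<in> ?C" if "0 < u (Best, hp + z)" for z
  proof -
    let ?l = "u (Lft, hp + z)" and ?r = "u (Rgt, hp + z)"
    from att[OF that, unfolded K] obtain x where x: "x \<le> 2*a" "0 < m (Best, p + x)" "?l = p + x"
      and or: "z = x + t \<and> u (Best, hp + z) = m (Best, p + x) \<and> ?r = p + x \<or>
         (\<exists>y\<le>2*t. 0 < m (Best, q + y) \<and> z = x + y \<and>
            u (Best, hp + z) = m (Best, p + x) + m (Best, q + y) \<and> ?r = q + y)" by blast
    have "?l < hp" using x P by simp
    \<comment> \<open>Row bases are positive, hence so is the right pointer, and the entry is read
      as a union; for a kept entry both halves coincide.\<close>
    have "0 < ?r" "?r < hp" using or x P Q by auto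
    then have "?cs u (hp + z) = ?cs u ?l \<union> ?cs u ?r"
      using \<open>?l < hp\<close> by (subst cell_set.simps) simp
    then have cs: "?cs u (hp + z) = ?cs m (p + x) \<union> ?cs m ?r"
      using low \<open>?l < hp\<close> \<open>?r < hp\<close> x(3) by simp
    from or show ?thesis
    proof (elim disjE exE conjE)
      assume "z = x + t" "u (Best, hp + z) = m (Best, p + x)" "?r = p + x"
      then show ?thesis using x cs unfolding candidates_def by auto
    next
      fix y assume "y \<le> 2*t" "0 < m (Best, q + y)" "z = x + y"
        "u (Best, hp + z) = m (Best, p + x) + m (Best, q + y)" "?r = q + y"
      then show ?thesis using x cs unfolding candidates_def by (intro UnI2) auto
    qed
  qed
qed

lemma sum_update:
  fixes f :: "nat \<Rightarrow> nat"
  assumes "p < k"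
  shows "(\<Sum>v<k. (f(p := x)) v) + f p = (\<Sum>v<k. f v) + x"
proof -
  have "(\<Sum>v<k. g v) = g p + (\<Sum>v\<in>{..<k} - {p}. g v)" for g :: "nat \<Rightarrow> nat"
    using assms by (intro sum.remove) auto
  from this[of f] this[of "f(p := x)"] show ?thesis by simp
qed

section \<open>Amortised analysis of all merges\<close>

text \<open>The sum of squares acts as a potential: it counts position \<open>k\<close> before the
  step and no longer afterwards, when its size has moved to the parent. The remaining 4 ticks are
  the start of the outer loop and the three assignments after the merge.\<close>

lemma compute_rows_step:
  fixes s
  defines "m \<equiv> store s"
  assumes par: "\<And>i. 0 < i \<Longrightarrow> i < n \<Longrightarrow> par i < i" and k: "0 < k" "k < n"
    and R: "rows_ok n par c (Suc k) m"
    and m: "m (Scal, vk) = k" "m (Scal, vp) = par k"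
  defines "t \<equiv> sem (merge_rows ;; Assign Base (Var vp) (Var vtop) ;;
        Assign Size (Var vp) (Plus (Fetch Size (Var vp)) (Fetch Size (Var vk))) ;;
        vtop ::= Plus (Var vtop) (Plus (Plus (Fetch Size (Var vp)) (Fetch Size (Var vp))) (Num 1))) s"
  shows "rows_ok n par c k (store t)"
    "ticks t + 57 * (\<Sum>v<Suc k. m (Size, v) ^ 2) \<le> ticks s + 4 + 57 * (\<Sum>v<k. store t (Size, v) ^ 2)"
    "store t (Scal, vtop) \<le> m (Scal, vtop) + 2 * n + 1"
proof -
  define v where "v = par k"
  define a where "a = m (Size, v)"
  define b where "b = m (Size, k)"
  define p where "p = m (Base, v)"
  define q where "q = m (Base, k)"
  define hp where "hp = m (Scal, vtop)"
  define u where "u = sem merge_rows s"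
  have v: "v < k" "v < n" using par[OF k] k by (simp_all add: v_def)
  let ?cs = "\<lambda>m b. cell_set (\<lambda>a. m (Lft, a)) (\<lambda>a. m (Rgt, a)) b :: nat set"
  have row: "0 < m (Base, w)" "0 < m (Size, w)" "m (Base, w) + 2 * m (Size, w) < hp"
    "row_ok n par c (Suc k) w (m (Size, w)) (\<lambda>x. m (Best, m (Base, w) + x)) (\<lambda>x. ?cs m (m (Base, w) + x))"
    if "w < n" for w
    using R that unfolding rows_ok_def hp_def by blast+
  have zero: "m (Best, x) = 0" if "hp \<le> x" for x
    using R that by (auto simp: rows_ok_def hp_def)
  have ptr: "m (Lft, x) < x \<and> m (Rgt, x) < x" if "0 < m (Rgt, x)" for x
    using R that by (auto simp: rows_ok_def)
  have total: "(\<Sum>w<Suc k. m (Size, w)) = n" using R by (simp add: rows_ok_def)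
  have U: "relaxed m hp (cells m p q b (2*a+1)) (store u)"
    "ticks u \<le> ticks s + 1 + (20 + 18 * b) * (2*a+1)"
    unfolding u_def m_def
    by (rule merge_rows_correct[where v = v and k = k];
        use m row[OF v(2)] row[OF k(2)] zero ptr in
          \<open>simp add: m_def v_def a_def b_def p_def q_def hp_def\<close>)+
  have keep: "store u (Base, w) = m (Base, w)" "store u (Size, w) = m (Size, w)"
    "store u (Scal, vtop) = hp" "store u (Scal, vp) = v" "store u (Scal, vk) = k" for w
    using m by (simp_all add: u_def m_def v_def hp_def keeps_store merge_rows_def merge_inner_def
        relax_def del: sem.simps)
  define t' where "t' = (store u)((Base, v) := hp, (Size, v) := a + b, (Scal, vtop) := hp + (a + b + (a + b) + 1))"
  have t: "store t = t'" "ticks t = ticks u + 3"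
    using keep by (simp_all add: t_def t'_def u_def[symmetric] a_def b_def)
  have low: "store u (Best, x) = m (Best, x)" "?cs (store u) x = ?cs m x" if "x < hp" for x
    using U(1) that unfolding relaxed_def by (auto intro!: cell_set_cong)
  have size: "(\<Sum>w<k. t' (Size, w)) + a = (\<Sum>w<k. m (Size, w)) + (a + b)"
    "(\<Sum>w<k. t' (Size, w) ^ 2) + a ^ 2 = (\<Sum>w<k. m (Size, w) ^ 2) + (a + b) ^ 2"
  proof -
    have "t' (Size, w) = ((\<lambda>w. m (Size, w))(v := a + b)) w" for w by (simp add: t'_def keep)
    then show "(\<Sum>w<k. t' (Size, w)) + a = (\<Sum>w<k. m (Size, w)) + (a + b)"
      using sum_update[OF v(1), of "\<lambda>w. m (Size, w)" "a + b"] by (simp add: a_def)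
    have "t' (Size, w) ^ 2 = ((\<lambda>w. m (Size, w) ^ 2)(v := (a + b) ^ 2)) w" for w
      by (simp add: t'_def keep)
    then show "(\<Sum>w<k. t' (Size, w) ^ 2) + a ^ 2 = (\<Sum>w<k. m (Size, w) ^ 2) + (a + b) ^ 2"
      using sum_update[OF v(1), of "\<lambda>w. m (Size, w) ^ 2" "(a + b) ^ 2"] by (simp add: a_def)
  qed
  have pos: "0 < a" "0 < b" using row v k by (simp_all add: a_def b_def)
  show "rows_ok n par c k (store t)"
    unfolding t rows_ok_def
  proof (intro conjI allI impI)
    fix w assume w: "w < n"
    have "0 < t' (Base, w) \<and> 0 < t' (Size, w) \<and> t' (Base, w) + 2 * t' (Size, w) < t' (Scal, vtop) \<and>
      row_ok n par c k w (t' (Size, w)) (\<lambda>x. t' (Best, t' (Base, w) + x)) (\<lambda>x. ?cs t' (t' (Base, w) + x))"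
    proof (cases "w = v")
      case True
      have "row_ok n par c k v (a + b) (\<lambda>z. store u (Best, hp + z)) (\<lambda>z. ?cs (store u) (hp + z))"
        by (rule merged_row_ok[OF par k R v_def p_def a_def q_def b_def _ hp_def])
           (use U(1) hp_def in auto)
      moreover have "0 < hp" using row(3)[OF v(2)] by simp
      ultimately show ?thesis using True pos by (simp add: t'_def)
    next
      case False
      note row[OF w]
      moreover have "row_ok n par c k w (m (Size, w)) (\<lambda>x. store u (Best, m (Base, w) + x))
          (\<lambda>x. ?cs (store u) (m (Base, w) + x))"
      proof (rule row_ok_cong)
        show "row_ok n par c k w (m (Size, w)) (\<lambda>x. m (Best, m (Base, w) + x)) (\<lambda>x. ?cs m (m (Base, w) + x))"
          using row_ok_other[of par k w] par[OF k] False row(4)[OF w] by (simp add: v_def)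
        show "store u (Best, m (Base, w) + x) = m (Best, m (Base, w) + x) \<and>
            ?cs (store u) (m (Base, w) + x) = ?cs m (m (Base, w) + x)" if "x \<le> 2 * m (Size, w)" for x
          using low row(3)[OF w] that by simp
      qed
      ultimately show ?thesis using False by (simp add: t'_def keep)
    qed
    then show "0 < t' (Base, w)" "0 < t' (Size, w)" "t' (Base, w) + 2 * t' (Size, w) < t' (Scal, vtop)"
      "row_ok n par c k w (t' (Size, w)) (\<lambda>x. t' (Best, t' (Base, w) + x)) (\<lambda>x. ?cs t' (t' (Base, w) + x))"
      by blast+
  next
    fix x assume x: "t' (Scal, vtop) \<le> x"
    show "t' (Best, x) = 0"
    \<comment> \<open>Candidate indices do not exceed \<open>2 * (a + b)\<close>, the last index of
      the new row, so nothing was written beyond the new top.\<close>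
    proof (rule ccontr)
      assume "t' (Best, x) \<noteq> 0"
      define z where "z = x - hp"
      have z: "x = hp + z" "2 * (a + b) < z" using x by (simp_all add: z_def t'_def)
      have "0 < store u (Best, hp + z)" using \<open>t' (Best, x) \<noteq> 0\<close> z by (simp add: t'_def)
      then have "(z, store u (Best, hp + z), store u (Lft, hp + z), store u (Rgt, hp + z))
          \<in> cells m p q b (2*a+1)" using U(1) by (auto simp: relaxed_def)
      then have "z \<le> 2 * (a + b)" by (auto simp: cells_def pairs_def)
      with z show False by simp
    qed
  next
    fix x assume "0 < t' (Rgt, x)"
    then show "t' (Lft, x) < x" "t' (Rgt, x) < x"
      using U(1) by (auto simp: relaxed_def t'_def)
  next
    show "(\<Sum>w<k. t' (Size, w)) = n" using size(1) total by (simp add: b_def)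
  qed
  have "ticks t \<le> ticks s + 4 + (20 + 18 * b) * (2*a+1)" using t(2) U(2) by simp
  \<comment> \<open>As \<open>a\<close> and \<open>b\<close> are positive, the factors are at most
    \<open>38 * b\<close> and \<open>3 * a\<close>. Their product is \<open>114 * a * b\<close>,
    that is 57 times the growth \<open>2 * a * b\<close> of the sum of squares.\<close>
  also have "(20 + 18 * b) * (2*a+1) \<le> (38 * b) * (3 * a)"
    using pos by (intro mult_mono) auto
  finally have "ticks t \<le> ticks s + 4 + 57 * (2 * a * b)" by (simp add: algebra_simps)
  moreover have "(\<Sum>w<Suc k. m (Size, w) ^ 2) + 2 * a * b = (\<Sum>w<k. t' (Size, w) ^ 2)"
    using size(2) by (simp add: b_def power2_eq_square algebra_simps)
  ultimately show "ticks t + 57 * (\<Sum>v<Suc k. m (Size, v) ^ 2) \<le>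
      ticks s + 4 + 57 * (\<Sum>v<k. store t (Size, v) ^ 2)"
    unfolding t(1) by linarith
  \<comment> \<open>The parent and \<open>k\<close> are distinct positions below
    \<open>Suc k\<close>, so their sizes together stay within the total \<open>n\<close>; this
    bounds the length of the new row.\<close>
  have "a + b = (\<Sum>w\<in>{v, k}. m (Size, w))" using v by (simp add: a_def b_def)
  also have "\<dots> \<le> (\<Sum>w<Suc k. m (Size, w))" using v by (intro sum_mono2) auto
  finally have "a + b \<le> n" using total by simp
  then show "store t (Scal, vtop) \<le> m (Scal, vtop) + 2 * n + 1"
    unfolding t(1) by (simp add: t'_def hp_def)
qed

lemma compute_rows_correct:
  fixes s
  defines "m \<equiv> store s" and "t \<equiv> sem compute_rows s"
  assumes par: "\<And>i. 0 < i \<Longrightarrow> i < n \<Longrightarrow> m (Par, i) < i" and n: "0 < n" "m (Scal, vn) = n"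
    and R: "rows_ok n (\<lambda>i. m (Par, i)) c n m"
  shows "rows_ok n (\<lambda>i. m (Par, i)) c 1 (store t)"
    "ticks t \<le> ticks s + 1 + 7 * n + 57 * n ^ 2"
    "store t (Scal, vtop) \<le> m (Scal, vtop) + n * (2 * n + 1)"
proof -
  let ?par = "\<lambda>i. m (Par, i)"
  let ?step = "merge_rows ;; Assign Base (Var vp) (Var vtop) ;;
        Assign Size (Var vp) (Plus (Fetch Size (Var vp)) (Fetch Size (Var vk))) ;;
        vtop ::= Plus (Var vtop) (Plus (Plus (Fetch Size (Var vp)) (Fetch Size (Var vp))) (Num 1))"
  let ?body = "vk ::= Minus (Minus (Var vn) (Num 1)) (Var vi) ;; vp ::= Fetch Par (Var vk) ;; ?step"
  let ?I = "\<lambda>i (t :: state). rows_ok n ?par c (n - i) (store t) \<and>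
    ticks t \<le> ticks s + 1 + 7 * i + 57 * (\<Sum>v<n - i. store t (Size, v) ^ 2) \<and>
    store t (Scal, vtop) \<le> m (Scal, vtop) + i * (2 * n + 1)"
  have I: "?I (n - 1) t"
    unfolding t_def compute_rows_def
  proof (rule For_rule[where I = ?I])
    fix i t
    assume i: "i < n - 1" and I: "?I i t"
      and fr: "\<And>a j. keeps a j (For vi (Minus (Var vn) (Num 1)) ?body) \<Longrightarrow>
        store t (a, j) = store s (a, j)"
    define k where "k = n - Suc i"
    have k: "0 < k" "k < n" "n - i = Suc k" using i by (auto simp: k_def)
    have keep: "store t (Par, w) = m (Par, w)" "store t (Scal, vn) = n" for w
      using fr[of Par w] fr[of Scal vn] n
      by (simp_all add: m_def merge_rows_def merge_inner_def relax_def)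
    define w where "w = set_loc Scal vp (m (Par, k)) (set_loc Scal vk k (set_loc Scal vi i t))"
    have body: "sem ?body (set_loc Scal vi i t) = sem ?step w"
      using keep by (simp add: w_def k_def)
    have R: "rows_ok n ?par c (Suc k) (store w)"
      using I k(3) by (simp add: rows_ok_def w_def)
    have w: "store w (Scal, vk) = k" "store w (Scal, vp) = m (Par, k)" "ticks w = ticks t + 3"
      "store w (Size, x) = store t (Size, x)" "store w (Scal, vtop) = store t (Scal, vtop)" for x
      by (simp_all add: w_def)
    define t' where "t' = sem ?body (set_loc Scal vi i t)"
    have "rows_ok n ?par c k (store t')"
      "ticks t' + 57 * (\<Sum>v<Suc k. store w (Size, v) ^ 2)
        \<le> ticks w + 4 + 57 * (\<Sum>v<k. store t' (Size, v) ^ 2)"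
      "store t' (Scal, vtop) \<le> store w (Scal, vtop) + 2 * n + 1"
      unfolding t'_def body
      by (rule compute_rows_step[of n ?par k c w]; use par k(1,2) R w(1,2) in simp)+
    then have "?I (Suc i) t'"
      using I unfolding w(3-5) k(3) k_def[symmetric] by auto
    then show "?I (Suc i) (sem ?body (set_loc Scal vi i t))" unfolding t'_def .
  next
    show "eval (Minus (Var vn) (Num 1)) (store s) = n - 1" using n by (simp add: m_def)
    show "?I 0 (s\<lparr>ticks := Suc (ticks s)\<rparr>)" using R by (simp add: m_def)
  qed
  have n1: "n - (n - 1) = 1" using n by simp
  show R1: "rows_ok n ?par c 1 (store t)" using I n1 by simp
  \<comment> \<open>Only position 0 is left and carries the whole total, so the final potential is
    \<open>57 * n ^ 2\<close>.\<close>
  then have "store t (Size, 0) = n" by (simp add: rows_ok_def)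
  then have "ticks t \<le> ticks s + 1 + 7 * (n - 1) + 57 * n ^ 2" using I n1 by simp
  then show "ticks t \<le> ticks s + 1 + 7 * n + 57 * n ^ 2" by linarith
  have "(n - 1) * (2 * n + 1) \<le> n * (2 * n + 1)" by (rule mult_le_mono1) simp
  then show "store t (Scal, vtop) \<le> m (Scal, vtop) + n * (2 * n + 1)" using I by linarith
qed

section \<open>Reading off an optimal subgraph\<close>

lemma select_best_correct:
  fixes s
  defines "m \<equiv> store s" and "t \<equiv> sem select_best s"
  defines "cell \<equiv> \<lambda>v. m (Base, v) + m (Size, v)"
  assumes m: "m (Scal, vn) = n" "m (Scal, vbest) = 0"
  shows "\<And>v. v < n \<Longrightarrow> m (Best, cell v) \<le> store t (Scal, vbest)"
    "0 < store t (Scal, vbest) \<Longrightarrow>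
      \<exists>v<n. store t (Scal, vroot) = cell v \<and> m (Best, cell v) = store t (Scal, vbest)"
    "ticks t \<le> ticks s + 1 + 5 * n"
proof -
  let ?body = "vcell ::= Plus (Fetch Base (Var vi)) (Fetch Size (Var vi)) ;;
        Cond (Minus (Fetch Best (Var vcell)) (Var vbest))
          (vbest ::= Fetch Best (Var vcell) ;; vroot ::= Var vcell)
          Skip"
  let ?I = "\<lambda>i (t :: state). ticks t \<le> ticks s + 1 + 5 * i \<and>
    (\<forall>v<i. m (Best, cell v) \<le> store t (Scal, vbest)) \<and>
    (0 < store t (Scal, vbest) \<longrightarrow>
      (\<exists>v<i. store t (Scal, vroot) = cell v \<and> m (Best, cell v) = store t (Scal, vbest)))"
  have "?I n t"
    unfolding t_def select_best_def
  proof (rule For_rule[where I = ?I])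
    fix i t
    assume i: "i < n" and I: "?I i t"
      and fr: "\<And>a j. keeps a j (For vi (Var vn) ?body) \<Longrightarrow> store t (a, j) = store s (a, j)"
    have u: "store t (Base, v) = m (Base, v)" "store t (Size, v) = m (Size, v)"
      "store t (Best, v) = m (Best, v)" for v
      using fr[of _ v] by (simp_all add: m_def)
    define t' where "t' = sem ?body (set_loc Scal vi i t)"
    have "?I (Suc i) t'"
    proof (cases "m (Best, cell i) > store t (Scal, vbest)")
      case True
      then have t': "store t' (Scal, vbest) = m (Best, cell i)" "store t' (Scal, vroot) = cell i"
        "ticks t' = ticks t + 5"
        by (simp_all add: u cell_def t'_def)
      have "m (Best, cell v) \<le> m (Best, cell i)" if "v < Suc i" for v
      proof (cases "v = i")
        case False
        then have "v < i" using that by simp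
        then have "m (Best, cell v) \<le> store t (Scal, vbest)" using I by blast
        with True show ?thesis by linarith
      qed simp
      then show ?thesis using I unfolding t' by auto
    next
      case False
      then have t': "store t' (Scal, vbest) = store t (Scal, vbest)"
        "store t' (Scal, vroot) = store t (Scal, vroot)" "ticks t' = ticks t + 3"
        by (simp_all add: u cell_def t'_def)
      have "m (Best, cell v) \<le> store t (Scal, vbest)" if "v < Suc i" for v
        using that I False by (cases "v = i") auto
      then show ?thesis using I less_SucI unfolding t' by (intro conjI) (simp, blast, blast)
    qed
    then show "?I (Suc i) (sem ?body (set_loc Scal vi i t))" unfolding t'_def .
  qed (use m in \<open>simp_all add: m_def\<close>)
  then show "\<And>v. v < n \<Longrightarrow> m (Best, cell v) \<le> store t (Scal, vbest)"
    "0 < store t (Scal, vbest) \<Longrightarrow>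
      \<exists>v<n. store t (Scal, vroot) = cell v \<and> m (Best, cell v) = store t (Scal, vbest)"
    "ticks t \<le> ticks s + 1 + 5 * n" by blast+
qed

text \<open>The selected positions together with the sets of all marked entries still to be visited
  always make up the result. A visit replaces an entry by its two smaller entries or by its single
  position, which leaves this union unchanged.\<close>

lemma mark_cells_correct:
  fixes s
  defines "m \<equiv> store s" and "t \<equiv> sem mark_cells s"
  defines "cs \<equiv> cell_set (\<lambda>a. m (Lft, a)) (\<lambda>a. m (Rgt, a))"
  assumes hp: "m (Scal, vtop) = hp" "0 < m (Scal, vbest) \<Longrightarrow> m (Scal, vroot) < hp"
    and ptr: "\<And>a. 0 < m (Rgt, a) \<Longrightarrow> m (Lft, a) < a \<and> m (Rgt, a) < a"
    and zero: "\<And>a. m (Mark, a) = 0" "\<And>a. m (Sel, a) = 0"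
  shows "{v. 0 < store t (Sel, v)} = (if 0 < m (Scal, vbest) then cs (m (Scal, vroot)) else {})"
    "ticks t \<le> ticks s + 3 + 6 * hp"
proof -
  let ?S = "if 0 < m (Scal, vbest) then cs (m (Scal, vroot)) else {}"
  let ?body = "vcell ::= Minus (Minus (Var vtop) (Num 1)) (Var vi) ;;
        Cond (Fetch Mark (Var vcell))
          (Cond (Fetch Rgt (Var vcell))
             (Assign Mark (Fetch Lft (Var vcell)) (Num 1) ;;
              Assign Mark (Fetch Rgt (Var vcell)) (Num 1))
             (Assign Sel (Fetch Lft (Var vcell)) (Num 1)))
          Skip"
  define s1 where "s1 = sem (Cond (Var vbest) (Assign Mark (Var vroot) (Num 1)) Skip) s"
  let ?I = "\<lambda>i (t :: state). ticks t \<le> ticks s + 3 + 6 * i \<and>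
    {v. 0 < store t (Sel, v)} \<union> (\<Union>a\<in>{a. a < hp - i \<and> 0 < store t (Mark, a)}. cs a) = ?S"
  have "?I hp (sem (For vi (Var vtop) ?body) s1)"
  proof (rule For_rule[where I = ?I])
    fix i t
    assume i: "i < hp" and I: "?I i t"
      and fr: "\<And>a j. keeps a j (For vi (Var vtop) ?body) \<Longrightarrow> store t (a, j) = store s1 (a, j)"
    have u: "store t (Lft, v) = m (Lft, v)" "store t (Rgt, v) = m (Rgt, v)"
      "store t (Scal, vtop) = hp" for v
      using fr[of _ v] fr[of Scal vtop] hp(1) by (simp_all add: m_def s1_def)
    define c where "c = hp - Suc i"
    have c: "hp - i = Suc c" "hp - Suc 0 - i = c" using i by (auto simp: c_def)
    define t' where "t' = sem ?body (set_loc Scal vi i t)"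
    have I: "ticks t \<le> ticks s + 3 + 6 * i"
      "{v. 0 < store t (Sel, v)} \<union> (\<Union>a\<in>{a. a < Suc c \<and> 0 < store t (Mark, a)}. cs a) = ?S"
      using I unfolding c(1) by blast+
    have "?I (Suc i) t'"
    proof (cases "0 < store t (Mark, c)")
      case False
      then have "{a. a < Suc c \<and> 0 < store t (Mark, a)} = {a. a < c \<and> 0 < store t (Mark, a)}"
        by (auto simp: less_Suc_eq)
      then show ?thesis using I False u c unfolding c_def[symmetric] by (simp add: t'_def)
    next
      case marked: True
      have old: "{a. a < Suc c \<and> 0 < store t (Mark, a)} = insert c {a. a < c \<and> 0 < store t (Mark, a)}"
        using marked by (auto simp: less_Suc_eq)
      show ?thesis
      proof (cases "0 < m (Rgt, c)")
        case True
        let ?l = "m (Lft, c)" and ?r = "m (Rgt, c)"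
        have lr: "?l < c" "?r < c" using ptr[OF True] by auto
        have csc: "cs c = cs ?l \<union> cs ?r"
          unfolding cs_def using True lr by (subst cell_set.simps) simp
        have t': "store t' (Sel, v) = store t (Sel, v)"
          "store t' (Mark, v) = (if v = ?l \<or> v = ?r then 1 else store t (Mark, v))"
          "ticks t' = ticks t + 6" for v
          using True marked u c by (simp_all add: t'_def)
        have "{a. a < c \<and> 0 < store t' (Mark, a)} = insert ?l (insert ?r {a. a < c \<and> 0 < store t (Mark, a)})"
          using lr by (auto simp: t')
        then have "(\<Union>a\<in>{a. a < c \<and> 0 < store t' (Mark, a)}. cs a) =
            (\<Union>a\<in>{a. a < Suc c \<and> 0 < store t (Mark, a)}. cs a)"
          unfolding old by (simp add: csc Un_assoc)
        then show ?thesis using I unfolding c_def[symmetric] by (simp add: t')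
      next
        case False
        have csc: "cs c = {m (Lft, c)}"
          unfolding cs_def using False by (subst cell_set.simps) simp
        have t': "store t' (Sel, v) = (if v = m (Lft, c) then 1 else store t (Sel, v))"
          "store t' (Mark, v) = store t (Mark, v)" "ticks t' = ticks t + 5" for v
          using False marked u c by (simp_all add: t'_def)
        have "{v. 0 < store t' (Sel, v)} = insert (m (Lft, c)) {v. 0 < store t (Sel, v)}"
          by (auto simp: t')
        then show ?thesis using I unfolding c_def[symmetric] old by (simp add: t' csc)
      qed
    qed
    then show "?I (Suc i) (sem ?body (set_loc Scal vi i t))" unfolding t'_def .
  next
    show "eval (Var vtop) (store s1) = hp" using hp(1) by (simp add: s1_def m_def)
    have "{a. a < hp \<and> 0 < store s1 (Mark, a)} = (if 0 < m (Scal, vbest) then {m (Scal, vroot)} else {})"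
      using zero hp(2) by (auto simp: s1_def m_def)
    moreover have "store s1 (Sel, v) = 0" for v using zero by (simp add: s1_def m_def)
    moreover have "ticks s1 \<le> ticks s + 2" by (simp add: s1_def)
    ultimately show "?I 0 (s1\<lparr>ticks := Suc (ticks s1)\<rparr>)" by simp
  qed
  moreover have "sem (For vi (Var vtop) ?body) s1 = t"
    by (simp only: t_def mark_cells_def s1_def sem.simps(3))
  ultimately have "?I hp t" by simp
  then show "{v. 0 < store t (Sel, v)} = ?S" "ticks t \<le> ticks s + 3 + 6 * hp" by simp_all
qed

lemma print_selected_correct:
  fixes s
  defines "m \<equiv> store s" and "t \<equiv> sem print_selected s"
  assumes m: "m (Scal, vn) = n" and "ok s"
  shows "tape_out t = tape_out s @ map (\<lambda>i. m (Ord, i)) (filter (\<lambda>i. 0 < m (Sel, i)) [0..<n])"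
    "ok t" "ticks t \<le> ticks s + 1 + 3 * n"
proof -
  let ?body = "Cond (Fetch Sel (Var vi)) (Put (Fetch Ord (Var vi))) Skip"
  let ?I = "\<lambda>i (t :: state). ticks t \<le> ticks s + 1 + 3 * i \<and> ok t \<and>
    tape_out t = tape_out s @ map (\<lambda>i. m (Ord, i)) (filter (\<lambda>i. 0 < m (Sel, i)) [0..<i])"
  have "?I n t"
    unfolding t_def print_selected_def
  proof (rule For_rule[where I = ?I])
    fix i t
    assume i: "i < n" and I: "?I i t"
      and fr: "\<And>a j. keeps a j (For vi (Var vn) ?body) \<Longrightarrow> store t (a, j) = store s (a, j)"
    have "store t (Ord, v) = m (Ord, v)" "store t (Sel, v) = m (Sel, v)" for v
      using fr[of _ v] by (simp_all add: m_def)
    then show "?I (Suc i) (sem ?body (set_loc Scal vi i t))" using I by simp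
  qed (use assms in simp_all)
  then show "tape_out t = tape_out s @ map (\<lambda>i. m (Ord, i)) (filter (\<lambda>i. 0 < m (Sel, i)) [0..<n])"
    "ok t" "ticks t \<le> ticks s + 1 + 3 * n" by blast+
qed

section \<open>The whole program\<close>

lemma bcs_program_correct:
  assumes tree: "is_tree {..<n} E" and enc: "encodes_graph xs n E col"
  defines "t \<equiv> sem bcs_program \<lparr>store = \<lambda>_. 0, tape_in = xs, tape_out = [], ticks = 0, ok = True\<rparr>"
  shows "ok t" "ticks t \<le> 20 + 56 * n + 76 * n ^ 2" "distinct (tape_out t)"
    "bcs_solution {..<n} E col (set (tape_out t))"
proof -
  define s0 where "s0 = \<lparr>store = \<lambda>_. 0, tape_in = xs, tape_out = [], ticks = 0, ok = True\<rparr>"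
  define s1 where "s1 = sem read_input s0"
  define s2 where "s2 = sem compute_order s1"
  define s3 where "s3 = sem init_rows s2"
  define s4 where "s4 = sem compute_rows s3"
  define s5 where "s5 = sem select_best s4"
  define s6 where "s6 = sem mark_cells s5"
  define s7 where "s7 = sem print_selected s6"
  have t: "t = s7"
    by (simp only: t_def bcs_program_def sem.simps(3) s0_def s1_def s2_def s3_def s4_def s5_def s6_def s7_def)
  note defs = read_input_def compute_order_def find_crossing_def init_rows_def compute_rows_def
    merge_rows_def merge_inner_def relax_def select_best_def mark_cells_def
  from enc obtain es where es: "distinct (map (\<lambda>(u, v). {u, v}) es)"
    "set (map (\<lambda>(u, v). {u, v}) es) = E"
    "xs = [n, length es] @ map (\<lambda>v. colour_code (col v)) [0..<n] @ concat (map (\<lambda>(u, v). [u, v]) es)"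
    unfolding encodes_graph_def by blast
  have "0 < n" using tree by (auto simp: is_tree_def connected_graph_def)
  have z1: "store s1 (a, i) = 0" if "a \<notin> {Scal, Colr, EndA, EndB}" for a i
  proof -
    have "keeps a i read_input" using that by (auto simp: defs)
    then show ?thesis by (simp add: s1_def s0_def keeps_store)
  qed
  have v1: "store s1 (Scal, i) = 0" if "i \<notin> {vn, vm, vi, vj}" for i
  proof -
    have "keeps Scal i read_input" using that by (auto simp: defs)
    then show ?thesis by (simp add: s1_def s0_def keeps_store)
  qed
  have "tape_in s0 = [n, length es] @ map (\<lambda>v. colour_code (col v)) [0..<n] @ concat (map (\<lambda>(u, v). [u, v]) es)"
    "ok s0" using es(3) by (simp_all add: s0_def)
  note r1 = read_input_correct[OF this, folded s1_def]
  define ord where "ord = (\<lambda>i. store s2 (Ord, i))"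
  define par where "par = (\<lambda>i. store s2 (Par, i))"
  have r2: "tree_order n E ord par" "ticks s2 \<le> ticks s1 + 2 + n * (5 + 7 * length es)"
    unfolding ord_def par_def s2_def
    by (rule compute_order_correct[OF tree r1(1,2,4) _ _ es(2)]; simp add: z1)+
  have bij: "bij_betw ord {..<n} {..<n}" and par: "\<And>i. 0 < i \<Longrightarrow> i < n \<Longrightarrow> par i < i"
    using r2(1) by (auto simp: tree_order_def)
  have inj: "inj_on ord {..<n}" using bij by (simp add: bij_betw_def)
  \<comment> \<open>The listed edges are distinct and each is the parent edge of a nonzero position.
    So the edge list is linear in \<open>n\<close>, and the scans for crossing edges are quadratic
    in total.\<close>
  have "length es = card E"
    using distinct_card[OF es(1)] es(2) by simp
  also have "\<dots> \<le> card {0<..<n}"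
    unfolding tree_order_edges[OF tree r2(1)] by (rule card_image_le) simp
  finally have len: "length es \<le> n" by simp
  have k2: "store s2 (Scal, vn) = n" "store s2 (Best, i) = 0" "store s2 (Rgt, i) = 0"
    "store s2 (Colr, i) = store s1 (Colr, i)" for i
    using r1(1) by (simp_all add: s2_def keeps_store defs z1 del: sem.simps)
  have ordn: "store s2 (Ord, i) < n" if "i < n" for i
    using bij that by (auto simp: ord_def bij_betw_def)
  let ?c = "\<lambda>i. col (ord i)"
  have r3: "rows_ok n par ?c n (store s3)" "store s3 (Scal, vtop) = 1 + 3 * n"
    "ticks s3 \<le> ticks s2 + 2 + 7 * n"
    unfolding ord_def s3_def
    by (rule init_rows_correct; use k2 ordn r1(3) in simp)+
  have k3: "store s3 (Par, i) = par i" "store s3 (Ord, i) = ord i" "store s3 (Scal, vn) = n" for i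
    using k2(1) by (simp_all add: s3_def par_def ord_def keeps_store defs del: sem.simps)
  have r4: "rows_ok n par ?c 1 (store s4)" "ticks s4 \<le> ticks s3 + 1 + 7 * n + 57 * n ^ 2"
    "store s4 (Scal, vtop) \<le> store s3 (Scal, vtop) + n * (2 * n + 1)"
    using compute_rows_correct[of n s3 ?c, folded s4_def] par \<open>0 < n\<close> r3(1) k3 by simp_all
  have k4: "store s4 (Scal, vn) = n" "store s4 (Scal, vbest) = 0" "store s4 (Ord, i) = ord i"
    "store s4 (Mark, i) = 0" "store s4 (Sel, i) = 0" for i
    using k3 by (simp_all add: s4_def s3_def s2_def keeps_store defs z1 v1 del: sem.simps)
  define m where "m = store s4"
  define cs where "cs = cell_set (\<lambda>a. m (Lft, a)) (\<lambda>a. m (Rgt, a))"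
  define cell where "cell v = m (Base, v) + m (Size, v)" for v
  note r5 = select_best_correct[OF k4(1,2), folded s5_def m_def, folded cell_def]
  have k5: "store s5 (Lft, i) = m (Lft, i)" "store s5 (Rgt, i) = m (Rgt, i)"
    "store s5 (Scal, vtop) = m (Scal, vtop)" "store s5 (Mark, i) = 0" "store s5 (Sel, i) = 0"
    "store s5 (Ord, i) = ord i" "store s5 (Scal, vn) = n" for i
    using k4 by (simp_all add: s5_def m_def keeps_store defs del: sem.simps)
  have row: "m (Base, v) + 2 * m (Size, v) < m (Scal, vtop)"
    "row_ok n par ?c 1 v (m (Size, v)) (\<lambda>x. m (Best, m (Base, v) + x)) (\<lambda>x. cs (m (Base, v) + x))"
    if "v < n" for v
    using r4(1) that unfolding rows_ok_def m_def cs_def by blast+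
  have ptr: "m (Lft, a) < a \<and> m (Rgt, a) < a" if "0 < m (Rgt, a)" for a
    using r4(1) that unfolding rows_ok_def m_def by blast
  let ?best = "store s5 (Scal, vbest)" and ?root = "store s5 (Scal, vroot)"
  define S where "S = (if 0 < ?best then cs ?root else {})"
  have root: "?root < m (Scal, vtop)" if "0 < ?best"
    using r5(2)[OF that] row(1) by (force simp: cell_def)
  have r6: "{v. 0 < store s6 (Sel, v)} = S" "ticks s6 \<le> ticks s5 + 3 + 6 * m (Scal, vtop)"
    using mark_cells_correct[of s5 "m (Scal, vtop)", folded s6_def] root ptr
    by (simp_all add: k5 S_def cs_def)
  have k6: "store s6 (Ord, i) = ord i" "store s6 (Scal, vn) = n" for i
    using k5 by (simp_all add: s6_def keeps_store defs del: sem.simps)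
  have "\<not> prints (read_input ;; compute_order ;; init_rows ;; compute_rows ;; select_best ;; mark_cells)"
    by (simp add: defs)
  from prints_sem[OF this, of s0] have "tape_out s6 = []"
    by (simp only: sem.simps(3) s1_def s2_def s3_def s4_def s5_def s6_def) (simp add: s0_def)
  moreover have "\<not> reads (compute_order ;; init_rows ;; compute_rows ;; select_best ;; mark_cells)"
    by (simp add: defs)
  from reads_sem[OF this, of s1] have "ok s6"
    using r1(5) by (simp only: sem.simps(3) s2_def s3_def s4_def s5_def s6_def)
  ultimately have ok6: "ok s6" "tape_out s6 = []" by simp_all
  have r7: "tape_out s7 = map ord (filter (\<lambda>i. 0 < store s6 (Sel, i)) [0..<n])" "ok s7"
    "ticks s7 \<le> ticks s6 + 1 + 3 * n"
    using print_selected_correct[OF k6(2) ok6(1), folded s7_def] by (simp_all add: ok6 k6)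
  show "ok t" using r7(2) t by simp
  show "distinct (tape_out t)"
    unfolding t r7(1) using inj by (auto simp: distinct_map intro: inj_on_subset)
  have S: "S = {} \<or> (\<exists>v. rooted n par 1 v S)" "balance ?c S = 0" "card S = ?best"
  proof -
    \<comment> \<open>If every entry for balance 0 has value 0, no nonempty set is feasible, and the
      empty set is the answer.\<close>
    have "(S = {} \<or> (\<exists>v. rooted n par 1 v S)) \<and> balance ?c S = 0 \<and> card S = ?best"
    proof (cases "0 < ?best")
      case True
      from r5(2)[OF True] obtain v where v: "v < n" "?root = cell v" "m (Best, cell v) = ?best" by blast
      have "rooted n par 1 v (cs (cell v))" "card (cs (cell v)) = ?best" "balance ?c (cs (cell v)) = 0"
        using row(2)[OF v(1), unfolded row_ok_def, THEN conjunct2, rule_format, of "m (Size, v)"]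
          v(3) True by (simp_all add: cell_def)
      then show ?thesis using True v by (auto simp: S_def)
    qed (simp add: S_def balance_def)
    then show "S = {} \<or> (\<exists>v. rooted n par 1 v S)" "balance ?c S = 0" "card S = ?best" by blast+
  qed
  have "card U \<le> card S" if "rooted n par 1 v U" "balance ?c U = 0" for v U
  proof -
    have "v < n" using that(1) by (auto simp: rooted_def)
    then have "card U \<le> m (Best, cell v)"
      using row(2)[of v, unfolded row_ok_def, THEN conjunct1, rule_format, of U] that
      by (simp add: cell_def)
    also have "\<dots> \<le> ?best" using r5(1) \<open>v < n\<close> .
    finally show ?thesis using S(3) by simp
  qed
  then have "bcs_solution {..<n} E col (ord ` S)"
    using optimal_rooted_solution[OF tree r2(1) S(1,2)] by blast
  moreover have "S \<subseteq> {..<n}" using S(1) by (auto simp: rooted_def)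
  then have "set (tape_out t) = ord ` S"
    unfolding t r7(1) using r6(1) by auto
  ultimately show "bcs_solution {..<n} E col (set (tape_out t))" by simp
  have "ticks s1 \<le> 4 + 2 * n + 3 * n"
    using r1(6) len by (simp add: s0_def)
  moreover have "n * (5 + 7 * length es) \<le> n * (5 + 7 * n)" using len by simp
  ultimately have "ticks s2 \<le> 4 + 2 * n + 3 * n + 2 + n * (5 + 7 * n)"
    using r2(2) by linarith
  then have "ticks s2 \<le> 6 + 10 * n + 7 * n ^ 2" by (simp add: algebra_simps power2_eq_square)
  \<comment> \<open>The initial rows take \<open>3 * n\<close> addresses, and fewer than
    \<open>n\<close> merges add at most \<open>2 * n + 1\<close> each.\<close>
  moreover have "m (Scal, vtop) \<le> 1 + 4 * n + 2 * n ^ 2"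
    using r3(2) r4(3) by (simp add: m_def algebra_simps power2_eq_square)
  ultimately show "ticks t \<le> 20 + 56 * n + 76 * n ^ 2"
    unfolding t using r3(3) r4(2) r5(3) r6(2) r7(3) by linarith
qed

theorem theorem1:
  shows "\<exists>(P :: instr list) (t :: nat \<Rightarrow> nat).
    (\<lambda>n. real (t n)) \<in> O(\<lambda>n. real n ^ 2) \<and>
    (\<forall>(n :: nat) (E :: nat set set) (col :: nat \<Rightarrow> colour) (xs :: nat list).
       is_tree {..<n} E \<longrightarrow> encodes_graph xs n E col \<longrightarrow>
       (\<exists>k ys. ram_computes P xs k ys \<and> k \<le> t n \<and>
               distinct ys \<and> bcs_solution {..<n} E col (set ys)))"
proof -
  define P where "P = compile bcs_program 0 0"
  define t where "t = (\<lambda>n :: nat. length P * (20 + 56 * n + 76 * n ^ 2))"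
  \<comment> \<open>For \<open>n \<ge> 1\<close> each monomial is at most \<open>n ^ 2\<close>, and
    152 is the sum of the coefficients 20, 56 and 76.\<close>
  have "t n \<le> length P * 152 * n ^ 2" if "1 \<le> n" for n
  proof -
    have "n \<le> n ^ 2" "1 \<le> n ^ 2" using that by (simp_all add: power2_eq_square)
    then have "20 + 56 * n + 76 * n ^ 2 \<le> 152 * n ^ 2" by linarith
    then have "length P * (20 + 56 * n + 76 * n ^ 2) \<le> length P * (152 * n ^ 2)"
      by (rule mult_le_mono2)
    then show ?thesis by (simp add: t_def mult.assoc)
  qed
  then have "\<forall>\<^sub>F n in sequentially. t n \<le> length P * 152 * n ^ 2"
    by (rule eventually_sequentiallyI)
  then have "(\<lambda>n. real (t n)) \<in> O(\<lambda>n. real n ^ 2)"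
    by (intro bigoI[where c = "real (length P * 152)"])
       (elim eventually_mono, simp flip: of_nat_power of_nat_mult add: of_nat_le_iff)
  moreover have "\<exists>k ys. ram_computes P xs k ys \<and> k \<le> t n \<and> distinct ys \<and>
      bcs_solution {..<n} E col (set ys)"
    if "is_tree {..<n} E" "encodes_graph xs n E col" for n E col xs
  proof -
    note c = bcs_program_correct[OF that]
    from compiled_program[OF c(1)] obtain k where
      "ram_computes P xs k (tape_out (sem bcs_program
         \<lparr>store = \<lambda>_. 0, tape_in = xs, tape_out = [], ticks = 0, ok = True\<rparr>))"
      "k \<le> length P * ticks (sem bcs_program
         \<lparr>store = \<lambda>_. 0, tape_in = xs, tape_out = [], ticks = 0, ok = True\<rparr>)"
      unfolding P_def by blast
    moreover from this(2) have "k \<le> t n"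
      unfolding t_def using c(2) by (meson le_trans mult_le_mono2)
    ultimately show ?thesis using c(3,4) by blast
  qed
  ultimately show ?thesis by blast
qed

end
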